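(* There exist a finite set $\mathcal S\subset\mathbb R^2$ and four sets $\mathcal C_1,\mathcal C_2,\mathcal C_3,\mathcal C_4\subset\mathbb R^2$, where $\mathcal C_1$ and $\mathcal C_2$ are connected closed curves and $\mathcal C_3$ and $\mathcal C_4$ are disconnected finite unions of pairwise disjoint closed curves, such that $\mathcal S$ is a $0.72$-sample of each $\mathcal C_i$ and $G_{\mathcal C_i}(\mathcal S)\ne G_{\mathcal C_j}(\mathcal S)$ for all $i\ne j$.
   Context: A closed curve is the image of an injective continuous map $S^1\to\mathbb R^2$. For a finite union $\mathcal C$ of pairwise disjoint closed curves, the medial axis $\mathcal M$ is the set of points of $\mathbb R^2$ without a unique closest point in $\mathcal C$, $\mathrm{lfs}(p)=d(p,\mathcal M)$, and a finite $\mathcal S\subset\mathcal C$ is an $\epsilon$-sample of $\mathcal C$ if $d(p,\mathcal S)<\epsilon\,\mathrm{lfs}(p)$ for all $p\in\mathcal C$. For sample points, $a\to b$ means: for some orientation of the component of $\mathcal C$ containing $a,b$, moving from $a$ along the orientation, the next sample point met is $b$; $a,b$ are consecutive if $a\to b$ or $b\to a$. $G_{\mathcal C}(\mathcal S)$ is the graph on $\mathcal S$ with an edge $\{a,b\}$ iff $a,b$ are consecutive. *)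

theory Defs
  imports "HOL-Analysis.Analysis"
begin

definition closed_curve :: "(real^2) set \<Rightarrow> bool" where
  "closed_curve C \<longleftrightarrow>
     (\<exists>f :: real^2 \<Rightarrow> real^2. continuous_on (sphere 0 1) f \<and> inj_on f (sphere 0 1)
        \<and> C = f ` sphere 0 1)"

definition curve_union :: "(real^2) set \<Rightarrow> bool" where
  "curve_union C \<longleftrightarrow>
     (\<exists>F. finite F \<and> (\<forall>K\<in>F. closed_curve K) \<and> pairwise disjnt F \<and> C = \<Union>F)"

definition medial_axis :: "(real^2) set \<Rightarrow> (real^2) set" where
  "medial_axis C = {p. \<not> (\<exists>!c. c \<in> C \<and> (\<forall>c'\<in>C. dist p c \<le> dist p c'))}"

definition lfs :: "(real^2) set \<Rightarrow> real^2 \<Rightarrow> real" where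
  "lfs C p = infdist p (medial_axis C)"

definition eps_sample :: "(real^2) set \<Rightarrow> (real^2) set \<Rightarrow> real \<Rightarrow> bool" where
  "eps_sample C S \<epsilon> \<longleftrightarrow>
     finite S \<and> S \<subseteq> C \<and> (\<forall>p\<in>C. infdist p S < \<epsilon> * lfs C p)"

text \<open>a \<rightarrow> b: on the component K of C containing a and b, there is a simple arc
  (a simple closed loop if a = b) in K from a to b, traversing K in one orientation,
  whose interior contains no sample point; i.e. b is the next sample point after a.\<close>
definition next_sample :: "(real^2) set \<Rightarrow> (real^2) set \<Rightarrow> real^2 \<Rightarrow> real^2 \<Rightarrow> bool" where
  "next_sample C S a b \<longleftrightarrow> a \<in> S \<and> b \<in> S \<and>
     (\<exists>K\<in>components C. a \<in> K \<and> b \<in> K \<and>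
        (\<exists>g. simple_path g \<and> pathstart g = a \<and> pathfinish g = b \<and> path_image g \<subseteq> K
             \<and> g ` {0<..<1} \<inter> S = {}))"

definition consecutive :: "(real^2) set \<Rightarrow> (real^2) set \<Rightarrow> real^2 \<Rightarrow> real^2 \<Rightarrow> bool" where
  "consecutive C S a b \<longleftrightarrow> next_sample C S a b \<or> next_sample C S b a"

definition sample_graph :: "(real^2) set \<Rightarrow> (real^2) set \<Rightarrow> (real^2) set \<times> (real^2) set set" where
  "sample_graph C S = (S, {{a, b} | a b. a \<in> S \<and> b \<in> S \<and> consecutive C S a b})"

end

theory Submission
  imports Defs
begin

text \<open>
  The basic gadget is a regular octagon from whose vertices eight strands leave radially; a curve can
  join the strands in pairs along the even or along the odd sides of the octagon. The joining arcs
  overshoot the strand lines, so that the curve is wide where no sample point can lie, and the two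
  ways of joining are mirror images of each other in every strand line; the crossing points of
  curve and strand lines are the samples. Two gadgets, mirror images of each other, are connected by eight
  common strands, which can be sampled as densely as desired. Of the four resulting sets, the two that
  use different parities at the two gadgets are single closed curves, and the two that use equal
  parities have four components.

  A bound for the medial axis near a gadget is obtained by folding with the reflections of the
  octagon: it suffices to understand the nearest points on one smooth chain of circular arcs inside
  a fundamental domain. There uniqueness only depends on the position of the point relative
  to the normals of the chain at the joints.
\<close>

section \<open>Unique nearest points along smooth chains\<close>

text \<open>Near a gadget the same samples have to be dense for two different resolutions, and the
  margin below 0.72 is thin; only there are explicit lower bounds on the local feature size
  computed. On rays and strands, which all four curves share, any positive bound suffices:
  compactness turns it into one finite net fine enough for all of them. Positivity needs smoothness
  at every joint, since at a corner the local feature size is 0; this is why the strands continue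
  the rays tangentially.

  The graphs are told apart locally, independently of the number of components. On two neighbouring
  strand lines, the samples nearest to the centre are consecutive if the pocket between the lines
  belongs to the parity in use. In the other parity they lie in different pockets, and a pocket
  meets the rest of the curve only in its ports, which are samples as well. One such pair per gadget
  reads off the parity of that gadget, so two pairs distinguish four graphs.\<close>

definition nearest :: "'a::metric_space \<Rightarrow> 'a set \<Rightarrow> 'a \<Rightarrow> bool" where
  "nearest q X z \<longleftrightarrow> z \<in> X \<and> (\<forall>x\<in>X. x \<noteq> z \<longrightarrow> dist q z < dist q x)"

lemma nearest_imageI:
  "t \<in> I \<Longrightarrow> (\<And>s. s \<in> I \<Longrightarrow> s \<noteq> t \<Longrightarrow> dist q (P t) < dist q (P s)) \<Longrightarrow> nearest q (P ` I) (P t)"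
  unfolding nearest_def by blast

text \<open>The shared point \<open>B\<close> stands for all of \<open>X\<close>: no point of
  \<open>X\<close> is closer, and \<open>Y\<close> already compares it with
  \<open>z\<close>.\<close>

lemma nearest_join_left: "nearest q X B \<Longrightarrow> nearest q Y z \<Longrightarrow> B \<in> Y \<Longrightarrow> nearest q (X \<union> Y) z"
  unfolding nearest_def by (metis UnCI UnE less_trans)

lemma nearest_join_right: "nearest q X z \<Longrightarrow> nearest q Y B \<Longrightarrow> B \<in> X \<Longrightarrow> nearest q (X \<union> Y) z"
  unfolding nearest_def by (metis UnCI UnE less_trans)

lemma nearest_notin_medial: "nearest q C z \<Longrightarrow> q \<notin> medial_axis C"
  unfolding nearest_def medial_axis_def
  by (simp, metis less_eq_real_def linorder_not_le order_refl)

text \<open>In use, \<open>S\<close> and \<open>T\<close> are the unit tangents at the ends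
  \<open>A\<close> and \<open>B\<close>, and the inner products are half the derivative of the
  squared distance from \<open>q\<close> along the piece there. The pattern nonnegative at
  \<open>A\<close>, nonpositive at \<open>B\<close> is left open: it is the one that allows an
  interior maximum of the distance.\<close>

definition smooth_piece :: "complex set \<Rightarrow> complex \<Rightarrow> complex \<Rightarrow> complex \<Rightarrow> complex \<Rightarrow> bool" where
  "smooth_piece X A S B T \<longleftrightarrow> A \<in> X \<and> B \<in> X \<and> compact X \<and>
     (\<forall>x\<in>X. x \<noteq> A \<longrightarrow> inner (A - x) S < 0) \<and> (\<forall>x\<in>X. x \<noteq> B \<longrightarrow> inner (B - x) T > 0) \<and>
     (\<forall>q. inner (A - q) S < 0 \<and> inner (B - q) T \<le> 0 \<longrightarrow> nearest q X B) \<and>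
     (\<forall>q. inner (A - q) S \<ge> 0 \<and> inner (B - q) T > 0 \<longrightarrow> nearest q X A) \<and>
     (\<forall>q. inner (A - q) S < 0 \<and> inner (B - q) T > 0 \<longrightarrow> (\<exists>z. nearest q X z))"

text \<open>
  Along a piece with centre of curvature \<open>c\<close> the derivative of the squared distance to \<open>q\<close> is
  \<open>2 (c - q) \<bullet> T\<close>, so its sign behaviour is decided at the two ends. If, over the whole chain, it never
  passes from nonnegative to nonpositive, then the distance decreases and afterwards increases.
\<close>

lemma chain_nearest:
  fixes X :: "nat \<Rightarrow> complex set" and A S :: "nat \<Rightarrow> complex"
  assumes pc: "\<And>i. i < n \<Longrightarrow> smooth_piece (X i) (A i) (S i) (A (Suc i)) (S (Suc i))"
    and nb: "\<And>i. i < n \<Longrightarrow> \<not> (inner (A i - q) (S i) \<ge> 0 \<and> inner (A (Suc i) - q) (S (Suc i)) \<le> 0)"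
    and n: "0 < n"
  shows "\<exists>z. nearest q (\<Union>i<n. X i) z" and "inner (A 0 - q) (S 0) \<ge> 0 \<Longrightarrow> nearest q (\<Union>i<n. X i) (A 0)"
proof -
  define l where "l i = inner (A i - q) (S i)" for i
  have nb': "l i \<ge> 0 \<Longrightarrow> l (Suc i) > 0" if "i < n" for i
    using nb[OF that] unfolding l_def by auto
  have p1: "l i < 0 \<Longrightarrow> l (Suc i) \<le> 0 \<Longrightarrow> nearest q (X i) (A (Suc i))" if "i < n" for i
    using pc[OF that] unfolding smooth_piece_def l_def by blast
  have p2: "l i \<ge> 0 \<Longrightarrow> nearest q (X i) (A i)" if "i < n" for i
    using pc[OF that] nb'[OF that] unfolding smooth_piece_def l_def by blast
  have p3: "l i < 0 \<Longrightarrow> l (Suc i) > 0 \<Longrightarrow> \<exists>z. nearest q (X i) z" if "i < n" for i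
    using pc[OF that] unfolding smooth_piece_def l_def by blast
  have mem: "A i \<in> X i \<and> A (Suc i) \<in> X i" if "i < n" for i
    using pc[OF that] unfolding smooth_piece_def by blast
  \<comment> \<open>The invariant splits on signs. A nonpositive derivative at the current end means
    that the distance is still descending, so that end is nearest. A nonnegative one at the start
    means that it ascends from the outset, so the start is nearest and stays so.\<close>
  have main: "(l k \<le> 0 \<longrightarrow> nearest q (\<Union>i<k. X i) (A k)) \<and> (\<exists>z. nearest q (\<Union>i<k. X i) z) \<and>
      (l 0 \<ge> 0 \<longrightarrow> l k > 0 \<and> nearest q (\<Union>i<k. X i) (A 0))" if "0 < k" "k \<le> n" for k
    using that
  proof (induction k)
    case 0 then show ?case by simp
  next
    case (Suc k)
    show ?case
    proof (cases "k = 0")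
      case True
      have k0: "0 < n" using Suc by simp
      show ?thesis using True p1[OF k0] p2[OF k0] p3[OF k0] nb'[OF k0]
        by (simp add: lessThan_Suc) (metis less_le_not_le linorder_not_le)
    next
      case False
      have kn: "k < n" using Suc by simp
      have IH: "l k \<le> 0 \<Longrightarrow> nearest q (\<Union>i<k. X i) (A k)" "\<exists>z. nearest q (\<Union>i<k. X i) z"
        "l 0 \<ge> 0 \<Longrightarrow> l k > 0" "l 0 \<ge> 0 \<Longrightarrow> nearest q (\<Union>i<k. X i) (A 0)"
        using Suc False by auto
      have U: "(\<Union>i<Suc k. X i) = (\<Union>i<k. X i) \<union> X k" by (auto simp: less_Suc_eq)
      have Ak: "A k \<in> (\<Union>i<k. X i)"
        using mem[of "k - 1"] False kn by (intro UN_I[of "k - 1"]) auto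
      have a: "nearest q (\<Union>i<Suc k. X i) (A (Suc k))" if "l (Suc k) \<le> 0"
      proof -
        have lk: "l k < 0" using nb'[OF kn] that by force
        show ?thesis unfolding U
          using nearest_join_left[OF IH(1) p1[OF kn lk that]] lk mem[OF kn] by simp
      qed
      have b: "\<exists>z. nearest q (\<Union>i<Suc k. X i) z"
      proof (cases "l k < 0")
        case True
        then obtain z where "nearest q (X k) z" using p1[OF kn] p3[OF kn] by (meson linorder_not_le)
        then show ?thesis unfolding U using nearest_join_left[OF IH(1)] True mem[OF kn] by force
      next
        case False
        then show ?thesis unfolding U using IH(2) nearest_join_right[OF _ p2[OF kn] Ak]
          by (meson linorder_not_le)
      qed
      have c: "l (Suc k) > 0 \<and> nearest q (\<Union>i<Suc k. X i) (A 0)" if "l 0 \<ge> 0"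
        unfolding U using nearest_join_right[OF IH(4) p2[OF kn] Ak] IH(3) that nb'[OF kn] by simp
      show ?thesis using a b c by blast
    qed
  qed
  show "\<exists>z. nearest q (\<Union>i<n. X i) z" "inner (A 0 - q) (S 0) \<ge> 0 \<Longrightarrow> nearest q (\<Union>i<n. X i) (A 0)"
    using main[OF n] by (auto simp: l_def)
qed

lemma nearest_exists_compact:
  assumes "compact X" "X \<noteq> {}"
    and uq: "\<And>x y. x \<in> X \<Longrightarrow> y \<in> X \<Longrightarrow> \<forall>w\<in>X. dist q x \<le> dist q w \<Longrightarrow> dist q x = dist q y \<Longrightarrow> x = y"
  shows "\<exists>z. nearest q X z"
proof -
  obtain z where z: "z \<in> X" "\<forall>y\<in>X. dist q z \<le> dist q y"
    using continuous_attains_inf[OF assms(1,2), of "dist q"] continuous_on_dist[OF continuous_on_const continuous_on_id]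
    by auto
  then have "nearest q X z" unfolding nearest_def using uq by (metis less_eq_real_def)
  then show ?thesis ..
qed

section \<open>Circular arcs and segments as smooth pieces\<close>

definition circle_arc :: "complex \<Rightarrow> complex \<Rightarrow> real \<Rightarrow> real \<Rightarrow> complex set" where
  "circle_arc o' v s \<tau> = (\<lambda>\<phi>. o' + v * cis (s * \<phi>)) ` {0..\<tau>}"

lemma dist_less_iff_square: "dist p x < dist p y \<longleftrightarrow> (dist p x)\<^sup>2 < (dist p y)\<^sup>2"
  by (meson pos2 power2_less_imp_less power_strict_mono zero_le_dist)

lemma arc_dist2: "(dist q (o' + v * cis \<psi>))\<^sup>2 = (dist q o')\<^sup>2 + (norm v)\<^sup>2 + 2 * inner (o' - q) (v * cis \<psi>)"
proof -
  have "(dist q (o' + v * cis \<psi>))\<^sup>2 = (norm ((o' - q) + v * cis \<psi>))\<^sup>2"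
    by (simp add: dist_norm norm_minus_commute algebra_simps)
  also have "\<dots> = (norm (o' - q))\<^sup>2 + (norm (v * cis \<psi>))\<^sup>2 + 2 * inner (o' - q) (v * cis \<psi>)"
    by (simp add: power2_norm_eq_inner inner_add inner_commute)
  finally show ?thesis by (simp add: norm_mult dist_norm norm_minus_commute)
qed

text \<open>On a circle the squared distance from \<open>q\<close> is a constant plus a sinusoid.
  Over an arc shorter than a half turn, its derivative at an inner angle is a positive combination
  of the two end values, so the signs at the ends control it. By \<open>diff\<close>, differences of
  distances are read off from the derivative at the midpoint angle.\<close>

lemma smooth_piece_arc:
  assumes v: "v \<noteq> 0" and s: "s = 1 \<or> s = -1" and t: "0 < \<tau>" "\<tau> < pi"
  shows "smooth_piece (circle_arc o' v s \<tau>) (o' + v) (of_real s * \<i> * sgn v) (o' + v * cis (s * \<tau>)) (of_real s * \<i> * sgn v * cis (s * \<tau>))"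
proof -
  define X where "X = circle_arc o' v s \<tau>"
  define R where "R = norm v"
  have R: "R > 0" using v by (simp add: R_def)
  have vs: "v = of_real R * sgn v" by (simp add: R_def sgn_eq)
  define P where "P \<phi> = o' + v * cis (s * \<phi>)" for \<phi>
  define T where "T \<phi> = of_real s * \<i> * sgn v * cis (s * \<phi>)" for \<phi>
  have XP: "X = P ` {0..\<tau>}" unfolding X_def circle_arc_def P_def ..
  have P0: "P 0 = o' + v" "T 0 = of_real s * \<i> * sgn v" by (simp_all add: P_def T_def)
  have ss: "s * s = 1" using s by auto
  have n1: "(Re (sgn v))\<^sup>2 + (Im (sgn v))\<^sup>2 = 1" using v
    by (metis cmod_power2 norm_sgn one_power2)
  have innT: "inner (P \<phi> - q) (T \<psi>) = inner (o' - q) (T \<psi>) + R * sin (\<psi> - \<phi>) * (-1)" for \<phi> \<psi> q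
  proof -
    have "inner (v * cis (s * \<phi>)) (T \<psi>) = R * inner (sgn v * cis (s * \<phi>)) (T \<psi>)"
      by (subst vs) (simp add: inner_complex_def algebra_simps)
    also have "inner (sgn v * cis (s * \<phi>)) (T \<psi>) = - s * sin (s * (\<psi> - \<phi>)) * ((Re (sgn v))\<^sup>2 + (Im (sgn v))\<^sup>2)"
      unfolding T_def by (simp add: inner_complex_def right_diff_distrib sin_diff) (algebra)
    also have "\<dots> = - sin (\<psi> - \<phi>)" using s n1 by (auto simp: right_diff_distrib sin_diff)
    finally show ?thesis by (simp add: P_def algebra_simps)
  qed
  have own: "inner (P \<phi> - q) (T \<phi>) = inner (o' - q) (T \<phi>)" for \<phi> q using innT[of \<phi> q \<phi>] by simp
  have PP: "inner (P \<phi> - P \<psi>) (T \<phi>) = R * sin (\<phi> - \<psi>)" for \<phi> \<psi>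
    using innT[of \<psi> "P \<psi>" \<phi>] own[of \<phi> "P \<psi>"] by simp
  have compX: "compact X" unfolding XP P_def
    by (intro compact_continuous_image continuous_intros) auto
  have c1: "inner (P 0 - x) (T 0) < 0" if xX: "x \<in> X" "x \<noteq> P 0" for x
  proof -
    obtain \<phi> where p: "\<phi> \<in> {0..\<tau>}" "x = P \<phi>" using xX XP by auto
    then have "\<phi> > 0" using that by (cases "\<phi> = 0") auto
    then have "sin \<phi> > 0" using p t by (intro sin_gt_zero) auto
    then show ?thesis using PP[of 0 \<phi>] p R by simp
  qed
  have c2: "inner (P \<tau> - x) (T \<tau>) > 0" if xX: "x \<in> X" "x \<noteq> P \<tau>" for x
  proof -
    obtain \<phi> where p: "\<phi> \<in> {0..\<tau>}" "x = P \<phi>" using xX XP by auto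
    then have "\<phi> < \<tau>" using that by (cases "\<phi> = \<tau>") auto
    then have "sin (\<tau> - \<phi>) > 0" using p t by (intro sin_gt_zero) auto
    then show ?thesis using PP[of \<tau> \<phi>] p R by simp
  qed
  \<comment> \<open>with \<open>w = c - q\<close>, the squared distance to the point at angle \<open>\<phi>\<close> is a constant plus \<open>2 R (a cos \<phi> + b sin \<phi>)\<close>\<close>
  have key: "\<exists>a b. (\<forall>\<phi>. inner (o' - q) (T \<phi>) = b * cos \<phi> - a * sin \<phi>) \<and>
      (\<forall>\<phi>. (dist q (P \<phi>))\<^sup>2 = (dist q o')\<^sup>2 + R\<^sup>2 + 2 * R * (a * cos \<phi> + b * sin \<phi>))" for q
  proof (intro exI conjI allI)
    fix \<phi>
    let ?w = "o' - q"
    show "inner ?w (T \<phi>) = inner ?w (T 0) * cos \<phi> - inner ?w (sgn v) * sin \<phi>"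
      unfolding T_def using s by (auto simp: inner_complex_def algebra_simps)
    have "inner ?w (v * cis (s * \<phi>)) = R * inner ?w (sgn v * cis (s * \<phi>))"
      by (subst vs) (simp add: inner_complex_def algebra_simps)
    also have "inner ?w (sgn v * cis (s * \<phi>)) = inner ?w (sgn v) * cos \<phi> + inner ?w (T 0) * sin \<phi>"
      unfolding T_def using s by (auto simp: inner_complex_def algebra_simps)
    finally show "(dist q (P \<phi>))\<^sup>2 = (dist q o')\<^sup>2 + R\<^sup>2 + 2 * R * (inner ?w (sgn v) * cos \<phi> + inner ?w (T 0) * sin \<phi>)"
      unfolding P_def arc_dist2 by (simp add: R_def)
  qed
  have dl: "dist q (P \<phi>) < dist q (P \<psi>) \<longleftrightarrow> a * cos \<phi> + b * sin \<phi> < a * cos \<psi> + b * sin \<psi>"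
    if "\<forall>\<phi>. (dist q (P \<phi>))\<^sup>2 = (dist q o')\<^sup>2 + R\<^sup>2 + 2 * R * (a * cos \<phi> + b * sin \<phi>)" for q a b \<phi> \<psi>
  proof -
    have "dist q (P \<phi>) < dist q (P \<psi>) \<longleftrightarrow> (dist q (P \<phi>))\<^sup>2 < (dist q (P \<psi>))\<^sup>2"
      by (rule dist_less_iff_square)
    then show ?thesis using that R by simp
  qed
  have st: "sin \<tau> > 0" using t by (intro sin_gt_zero) auto
  \<comment> \<open>the derivative interpolates its two end values with positive weights\<close>
  have interp: "sin \<tau> * (b * cos \<phi> - a * sin \<phi>) = b * sin (\<tau> - \<phi>) + (b * cos \<tau> - a * sin \<tau>) * sin \<phi>" for a b \<phi> :: real
    by (simp add: sin_diff algebra_simps)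
  have diff: "(a * cos \<psi> + b * sin \<psi>) - (a * cos \<phi> + b * sin \<phi>) = 2 * sin ((\<psi> - \<phi>) / 2) * (b * cos ((\<phi> + \<psi>) / 2) - a * sin ((\<phi> + \<psi>) / 2))" for a b \<phi> \<psi> :: real
  proof -
    define m d where "m = (\<phi> + \<psi>) / 2" and "d = (\<psi> - \<phi>) / 2"
    have "\<psi> = m + d" "\<phi> = m - d" unfolding m_def d_def by (simp_all add: field_simps)
    moreover have "(a * cos (m + d) + b * sin (m + d)) - (a * cos (m - d) + b * sin (m - d)) = 2 * sin d * (b * cos m - a * sin m)"
      by (simp add: cos_diff sin_diff cos_add sin_add algebra_simps)
    ultimately show ?thesis unfolding m_def d_def by metis
  qed
  have c3: "nearest q X (P \<tau>)" if l: "inner (P 0 - q) (T 0) < 0" "inner (P \<tau> - q) (T \<tau>) \<le> 0" for q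
  proof -
    obtain a b where ab: "\<forall>\<phi>. inner (o' - q) (T \<phi>) = b * cos \<phi> - a * sin \<phi>"
      "\<forall>\<phi>. (dist q (P \<phi>))\<^sup>2 = (dist q o')\<^sup>2 + R\<^sup>2 + 2 * R * (a * cos \<phi> + b * sin \<phi>)" using key by meson
    have b: "b < 0" "b * cos \<tau> - a * sin \<tau> \<le> 0" using l own ab(1) by (metis cos_zero diff_zero mult.right_neutral mult_zero_right sin_zero, metis own ab(1))
    have "dist q (P \<tau>) < dist q (P \<phi>)" if "\<phi> \<in> {0..\<tau>}" "\<phi> \<noteq> \<tau>" for \<phi>
    proof -
      let ?m = "(\<phi> + \<tau>) / 2"
      have "sin (\<tau> - ?m) > 0" "sin ?m > 0" using that t by (auto intro!: sin_gt_zero simp: field_simps)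
      then have "sin \<tau> * (b * cos ?m - a * sin ?m) < 0" unfolding interp using b
        by (smt (verit, best) mult_neg_pos mult_nonpos_nonneg)
      then have "b * cos ?m - a * sin ?m < 0" using st by (simp add: mult_less_0_iff)
      moreover have "sin ((\<tau> - \<phi>) / 2) > 0" using that t by (auto intro!: sin_gt_zero simp: field_simps)
      ultimately have "(a * cos \<tau> + b * sin \<tau>) - (a * cos \<phi> + b * sin \<phi>) < 0"
        unfolding diff by (simp add: mult_less_0_iff)
      then show ?thesis using dl[OF ab(2)] by simp
    qed
    then show ?thesis unfolding XP using t by (intro nearest_imageI) auto
  qed
  have c4: "nearest q X (P 0)" if l: "inner (P 0 - q) (T 0) \<ge> 0" "inner (P \<tau> - q) (T \<tau>) > 0" for q
  proof -
    obtain a b where ab: "\<forall>\<phi>. inner (o' - q) (T \<phi>) = b * cos \<phi> - a * sin \<phi>"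
      "\<forall>\<phi>. (dist q (P \<phi>))\<^sup>2 = (dist q o')\<^sup>2 + R\<^sup>2 + 2 * R * (a * cos \<phi> + b * sin \<phi>)" using key by meson
    have b: "b \<ge> 0" "b * cos \<tau> - a * sin \<tau> > 0" using l own ab(1) by (metis cos_zero diff_zero mult.right_neutral mult_zero_right sin_zero, metis own ab(1))
    have "dist q (P 0) < dist q (P \<phi>)" if "\<phi> \<in> {0..\<tau>}" "\<phi> \<noteq> 0" for \<phi>
    proof -
      let ?m = "(0 + \<phi>) / 2"
      have "sin (\<tau> - ?m) > 0" "sin ?m > 0" using that t by (auto intro!: sin_gt_zero simp: field_simps)
      then have "sin \<tau> * (b * cos ?m - a * sin ?m) > 0" unfolding interp using b
        by (smt (verit, best) mult_pos_pos mult_nonneg_nonneg)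
      then have "b * cos ?m - a * sin ?m > 0" using st by (simp add: zero_less_mult_iff)
      moreover have "sin ((\<phi> - 0) / 2) > 0" using that t by (auto intro!: sin_gt_zero simp: field_simps)
      ultimately have "(a * cos \<phi> + b * sin \<phi>) - (a * cos 0 + b * sin 0) > 0"
        unfolding diff by (simp add: zero_less_mult_iff)
      then show ?thesis using dl[OF ab(2)] by simp
    qed
    then show ?thesis unfolding XP using t by (intro nearest_imageI) auto
  qed
  have c5: "\<exists>z. nearest q X z" if l: "inner (P 0 - q) (T 0) < 0" "inner (P \<tau> - q) (T \<tau>) > 0" for q
  proof (rule nearest_exists_compact[OF compX])
    show "X \<noteq> {}" unfolding XP using t by auto
    obtain a b where ab: "\<forall>\<phi>. inner (o' - q) (T \<phi>) = b * cos \<phi> - a * sin \<phi>"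
      "\<forall>\<phi>. (dist q (P \<phi>))\<^sup>2 = (dist q o')\<^sup>2 + R\<^sup>2 + 2 * R * (a * cos \<phi> + b * sin \<phi>)" using key by meson
    have b: "b < 0" "b * cos \<tau> - a * sin \<tau> > 0" using l own ab(1) by (metis cos_zero diff_zero mult.right_neutral mult_zero_right sin_zero, metis own ab(1))
    \<comment> \<open>Two minimisers would make their midpoint angle \<open>m\<close> critical. As
      the value there is not smaller, the sinusoid is nonnegative at \<open>m\<close>; but at a
      critical angle its product with \<open>sin m\<close> equals \<open>b\<close>, which is
      negative.\<close>
    have imp: False if h: "\<phi> \<in> {0..\<tau>}" "\<psi> \<in> {0..\<tau>}" "\<phi> < \<psi>" "dist q (P \<phi>) = dist q (P \<psi>)"
      "\<forall>w\<in>X. dist q (P \<phi>) \<le> dist q w" for \<phi> \<psi>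
    proof -
      let ?f = "\<lambda>\<phi>. a * cos \<phi> + b * sin \<phi>"
      define m where "m = (\<phi> + \<psi>) / 2"
      have sm: "sin ((\<psi> - \<phi>) / 2) > 0" using h t by (auto intro!: sin_gt_zero simp: field_simps)
      have "\<not> dist q (P \<phi>) < dist q (P \<psi>)" "\<not> dist q (P \<psi>) < dist q (P \<phi>)" using h by auto
      then have "?f \<psi> - ?f \<phi> = 0" unfolding dl[OF ab(2)] by simp
      then have g0: "b * cos m - a * sin m = 0" unfolding diff m_def using sm by simp
      have gap_mid: "m \<in> {0..\<tau>}" "0 < m" "m < \<tau>" using h unfolding m_def by auto
      have "dist q (P \<phi>) \<le> dist q (P m)" using h gap_mid XP by auto
      then have le: "?f \<phi> \<le> ?f m" using dl[OF ab(2), of m \<phi>] by linarith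
      have "?f \<phi> = ?f m * cos ((\<psi> - \<phi>) / 2)"
      proof -
        define d where "d = (\<psi> - \<phi>) / 2"
        have "\<phi> = m - d" unfolding m_def d_def by (simp add: field_simps)
        moreover have "?f (m - d) = ?f m * cos d - (b * cos m - a * sin m) * sin d"
          by (simp add: cos_diff sin_diff algebra_simps)
        ultimately show ?thesis using g0 d_def by simp
      qed
      then have "?f m * (1 - cos ((\<psi> - \<phi>) / 2)) \<ge> 0" using le by (simp add: right_diff_distrib)
      moreover have "cos ((\<psi> - \<phi>) / 2) < 1"
        using cos_monotone_0_pi[of 0 "(\<psi> - \<phi>) / 2"] h t by (auto simp: field_simps)
      ultimately have fm: "?f m \<ge> 0" by (auto simp: zero_le_mult_iff)
      have sinm: "sin m > 0" using gap_mid t by (intro sin_gt_zero) auto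
      have "?f m * sin m = b * (cos m * cos m + sin m * sin m)"
      proof -
        have "a * sin m = b * cos m" using g0 by simp
        then have e: "(a * sin m) * cos m + b * sin m * sin m = (b * cos m) * cos m + b * sin m * sin m" by (simp only:)
        have "?f m * sin m = (a * sin m) * cos m + b * sin m * sin m" by (simp add: distrib_right)
        also note e
        finally show ?thesis by (simp only: distrib_left mult.assoc)
      qed
      also have "\<dots> = b" by (simp add: power2_eq_square[symmetric])
      finally show False using mult_nonneg_nonneg[OF fm, of "sin m"] sinm b(1) by simp
    qed
    show "x = y" if h: "x \<in> X" "y \<in> X" "\<forall>w\<in>X. dist q x \<le> dist q w" "dist q x = dist q y" for x y
    proof -
      obtain \<phi> \<psi> where p: "\<phi> \<in> {0..\<tau>}" "x = P \<phi>" "\<psi> \<in> {0..\<tau>}" "y = P \<psi>" using h XP by auto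
      show ?thesis using imp[of \<phi> \<psi>] imp[of \<psi> \<phi>] p h by (metis linorder_neqE_linordered_idom)
    qed
  qed
  have "P 0 \<in> X" "P \<tau> \<in> X" unfolding XP using t by auto
  then have "smooth_piece X (P 0) (T 0) (P \<tau>) (T \<tau>)" unfolding smooth_piece_def using compX c1 c2 c3 c4 c5 by auto
  then show ?thesis unfolding X_def by (simp add: P_def T_def)
qed

lemma smooth_piece_segment:
  assumes "A \<noteq> B"
  shows "smooth_piece (closed_segment A B) A (sgn (B - A)) B (sgn (B - A))"
proof -
  define d where "d = norm (B - A)"
  define u where "u = sgn (B - A)"
  have d: "d > 0" using assms by (simp add: d_def)
  have u1: "norm u = 1" using assms by (simp add: u_def norm_sgn)
  have Bu: "B = A + of_real d * u" using assms by (simp add: d_def u_def sgn_div_norm scaleR_conv_of_real field_simps)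
  define P where "P t = A + of_real t * u" for t
  have uu: "inner u u = 1" using u1 by (metis norm_eq_1)
  have XP: "closed_segment A B = P ` {0..d}"
  proof -
    have "closed_segment A B = (\<lambda>s. P (s * d)) ` {0..1}"
      unfolding closed_segment_image_interval P_def Bu
      by (intro image_cong) (auto simp: scaleR_conv_of_real algebra_simps)
    also have "\<dots> = P ` ((\<lambda>s. s * d) ` {0..1})" by (simp add: image_image)
    also have "(\<lambda>s. s * d) ` {0..1} = {0..d}"
      using image_mult_atLeastAtMost[of d 0 1] d by (simp add: mult.commute)
    finally show ?thesis .
  qed
  have inP: "inner (P t - q) u = inner (A - q) u + t" for t q
    using uu by (simp add: P_def inner_add inner_diff scaleR_conv_of_real[symmetric] inner_scaleR_left)
  have PA: "P 0 = A" "P d = B" by (simp_all add: P_def Bu)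
  have D: "(dist q (P t))\<^sup>2 = (dist q A)\<^sup>2 + 2 * t * inner (A - q) u + t\<^sup>2" for q t
  proof -
    have "(dist q (P t))\<^sup>2 = (norm ((A - q) + t *\<^sub>R u))\<^sup>2"
      by (simp add: dist_norm norm_minus_commute P_def algebra_simps scaleR_conv_of_real)
    also have "\<dots> = (norm (A - q))\<^sup>2 + 2 * t * inner (A - q) u + t\<^sup>2 * inner u u"
      unfolding power2_norm_eq_inner
      by (simp only: inner_add inner_scaleR_left inner_scaleR_right inner_commute[of u "A - q"] power2_eq_square)
         (simp add: algebra_simps)
    finally show ?thesis by (simp add: uu dist_norm norm_minus_commute)
  qed
  have dl: "dist q (P s) < dist q (P t) \<longleftrightarrow> (t - s) * (2 * inner (A - q) u + s + t) > 0" for q s t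
  proof -
    have "dist q (P s) < dist q (P t) \<longleftrightarrow> (dist q (P s))\<^sup>2 < (dist q (P t))\<^sup>2"
      by (rule dist_less_iff_square)
    then show ?thesis unfolding D by (simp add: algebra_simps power2_eq_square)
  qed
  have c3: "nearest q (closed_segment A B) B" if "inner (A - q) u < 0" "inner (B - q) u \<le> 0" for q
  proof -
    have "inner (A - q) u + d \<le> 0" using that inP[of d q] PA by simp
    then have "dist q (P d) < dist q (P t)" if "t \<in> {0..d}" "t \<noteq> d" for t
      unfolding dl using that by (auto intro!: mult_neg_neg)
    then have "nearest q (P ` {0..d}) (P d)" using d by (intro nearest_imageI) auto
    then show ?thesis by (simp add: XP PA)
  qed
  have c4: "nearest q (closed_segment A B) A" if "inner (A - q) u \<ge> 0" for q
  proof -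
    have "dist q (P 0) < dist q (P t)" if "t \<in> {0..d}" "t \<noteq> 0" for t
      unfolding dl using that \<open>inner (A - q) u \<ge> 0\<close> by auto
    then have "nearest q (P ` {0..d}) (P 0)" using d by (intro nearest_imageI) auto
    then show ?thesis by (simp add: XP PA)
  qed
  have c5: "\<exists>z. nearest q (closed_segment A B) z" if "inner (A - q) u < 0" "inner (B - q) u > 0" for q
  proof -
    define s where "s = - inner (A - q) u"
    have s: "s \<in> {0..d}" using that inP[of d q] PA by (simp add: s_def)
    have "dist q (P s) < dist q (P t)" if "t \<in> {0..d}" "t \<noteq> s" for t
    proof -
      have "(t - s) * (2 * inner (A - q) u + s + t) = (t - s)\<^sup>2"
        unfolding s_def by (simp add: power2_eq_square algebra_simps)
      then show ?thesis unfolding dl using that by simp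
    qed
    then have "nearest q (closed_segment A B) (P s)" unfolding XP using s by (intro nearest_imageI)
    then show ?thesis ..
  qed
  have c1: "inner (A - x) u < 0 \<or> x = A" if xX: "x \<in> closed_segment A B" for x
  proof -
    obtain t where t: "t \<in> {0..d}" "x = P t" using xX XP by auto
    have "inner (A - P t) u = - t" using inP[of t "P t"] by simp
    then show ?thesis using t PA by (cases "t = 0") auto
  qed
  have c2: "inner (B - x) u > 0 \<or> x = B" if xX: "x \<in> closed_segment A B" for x
  proof -
    obtain t where t: "t \<in> {0..d}" "x = P t" using xX XP by auto
    have "inner (A - P t) u = - t" using inP[of t "P t"] by simp
    then have "inner (B - P t) u = d - t" using inP[of d "P t"] PA by simp
    then show ?thesis using t PA by (cases "t = d") auto
  qed
  show ?thesis unfolding smooth_piece_def u_def[symmetric] using c1 c2 c3 c4 c5 by (auto simp: less_imp_le)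
qed

section \<open>The half chain of a gadget\<close>

lemma circle_arc_chord2:
  assumes s: "s = 1 \<or> s = -1"
  shows "(dist (o' + v * cis (s * \<phi>)) (o' + v * cis (s * \<psi>)))\<^sup>2 = 2 * (norm v)\<^sup>2 * (1 - cos (\<phi> - \<psi>))"
proof -
  have "(norm (cis (s * \<phi>) - cis (s * \<psi>)))\<^sup>2 = (cos \<phi> - cos \<psi>)\<^sup>2 + (sin \<phi> - sin \<psi>)\<^sup>2"
    using s by (auto simp: cmod_power2 power2_commute)
  also have "\<dots> = ((cos \<phi>)\<^sup>2 + (sin \<phi>)\<^sup>2) + ((cos \<psi>)\<^sup>2 + (sin \<psi>)\<^sup>2) - 2 * cos (\<phi> - \<psi>)"
    by (simp add: cos_diff power2_eq_square algebra_simps)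
  also have "\<dots> = 2 * (1 - cos (\<phi> - \<psi>))" by simp
  finally have e: "(norm (cis (s * \<phi>) - cis (s * \<psi>)))\<^sup>2 = 2 * (1 - cos (\<phi> - \<psi>))" .
  have "dist (o' + v * cis (s * \<phi>)) (o' + v * cis (s * \<psi>)) = norm v * norm (cis (s * \<phi>) - cis (s * \<psi>))"
    by (simp add: dist_norm right_diff_distrib[symmetric] norm_mult)
  then show ?thesis using e by (simp add: power_mult_distrib)
qed

lemma circle_arc_chord:
  assumes s: "s = 1 \<or> s = -1" and "\<psi> \<le> \<phi>" "\<phi> - \<psi> \<le> pi"
  shows "dist (o' + v * cis (s * \<phi>)) (o' + v * cis (s * \<psi>)) = 2 * norm v * sin ((\<phi> - \<psi>) / 2)"
proof -
  have "1 - cos (\<phi> - \<psi>) = 2 * (sin ((\<phi> - \<psi>) / 2))\<^sup>2"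
    using cos_double_sin[of "(\<phi> - \<psi>) / 2"] by (simp only: mult_2 field_sum_of_halves)
  then have "(dist (o' + v * cis (s * \<phi>)) (o' + v * cis (s * \<psi>)))\<^sup>2 = (2 * norm v * sin ((\<phi> - \<psi>) / 2))\<^sup>2"
    unfolding circle_arc_chord2[OF s] by (simp add: power_mult_distrib)
  moreover have "sin ((\<phi> - \<psi>) / 2) \<ge> 0" using assms by (intro sin_ge_zero) auto
  ultimately show ?thesis by (simp add: power2_eq_iff_nonneg)
qed

text \<open>Here \<open>x\<close> and \<open>y\<close> are half angles of two adjacent sub-arcs.
  Writing \<open>sin x\<close> as the sine of a difference costs \<open>cos (x + y) * sin y\<close>,
  and \<open>cos (x + y)\<close> is at least 0.72 because (1 + 1/10) / 2 exceeds the square of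
  0.72.\<close>

lemma sin_chord_bound:
  assumes "0 \<le> x" "0 \<le> y" "x + y \<le> pi / 2" "cos (2 * (x + y)) \<ge> 1 / 10"
  shows "sin x + 0.72 * sin y \<le> sin (x + y)"
proof -
  have "2 * (cos (x + y))\<^sup>2 \<ge> 1 + 1 / 10" using assms(4) unfolding cos_double_cos by simp
  then have "(0.72::real)\<^sup>2 \<le> (cos (x + y))\<^sup>2" by (simp add: power2_eq_square)
  moreover have "cos (x + y) \<ge> 0" using assms by (intro cos_ge_zero) auto
  ultimately have c: "0.72 \<le> cos (x + y)" by (rule power2_le_imp_le)
  have "sin x = sin (x + y) * cos y - cos (x + y) * sin y"
    using sin_diff[of "x + y" y] by simp
  moreover have "sin (x + y) * cos y \<le> sin (x + y)"
    using assms by (intro mult_left_le sin_ge_zero) auto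
  moreover have "0.72 * sin y \<le> cos (x + y) * sin y"
    using assms c by (intro mult_right_mono sin_ge_zero) auto
  ultimately show ?thesis by linarith
qed

text \<open>Along an arc that is not too long, the distance to a sample at one end plus 0.72 times
  the distance to the other end is largest at the other end. Hence each gap has to be checked at
  finitely many points only.\<close>

lemma circle_arc_between:
  fixes o' v :: complex
  assumes s: "s = 1 \<or> s = -1" and "\<phi> \<le> \<zeta>" "\<zeta> \<le> \<psi>" "\<psi> - \<phi> \<le> pi" "cos (\<psi> - \<phi>) \<ge> 1 / 10"
  defines "P \<equiv> \<lambda>\<phi>. o' + v * cis (s * \<phi>)"
  shows "dist (P \<zeta>) (P \<phi>) + 0.72 * dist (P \<zeta>) (P \<psi>) \<le> dist (P \<phi>) (P \<psi>)"
    and "dist (P \<zeta>) (P \<psi>) + 0.72 * dist (P \<zeta>) (P \<phi>) \<le> dist (P \<phi>) (P \<psi>)"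
proof -
  have d: "dist (P \<zeta>) (P \<phi>) = 2 * norm v * sin ((\<zeta> - \<phi>) / 2)"
    "dist (P \<psi>) (P \<zeta>) = 2 * norm v * sin ((\<psi> - \<zeta>) / 2)"
    "dist (P \<psi>) (P \<phi>) = 2 * norm v * sin ((\<psi> - \<phi>) / 2)"
    unfolding P_def using assms by (intro circle_arc_chord; simp)+
  have e: "(\<zeta> - \<phi>) / 2 + (\<psi> - \<zeta>) / 2 = (\<psi> - \<phi>) / 2" by (simp add: field_simps)
  have 1: "sin ((\<zeta> - \<phi>) / 2) + 0.72 * sin ((\<psi> - \<zeta>) / 2) \<le> sin ((\<psi> - \<phi>) / 2)"
    using sin_chord_bound[of "(\<zeta> - \<phi>) / 2" "(\<psi> - \<zeta>) / 2"] assms(2-5) unfolding e by (simp only: mult_2 field_sum_of_halves) simp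
  have 2: "sin ((\<psi> - \<zeta>) / 2) + 0.72 * sin ((\<zeta> - \<phi>) / 2) \<le> sin ((\<psi> - \<phi>) / 2)"
    using sin_chord_bound[of "(\<psi> - \<zeta>) / 2" "(\<zeta> - \<phi>) / 2"] assms(2-5) unfolding add.commute[of "(\<psi> - \<zeta>) / 2"] e by (simp only: mult_2 field_sum_of_halves) simp
  have "2 * norm v * (sin ((\<zeta> - \<phi>) / 2) + 0.72 * sin ((\<psi> - \<zeta>) / 2)) \<le> 2 * norm v * sin ((\<psi> - \<phi>) / 2)"
    "2 * norm v * (sin ((\<psi> - \<zeta>) / 2) + 0.72 * sin ((\<zeta> - \<phi>) / 2)) \<le> 2 * norm v * sin ((\<psi> - \<phi>) / 2)"
    using 1 2 by (intro mult_left_mono; simp)+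
  then show "dist (P \<zeta>) (P \<phi>) + 0.72 * dist (P \<zeta>) (P \<psi>) \<le> dist (P \<phi>) (P \<psi>)"
    "dist (P \<zeta>) (P \<psi>) + 0.72 * dist (P \<zeta>) (P \<phi>) \<le> dist (P \<phi>) (P \<psi>)"
    using d by (simp_all add: distrib_left dist_commute[of "P \<zeta>" "P \<psi>"] dist_commute[of "P \<phi>" "P \<psi>"])
qed

section \<open>Constants and joints of the half chain\<close>

definition cos8 :: real where "cos8 = cos (pi / 8)"
definition sin8 :: real where "sin8 = sin (pi / 8)"
text \<open>This surd is the tangent of \<open>pi / 8\<close>; in this form its decimal bounds come
  from those of \<open>sqrt 2\<close>.\<close>

definition tan8 :: real where "tan8 = sqrt 2 - 1"
definition u0 :: complex where "u0 = cis (pi / 8)"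

lemma sqrt2_bounds: "1.41421 < sqrt 2" "sqrt 2 < 1.41422"
  by (rule real_less_rsqrt, simp add: power2_eq_square) (rule real_less_lsqrt, auto simp: power2_eq_square)

lemma tan8_bounds: "0.41421 < tan8" "tan8 < 0.41422" using sqrt2_bounds by (auto simp: tan8_def)

lemma cos8_pos: "cos8 > 0" unfolding cos8_def by (intro cos_gt_zero) auto

lemma cos8_sq: "cos8\<^sup>2 = (2 + sqrt 2) / 4"
proof -
  have "cos (2 * (pi / 8)) = 2 * (cos (pi / 8))\<^sup>2 - 1" by (rule cos_double_cos)
  then show ?thesis by (simp add: cos8_def cos_45 field_simps)
qed

lemma cos8_bounds: "0.92387 < cos8" "cos8 < 0.92389"
proof -
  have "0.92387\<^sup>2 < cos8\<^sup>2" "cos8\<^sup>2 < 0.92389\<^sup>2" unfolding cos8_sq using sqrt2_bounds by (auto simp: power2_eq_square)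
  then show "0.92387 < cos8" "cos8 < 0.92389" using cos8_pos by - (erule power2_less_imp_less, simp)+
qed

lemma sin8_eq: "sin8 = tan8 * cos8"
proof -
  have "sin (2 * (pi / 8)) = 2 * sin (pi / 8) * cos (pi / 8)" by (rule sin_double)
  then have "2 * sin8 * cos8 = sqrt 2 / 2" by (simp add: sin8_def cos8_def sin_45)
  also have "\<dots> = 2 * (tan8 * cos8) * cos8"
  proof -
    have "tan8 * cos8\<^sup>2 = sqrt 2 / 4" unfolding cos8_sq tan8_def by (simp add: field_simps)
    then show ?thesis by (simp add: power2_eq_square)
  qed
  finally show ?thesis using cos8_pos by simp
qed

lemma u0_parts [simp]: "Re u0 = cos8" "Im u0 = sin8" "norm u0 = 1" by (simp_all add: u0_def cos8_def sin8_def)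
lemma u0_inner [simp]: "inner u0 u0 = 1" by (simp add: dot_square_norm)

text \<open>The triple 8, 15, 17 makes sine and cosine of this turn rational, so that the joint
  \<open>g3\<close> has rational coordinates.\<close>

definition turn3 :: real where "turn3 = arccos (15 / 17)"
text \<open>After \<open>turn3\<close> the heading is steeper than the strand direction
  \<open>pi / 8\<close>; the last arc turns it back by this angle.\<close>

definition turn4 :: real where "turn4 = turn3 - pi / 8"

lemma cos_turn3 [simp]: "cos turn3 = 15 / 17" by (simp add: turn3_def cos_arccos)
lemma sin_turn3 [simp]: "sin turn3 = 8 / 17" 
proof -
  have "sin turn3 = sqrt (1 - (15 / 17)\<^sup>2)" by (simp add: turn3_def sin_arccos)
  also have "1 - (15 / 17)\<^sup>2 = ((8::real) / 17)\<^sup>2" by (simp add: power2_eq_square)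
  finally show ?thesis by (simp only: real_sqrt_abs)
qed
lemma turn3_bounds: "pi / 8 < turn3" "turn3 < pi / 2"
proof -
  have "0 \<le> turn3" "turn3 \<le> pi" by (auto simp: turn3_def arccos_lbound arccos_ubound)
  moreover have "\<not> turn3 \<le> pi / 8"
    using cos_monotone_0_pi_le[of turn3 "pi / 8"] cos8_bounds \<open>0 \<le> turn3\<close> by (auto simp: cos8_def)
  moreover have "\<not> turn3 \<ge> pi / 2"
    using cos_monotone_0_pi_le[of "pi / 2" turn3] \<open>turn3 \<le> pi\<close> by auto
  ultimately show "pi / 8 < turn3" "turn3 < pi / 2" by auto
qed
lemma turn4_bounds: "0 < turn4" "turn4 < pi / 2" using turn3_bounds pi_gt_zero by (auto simp: turn4_def)
lemma cos_turn4: "cos turn4 = cos8 * (15 + 8 * tan8) / 17"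
  unfolding turn4_def cos_diff by (simp add: cos8_def[symmetric] sin8_def[symmetric] sin8_eq field_simps)

text \<open>
  The constants below come from a numerical optimisation of the ratio between the distance to the
  nearest sample and the local feature size; its optimum in this family is about 0.706. The radius
  \<open>R4\<close> makes the last arc tangent to the line through 0 and \<open>u0\<close>, at the point \<open>sample_e\<close>.
\<close>

definition g1 :: complex where "g1 = Complex 1 0.04"
definition g2 :: complex where "g2 = Complex 1.705 0.745"
definition g3 :: complex where "g3 = Complex 2.025 0.825"
definition o2 :: complex where "o2 = Complex 1.705 0.04"
definition o3 :: complex where "o3 = Complex 1.705 1.425"
text \<open>Distance from \<open>g3\<close> to the line through 0 and \<open>u0\<close>. An arc of
  radius \<open>R4\<close> that turns through \<open>turn4\<close> and ends tangent to the line
  bridges the distance \<open>R4 * (1 - cos turn4)\<close>, which determines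
  \<open>R4\<close>.\<close>

definition offset4 :: real where "offset4 = cos8 * (2.025 * tan8 - 0.825)"
definition R4 :: real where "R4 = offset4 / (1 - cos turn4)"
definition o4 :: complex where "o4 = g3 - of_real R4 * \<i> * cis turn3"
definition sample_e :: complex where "sample_e = o4 + of_real R4 * \<i> * u0"
definition radius_e :: real where "radius_e = cos8 * (2.025 + 0.825 * tan8) + R4 * sin turn4"

lemma offset4_bounds: "0.0127 < offset4" "offset4 < 0.012754"
proof -
  have "0.013758 < 2.025 * tan8 - 0.825" "2.025 * tan8 - 0.825 < 0.0138" using tan8_bounds by auto
  moreover have "0.92387 * 0.01375 < cos8 * (2.025 * tan8 - 0.825)"
    using cos8_bounds tan8_bounds by (intro mult_strict_mono) auto
  moreover have "cos8 * (2.025 * tan8 - 0.825) < 0.92389 * 0.0138"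
    using cos8_bounds tan8_bounds by (intro mult_strict_mono) auto
  ultimately show "0.0127 < offset4" "offset4 < 0.012754" unfolding offset4_def by auto
qed

lemma cos_turn4_bounds: "0.0047 < 1 - cos turn4" "1 - cos turn4 < 0.0048"
proof -
  have "cos8 * (15 + 8 * tan8) < 0.92389 * 18.31376" "0.92387 * 18.31368 < cos8 * (15 + 8 * tan8)"
    using cos8_bounds tan8_bounds by (intro mult_strict_mono; simp)+
  then show "0.0047 < 1 - cos turn4" "1 - cos turn4 < 0.0048" unfolding cos_turn4 by auto
qed

lemma R4_gt: "R4 > 2" 
  unfolding R4_def using offset4_bounds cos_turn4_bounds by (auto simp: field_simps)

lemma sin_turn4_pos: "sin turn4 > 0" using turn4_bounds by (intro sin_gt_zero) auto

lemma radius_e_lb: "2.184 < cos8 * (2.025 + 0.825 * tan8)" "cos8 * (2.025 + 0.825 * tan8) < 2.2"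
proof -
  have "0.92387 * 2.3667 < cos8 * (2.025 + 0.825 * tan8)" "cos8 * (2.025 + 0.825 * tan8) < 0.92389 * 2.3668"
    using cos8_bounds tan8_bounds by (intro mult_strict_mono; simp)+
  then show "2.184 < cos8 * (2.025 + 0.825 * tan8)" "cos8 * (2.025 + 0.825 * tan8) < 2.2" by auto
qed

lemma radius_e_gt: "radius_e > 2.184" unfolding radius_e_def using radius_e_lb R4_gt sin_turn4_pos by (smt (verit) mult_pos_pos)

lemma sample_e_eq: "sample_e = of_real radius_e * u0"
proof -
  have R: "R4 * (1 - cos turn4) = offset4" using cos_turn4_bounds by (simp add: R4_def)
  \<comment> \<open>Multiplying by \<open>cnj u0\<close> puts the strand line on the real axis;
    there \<open>Im P = 0\<close> is exactly the equation that defines \<open>R4\<close>.\<close>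
  define P where "P = cnj u0 * sample_e"
  have uu: "u0 * cnj u0 = 1" by (simp add: u0_def cis_cnj cis_mult)
  have cb: "cnj u0 * cis turn3 = cis turn4" by (simp add: u0_def turn4_def cis_cnj cis_mult)
  have "P = cnj u0 * g3 + of_real R4 * \<i> * (cnj u0 * u0 - cnj u0 * cis turn3)"
    by (simp add: P_def sample_e_def o4_def algebra_simps)
  also have "\<dots> = cnj u0 * g3 + of_real R4 * \<i> * (1 - cis turn4)"
    using uu cb by (simp add: mult.commute)
  finally have P: "P = cnj u0 * g3 + of_real R4 * \<i> * (1 - cis turn4)" .
  have "Im P = 0" using R unfolding P by (simp add: g3_def sin8_eq offset4_def algebra_simps)
  moreover have "Re P = radius_e" unfolding P by (simp add: g3_def sin8_eq radius_e_def algebra_simps)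
  ultimately have "P = of_real radius_e" by (simp add: complex_eq_iff)
  then have "u0 * P = u0 * of_real radius_e" by simp
  moreover have "u0 * P = sample_e" unfolding P_def using uu by (simp add: mult.assoc[symmetric])
  ultimately have "sample_e = u0 * of_real radius_e" by (simp only:)
  then show ?thesis by (simp only: mult.commute)
qed

text \<open>The bound is 0.72 * 0.4, where 0.4 will be the radius of the ball about
  \<open>g3\<close> that avoids the medial axis.\<close>

lemma g3_sample_e: "dist g3 sample_e < 0.288"
proof -
  have s: "(-1::real) = 1 \<or> (-1::real) = -1" by simp
  have g: "g3 = o4 + (of_real R4 * \<i> * cis turn3) * cis (-1 * 0)" by (simp add: o4_def)
  have e: "sample_e = o4 + (of_real R4 * \<i> * cis turn3) * cis (-1 * turn4)"
    by (simp add: sample_e_def u0_def turn4_def mult.assoc cis_mult)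
  have "(dist g3 sample_e)\<^sup>2 = 2 * (norm (of_real R4 * \<i> * cis turn3))\<^sup>2 * (1 - cos (0 - turn4))"
    by (subst g, subst e) (rule circle_arc_chord2, simp)
  also have "\<dots> = 2 * R4\<^sup>2 * (1 - cos turn4)" by (simp add: norm_mult)
  also have "\<dots> = 2 * offset4\<^sup>2 / (1 - cos turn4)" using cos_turn4_bounds by (simp add: R4_def power2_eq_square)
  also have "\<dots> < 0.288\<^sup>2"
  proof -
    have "offset4\<^sup>2 < 0.012754\<^sup>2" using offset4_bounds by (intro power_strict_mono) auto
    then have "2 * offset4\<^sup>2 < 0.288\<^sup>2 * 0.0047" by (simp add: power2_eq_square)
    also have "\<dots> < 0.288\<^sup>2 * (1 - cos turn4)" using cos_turn4_bounds by simp
    finally show ?thesis using cos_turn4_bounds by (simp add: field_simps)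
  qed
  finally show ?thesis by (rule power2_less_imp_less) simp
qed

lemma cmod_le_iff_square: "0 \<le> c \<Longrightarrow> cmod z \<le> c \<longleftrightarrow> (Re z)\<^sup>2 + (Im z)\<^sup>2 \<le> c\<^sup>2"
  by (metis cmod_power2 norm_ge_zero power2_le_imp_le power_mono)

lemma radius_e_lt: "radius_e < 3"
proof -
  have "norm g3 \<le> 2.2" by (subst cmod_le_iff_square) (simp_all add: g3_def power2_eq_square)
  moreover have "norm sample_e \<le> norm g3 + dist g3 sample_e" by (metis dist_commute dist_norm norm_triangle_sub)
  moreover have "norm sample_e = radius_e" using radius_e_gt by (simp add: sample_e_eq norm_mult)
  ultimately show ?thesis using g3_sample_e by simp
qed

section \<open>Nearest points on the half chain\<close>

fun link :: "nat \<Rightarrow> complex set" where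
  "link 0 = closed_segment 1 g1"
| "link (Suc 0) = circle_arc o2 (-0.705) (-1) (pi / 2)"
| "link (Suc (Suc 0)) = circle_arc o3 (- 0.68 * \<i>) 1 turn3"
| "link (Suc (Suc (Suc 0))) = circle_arc o4 (of_real R4 * \<i> * cis turn3) (-1) turn4"
| "link (Suc (Suc (Suc (Suc n)))) = closed_segment sample_e (4 * u0)"

definition hchain :: "complex set" where "hchain = (\<Union>i<5. link i)"

definition node :: "nat \<Rightarrow> complex" where "node i = [1, g1, g2, g3, sample_e, 4 * u0] ! i"
definition heading :: "nat \<Rightarrow> complex" where "heading i = [\<i>, \<i>, 1, cis turn3, u0, u0] ! i"

lemma hchain_smooth_piece:
  assumes "i < 5"
  shows "smooth_piece (link i) (node i) (heading i) (node (Suc i)) (heading (Suc i))"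
proof -
  consider "i = 0" | "i = 1" | "i = 2" | "i = 3" | "i = 4" using assms by linarith
  then show ?thesis
  proof cases
    case 1
    have "smooth_piece (closed_segment 1 g1) 1 (sgn (g1 - 1)) g1 (sgn (g1 - 1))"
      by (intro smooth_piece_segment) (simp add: g1_def complex_eq_iff)
    moreover have "sgn (g1 - 1) = \<i>" by (simp add: g1_def sgn_eq complex_eq_iff cmod_def)
    ultimately show ?thesis using 1 by (simp add: node_def heading_def)
  next
    case 2
    have "o2 - 0.705 = g1" "o2 + (-0.705) * cis (-1 * (pi / 2)) = g2" by (simp_all add: o2_def g1_def g2_def complex_eq_iff)
    moreover have "sgn (-0.705::complex) = -1" by (simp add: sgn_eq)
    ultimately show ?thesis using 2 smooth_piece_arc[of "-0.705" "-1" "pi / 2" o2]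
      by (simp add: node_def heading_def)
  next
    case 3
    have "o3 - 0.68 * \<i> = g2" "o3 + (- 0.68 * \<i>) * cis (1 * turn3) = g3" by (simp_all add: o3_def g3_def g2_def complex_eq_iff)
    moreover have "sgn (- 0.68 * \<i>) = - \<i>" by (simp add: sgn_eq norm_mult)
    ultimately show ?thesis using 3 smooth_piece_arc[of "- 0.68 * \<i>" 1 turn3 o3] turn3_bounds pi_gt_zero
      by (simp add: node_def heading_def numeral_2_eq_2 numeral_3_eq_3)
  next
    case 4
    have e: "o4 + of_real R4 * \<i> * cis turn3 = g3" "o4 + (of_real R4 * \<i> * cis turn3) * cis (-1 * turn4) = sample_e"
      by (simp_all add: o4_def sample_e_def u0_def turn4_def mult.assoc cis_mult)
    have s: "sgn (of_real R4 * \<i> * cis turn3) = \<i> * cis turn3" using R4_gt by (simp add: sgn_eq norm_mult)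
    have t: "of_real (-1) * \<i> * (\<i> * cis turn3) = cis turn3" "cis turn3 * cis (-1 * turn4) = u0"
      by (simp_all add: u0_def turn4_def mult.assoc[symmetric] cis_mult)
    define v where "v = of_real R4 * \<i> * cis turn3"
    have "smooth_piece (circle_arc o4 v (-1) turn4) (o4 + v) (of_real (-1) * \<i> * sgn v) (o4 + v * cis (-1 * turn4)) (of_real (-1) * \<i> * sgn v * cis (-1 * turn4))"
      using turn4_bounds pi_gt_zero R4_gt by (intro smooth_piece_arc) (auto simp: v_def)
    then have "smooth_piece (circle_arc o4 (of_real R4 * \<i> * cis turn3) (-1) turn4) g3 (cis turn3) sample_e u0"
      unfolding v_def s e t .
    then show ?thesis using 4 by (simp add: node_def heading_def numeral_3_eq_3)
  next
    case 5
    have e: "4 * u0 - sample_e = of_real (4 - radius_e) * u0" by (simp add: sample_e_eq algebra_simps)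
    have "sgn (4 * u0 - sample_e) = u0" unfolding e sgn_mult sgn_of_real using radius_e_lt by (simp add: sgn_eq)
    moreover have "norm (4 * u0 - sample_e) > 0" unfolding e norm_mult norm_of_real using radius_e_lt by simp
    then have "sample_e \<noteq> 4 * u0" by auto
    ultimately show ?thesis using 5 smooth_piece_segment[of sample_e "4 * u0"] by (simp add: node_def heading_def eval_nat_numeral)
  qed
qed

text \<open>The three alternatives exclude, one for each arc, the wedge between the end normals
  beyond the centre of curvature, where the distance can have an interior maximum. On the two
  straight links the bad sign pattern cannot occur. For real \<open>q\<close> the derivative at the
  start is 0, so 1 itself is nearest.\<close>

lemma hchain_nearest:
  assumes "0 \<le> Im q" 
    and c12: "0.04 < Im q \<or> Re q < 1.705"
    and c23: "1.705 < Re q \<or> inner (g3 - q) (cis turn3) > 0"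
    and c34: "inner (g3 - q) (cis turn3) < 0 \<or> inner (sample_e - q) u0 > 0"
  shows "\<exists>z. nearest q hchain z \<and> (Im q = 0 \<longrightarrow> z = 1)"
proof -
  have nb: "\<not> (inner (node i - q) (heading i) \<ge> 0 \<and> inner (node (Suc i) - q) (heading (Suc i)) \<le> 0)" if i5: "i < 5" for i
  proof -
    consider "i = 0" | "i = 1" | "i = 2" | "i = 3" | "i = 4" using i5 by linarith
    then show ?thesis
    proof cases
      case 1 then show ?thesis by (simp add: node_def heading_def g1_def inner_complex_def)
    next
      case 2 then show ?thesis using c12 by (auto simp: node_def heading_def g1_def g2_def inner_complex_def numeral_2_eq_2)
    next
      case 3 then show ?thesis using c23 by (auto simp: node_def heading_def g2_def inner_complex_def numeral_2_eq_2 numeral_3_eq_3)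
    next
      case 4 then show ?thesis using c34 by (auto simp: node_def heading_def numeral_2_eq_2 numeral_3_eq_3)
    next
      case 5
      have "inner (4 * u0 - q) u0 = inner (sample_e - q) u0 + (4 - radius_e)"
      proof -
        have "4 * u0 - q = (sample_e - q) + (4 - radius_e) *\<^sub>R u0"
          by (simp add: sample_e_eq scaleR_conv_of_real algebra_simps)
        moreover have "inner u0 u0 = 1" by simp
        ultimately show ?thesis by (simp only: inner_add_left inner_scaleR_left mult_1_right)
      qed
      then show ?thesis using 5 radius_e_lt by (auto simp: node_def heading_def eval_nat_numeral)
    qed
  qed
  have "\<exists>z. nearest q hchain z" unfolding hchain_def by (rule chain_nearest(1)[of 5 link node heading q, OF hchain_smooth_piece nb]) auto
  moreover have "nearest q hchain 1" if "Im q = 0"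
    using chain_nearest(2)[of 5 link node heading q, OF hchain_smooth_piece nb] that unfolding hchain_def[symmetric]
    by (simp add: node_def heading_def inner_complex_def)
  ultimately show ?thesis by blast
qed

definition gap_mid :: complex where "gap_mid = Complex 1.45684 0.69988"

lemma Re_Im_ball: "dist m q < L \<Longrightarrow> \<bar>Re q - Re m\<bar> < L \<and> \<bar>Im q - Im m\<bar> < L"
  using abs_Re_le_cmod[of "m - q"] abs_Im_le_cmod[of "m - q"] by (auto simp: dist_norm)

text \<open>The distance from \<open>m\<close> to the diagonal is
  \<open>(Re m - Im m) / sqrt 2\<close>, so the ball does not reach it. The diagonal is a symmetry
  axis of the gadget and bounds the wedge into which points are folded.\<close>

lemma wedge_ball:
  assumes "dist m q < L" "2 * L\<^sup>2 \<le> (Re m - Im m)\<^sup>2" "Im m < Re m"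
  shows "Im q < Re q"
proof (rule ccontr)
  assume "\<not> Im q < Re q"
  define x y where "x = Re m - Re q" and "y = Im q - Im m"
  have "(dist m q)\<^sup>2 = x\<^sup>2 + y\<^sup>2" by (simp add: dist_norm cmod_power2 x_def y_def power2_commute)
  moreover have "(dist m q)\<^sup>2 < L\<^sup>2" using assms(1) by (intro power_strict_mono) auto
  moreover have "x + y \<ge> Re m - Im m" using \<open>\<not> Im q < Re q\<close> by (simp add: x_def y_def)
  then have "(Re m - Im m)\<^sup>2 \<le> (x + y)\<^sup>2" using assms(3) by (intro power_mono) auto
  moreover have "(x + y)\<^sup>2 \<le> 2 * (x\<^sup>2 + y\<^sup>2)" using sum_squares_bound[of x y] by (simp add: power2_sum)
  ultimately have "2 * L\<^sup>2 \<le> 2 * (x\<^sup>2 + y\<^sup>2)" "x\<^sup>2 + y\<^sup>2 < L\<^sup>2" using assms(2) by (meson order_trans, simp)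
  then show False by simp
qed

lemma inner_g3: "inner (g3 - q) (cis turn3) = ((2.025 - Re q) * 15 + (0.825 - Im q) * 8) / 17"
  by (simp add: inner_complex_def g3_def field_simps)

text \<open>
  Three balls, centred at the critical points of the three gaps between consecutive samples, which
  avoid the medial axis. Since the local feature size is 1-Lipschitz, no other point has to be examined.
\<close>

lemma ball_good:
  assumes mL: "(m, L) \<in> {(1, 0.705), (gap_mid, 0.535), (g3, 0.4)}" and q: "dist m q < L" "0 \<le> Im q"
  shows "Im q < Re q" "\<exists>z. nearest q hchain z \<and> (Im q = 0 \<longrightarrow> z = 1)"
proof -
  have b: "Re q - Re m < L" "Re m - Re q < L" "Im q - Im m < L" "Im m - Im q < L"
    using Re_Im_ball[OF q(1)] by auto
  consider "m = 1" "L = 0.705" | "m = gap_mid" "L = 0.535" | "m = g3" "L = 0.4" using mL by auto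
  note cs = this
  have "2 * L\<^sup>2 \<le> (Re m - Im m)\<^sup>2 \<and> Im m < Re m"
  proof (cases rule: cs)
    case 1 show ?thesis unfolding 1 by (simp add: power2_eq_square)
  next
    case 2 show ?thesis unfolding 2 by (simp add: gap_mid_def power2_eq_square)
  next
    case 3 show ?thesis unfolding 3 by (simp add: g3_def power2_eq_square)
  qed
  then show "Im q < Re q" by (intro wedge_ball[OF q(1)]) auto
  \<comment> \<open>The last ray starts at distance \<open>radius_e\<close> > 2.184 from 0 in
    direction \<open>u0\<close>, so a point of norm below 2.184 projects before its start.\<close>
  have far: "inner (sample_e - q) u0 > 0" if "norm q < 2.184"
  proof -
    have "inner (sample_e - q) u0 = radius_e * inner u0 u0 - inner q u0"
      by (simp add: sample_e_eq inner_diff_left scaleR_conv_of_real[symmetric])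
    moreover have "inner q u0 \<le> norm q" using norm_cauchy_schwarz[of q u0] by simp
    moreover have "inner u0 u0 = 1" by simp
    ultimately show ?thesis using radius_e_gt that by simp
  qed
  have nq: "norm q \<le> norm m + dist m q" by (metis dist_commute dist_norm norm_triangle_sub)
  show "\<exists>z. nearest q hchain z \<and> (Im q = 0 \<longrightarrow> z = 1)"
  proof (rule hchain_nearest[OF q(2)])
    show "0.04 < Im q \<or> Re q < 1.705" using b by (cases rule: cs) (auto simp: gap_mid_def g3_def)
    show "1.705 < Re q \<or> inner (g3 - q) (cis turn3) > 0"
      unfolding inner_g3 using b by (cases rule: cs) (auto simp: gap_mid_def g3_def)
    show "inner (g3 - q) (cis turn3) < 0 \<or> inner (sample_e - q) u0 > 0"
    proof (cases rule: cs)
      case 1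
      then have "norm q < 2.184" using nq q by simp
      then show ?thesis using far by simp
    next
      case 2
      have "norm gap_mid \<le> 1.62" by (subst cmod_le_iff_square) (simp_all add: gap_mid_def power2_eq_square)
      then have "norm q < 2.184" using nq q 2 by simp
      then show ?thesis using far by simp
    next
      case 3
      show ?thesis
      proof (rule ccontr)
        assume "\<not> ?thesis"
        then have h: "inner (g3 - q) (cis turn3) \<ge> 0" "inner (sample_e - q) u0 \<le> 0" by auto
        \<comment> \<open>The excluded wedge of the last arc has its apex at \<open>o4\<close>, at
          distance \<open>R4\<close> from \<open>g3\<close>. Resolving \<open>u0\<close> along the
          heading at \<open>g3\<close> and its normal shows that \<open>w\<close> would need a
          normal component of at least \<open>R4\<close>, against
          \<open>norm w < 0.4\<close>.\<close>
        define w where "w = q - g3"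
        have w: "norm w < 0.4" using q 3 by (simp add: w_def dist_norm norm_minus_commute)
        have w1: "inner w (cis turn3) \<le> 0" using h by (simp add: w_def inner_diff_left)
        have "inner (sample_e - g3) u0 = R4 * sin turn4"
        proof -
          have "inner sample_e u0 = radius_e" by (simp add: sample_e_eq scaleR_conv_of_real[symmetric])
          moreover have "inner g3 u0 = cos8 * (2.025 + 0.825 * tan8)"
            by (simp add: inner_complex_def g3_def sin8_eq algebra_simps)
          ultimately show ?thesis by (simp add: inner_diff_left radius_e_def)
        qed
        then have "inner w u0 \<ge> R4 * sin turn4" using h by (simp add: w_def inner_diff_left)
        moreover have "u0 = cos turn4 *\<^sub>R cis turn3 + sin turn4 *\<^sub>R (- \<i> * cis turn3)"
        proof -
          have "u0 = cis turn3 * cis (- turn4)" by (simp add: u0_def turn4_def cis_mult)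
          then show ?thesis by (simp add: complex_eq_iff algebra_simps)
        qed
        then have "inner w u0 = cos turn4 * inner w (cis turn3) + sin turn4 * inner w (- \<i> * cis turn3)"
          by (metis inner_add_right inner_scaleR_right)
        moreover have "cos turn4 * inner w (cis turn3) \<le> 0" using w1 turn4_bounds by (intro mult_nonneg_nonpos cos_ge_zero) auto
        moreover have "inner w (- \<i> * cis turn3) \<le> norm w" using norm_cauchy_schwarz[of w "- \<i> * cis turn3"] by (simp add: norm_mult)
        then have "sin turn4 * inner w (- \<i> * cis turn3) \<le> sin turn4 * norm w" using sin_turn4_pos by (intro mult_left_mono) auto
        ultimately have "R4 * sin turn4 \<le> norm w * sin turn4" by (simp add: mult.commute)
        then show False using sin_turn4_pos R4_gt w by simp
      qed
    qed
  qed
qed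

section \<open>Samples on the half chain\<close>

text \<open>
  The samples \<open>sample_a\<close>, \<open>sample_b\<close> and \<open>sample_e\<close> are the points of the half chain on the line through 0 and \<open>u0\<close>. This line is the
  axis of the reflection exchanging the two resolutions of the gadget, so both contain these points.
\<close>

lemma angle_a_ex: "\<exists>\<phi>. arccos 0.787 \<le> \<phi> \<and> \<phi> \<le> arccos 0.782 \<and> 0.04 + 0.705 * sin \<phi> = tan8 * (1.705 - 0.705 * cos \<phi>)"
proof -
  let ?f = "\<lambda>\<phi>. 0.04 + 0.705 * sin \<phi> - tan8 * (1.705 - 0.705 * cos \<phi>)"
  have "sqrt (1 - 0.787\<^sup>2) \<le> 0.617" by (rule real_le_lsqrt) (simp_all add: power2_eq_square)
  then have s1: "sin (arccos 0.787) \<le> 0.617" by (simp add: sin_arccos)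
  have "0.623 \<le> sqrt (1 - 0.782\<^sup>2)" by (rule real_le_rsqrt) (simp_all add: power2_eq_square)
  then have s2: "sin (arccos 0.782) \<ge> 0.623" by (simp add: sin_arccos)
  have c: "cos (arccos 0.787) = 0.787" "cos (arccos 0.782) = 0.782" by (simp_all add: cos_arccos)
  have "?f (arccos 0.787) \<le> 0" unfolding c using s1 tan8_bounds by simp
  moreover have "0 \<le> ?f (arccos 0.782)" unfolding c using s2 tan8_bounds by simp
  moreover have "arccos 0.787 \<le> arccos 0.782" by (intro arccos_le_arccos) auto
  moreover have "continuous_on {arccos 0.787..arccos 0.782} ?f" by (intro continuous_intros)
  ultimately obtain x where "arccos 0.787 \<le> x" "x \<le> arccos 0.782" "?f x = 0"
    using IVT'[of ?f "arccos 0.787" 0 "arccos 0.782"] by blast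
  then show ?thesis by (intro exI[of _ x]) simp
qed

definition angle_a :: real where
  "angle_a = (SOME \<phi>. arccos 0.787 \<le> \<phi> \<and> \<phi> \<le> arccos 0.782 \<and> 0.04 + 0.705 * sin \<phi> = tan8 * (1.705 - 0.705 * cos \<phi>))"

lemma angle_a_prop: "arccos 0.787 \<le> angle_a" "angle_a \<le> arccos 0.782" "0.04 + 0.705 * sin angle_a = tan8 * (1.705 - 0.705 * cos angle_a)"
  using someI_ex[OF angle_a_ex] unfolding angle_a_def by blast+

lemma angle_a_range: "0 < angle_a" "angle_a < pi / 2"
proof -
  have "0 < arccos (0.787::real)" using arccos_less_arccos[of "0.787" 1] by simp
  then show "0 < angle_a" using angle_a_prop by simp
  have "arccos (0.782::real) < pi / 2" using arccos_less_arccos[of 0 "0.782"] by simp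
  then show "angle_a < pi / 2" using angle_a_prop by simp
qed

lemma angle_a_trig: "0.782 \<le> cos angle_a" "cos angle_a \<le> 0.787" "0.6169 \<le> sin angle_a"
proof -
  have r: "0 \<le> arccos (0.787::real)" "arccos (0.782::real) \<le> pi" by (simp_all add: arccos_lbound arccos_ubound)
  show c: "0.782 \<le> cos angle_a" using cos_monotone_0_pi_le[of angle_a "arccos 0.782"] angle_a_prop angle_a_range r by (simp add: cos_arccos)
  show c': "cos angle_a \<le> 0.787" using cos_monotone_0_pi_le[of "arccos 0.787" angle_a] angle_a_prop angle_a_range r by (simp add: cos_arccos)
  have "(cos angle_a)\<^sup>2 \<le> 0.787\<^sup>2" using c c' by (intro power_mono) auto
  moreover have "(0.6169::real)\<^sup>2 \<le> 1 - 0.787\<^sup>2" by (simp add: power2_eq_square)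
  ultimately have "0.6169\<^sup>2 \<le> (sin angle_a)\<^sup>2" unfolding sin_squared_eq by linarith
  moreover have "0 \<le> sin angle_a" using angle_a_range by (intro sin_ge_zero) auto
  ultimately show "0.6169 \<le> sin angle_a" by (rule power2_le_imp_le)
qed

text \<open>The second arc takes the curve back below the strand line; this is the angle of that
  crossing.\<close>

lemma angle_b_ex: "\<exists>\<phi>. arcsin 0.16 \<le> \<phi> \<and> \<phi> \<le> arcsin 0.19 \<and> 1.425 - 0.68 * cos \<phi> = tan8 * (1.705 + 0.68 * sin \<phi>)"
proof -
  let ?f = "\<lambda>\<phi>. tan8 * (1.705 + 0.68 * sin \<phi>) - (1.425 - 0.68 * cos \<phi>)"
  have "sqrt (1 - 0.16\<^sup>2) \<le> 0.98713" by (rule real_le_lsqrt) (simp_all add: power2_eq_square)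
  then have s1: "cos (arcsin 0.16) \<le> 0.98713" by (simp add: cos_arcsin)
  have "0.9817 \<le> sqrt (1 - 0.19\<^sup>2)" by (rule real_le_rsqrt) (simp_all add: power2_eq_square)
  then have s2: "cos (arcsin 0.19) \<ge> 0.9817" by (simp add: cos_arcsin)
  have c: "sin (arcsin 0.16) = 0.16" "sin (arcsin 0.19) = 0.19" by (simp_all add: sin_arcsin)
  have "?f (arcsin 0.16) \<le> 0" unfolding c using s1 tan8_bounds by simp
  moreover have "0 \<le> ?f (arcsin 0.19)" unfolding c using s2 tan8_bounds by simp
  moreover have "arcsin 0.16 \<le> arcsin 0.19" by (intro arcsin_le_arcsin) auto
  moreover have "continuous_on {arcsin 0.16..arcsin 0.19} ?f" by (intro continuous_intros)
  ultimately obtain x where "arcsin 0.16 \<le> x" "x \<le> arcsin 0.19" "?f x = 0"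
    using IVT'[of ?f "arcsin 0.16" 0 "arcsin 0.19"] by blast
  then show ?thesis by (intro exI[of _ x]) simp
qed

definition angle_b :: real where
  "angle_b = (SOME \<phi>. arcsin 0.16 \<le> \<phi> \<and> \<phi> \<le> arcsin 0.19 \<and> 1.425 - 0.68 * cos \<phi> = tan8 * (1.705 + 0.68 * sin \<phi>))"

lemma angle_b_prop: "arcsin 0.16 \<le> angle_b" "angle_b \<le> arcsin 0.19" "1.425 - 0.68 * cos angle_b = tan8 * (1.705 + 0.68 * sin angle_b)"
  using someI_ex[OF angle_b_ex] unfolding angle_b_def by blast+

lemma angle_b_range: "0 < angle_b" "angle_b < turn3"
proof -
  have "0 < arcsin (0.16::real)" using arcsin_less_arcsin[of 0 "0.16"] by simp
  then show "0 < angle_b" using angle_b_prop by simp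
  have "arcsin (0.19::real) < arcsin (sin turn3)" by (intro arcsin_less_arcsin) auto
  moreover have "arcsin (sin turn3) = turn3" by (rule arcsin_sin) (use turn3_bounds pi_gt_zero in auto)
  ultimately have "arcsin (0.19::real) < turn3" by (simp only:)
  then show "angle_b < turn3" using angle_b_prop by simp
qed

lemma angle_b_trig: "0.16 \<le> sin angle_b" "sin angle_b \<le> 0.19" "0.9817 \<le> cos angle_b"
proof -
  have r: "- (pi / 2) \<le> arcsin (0.16::real)" "arcsin (0.19::real) \<le> pi / 2" by (rule arcsin_lbound arcsin_ubound; simp)+
  have r': "angle_b \<le> pi / 2" using angle_b_range turn3_bounds by simp
  show c: "0.16 \<le> sin angle_b" using sin_monotone_2pi_le[of "arcsin 0.16" angle_b] angle_b_prop r r' by (simp add: sin_arcsin)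
  show c': "sin angle_b \<le> 0.19" using sin_monotone_2pi_le[of angle_b "arcsin 0.19"] angle_b_prop angle_b_range r by (simp add: sin_arcsin)
  have "(sin angle_b)\<^sup>2 \<le> 0.19\<^sup>2" using c c' by (intro power_mono) auto
  moreover have "(0.9817::real)\<^sup>2 \<le> 1 - 0.19\<^sup>2" by (simp add: power2_eq_square)
  ultimately have "0.9817\<^sup>2 \<le> (cos angle_b)\<^sup>2" unfolding cos_squared_eq by linarith
  moreover have "0 \<le> cos angle_b" using angle_b_range r' by (intro cos_ge_zero) auto
  ultimately show "0.9817 \<le> cos angle_b" by (rule power2_le_imp_le)
qed

text \<open>The Pythagorean triple 44, 117, 125 gives the rational values 0.352 and 0.936, which
  place \<open>gap_mid\<close>, the centre of the second ball, exactly on the first arc.\<close>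

definition angle_m :: real where "angle_m = arccos 0.352"
lemma angle_m_trig [simp]: "cos angle_m = 0.352" "sin angle_m = 0.936"
proof -
  show "cos angle_m = 0.352" by (simp add: angle_m_def cos_arccos)
  have "sin angle_m = sqrt (1 - 0.352\<^sup>2)" by (simp add: angle_m_def sin_arccos)
  also have "1 - 0.352\<^sup>2 = (0.936::real)\<^sup>2" by (simp add: power2_eq_square)
  finally have "sin angle_m = \<bar>0.936\<bar>" by (simp only: real_sqrt_abs)
  then show "sin angle_m = 0.936" by simp
qed
lemma angle_m_range: "angle_a < angle_m" "angle_m < pi / 2"
proof -
  have "arccos (0.782::real) < angle_m" unfolding angle_m_def by (intro arccos_less_arccos) auto
  then show "angle_a < angle_m" using angle_a_prop by simp
  show "angle_m < pi / 2" using arccos_less_arccos[of 0 "0.352"] by (simp add: angle_m_def)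
qed

definition arc2 :: "real \<Rightarrow> complex" where "arc2 \<phi> = o2 + (-0.705) * cis (-1 * \<phi>)"
definition arc3 :: "real \<Rightarrow> complex" where "arc3 \<phi> = o3 + (-0.68 * \<i>) * cis (1 * \<phi>)"
definition arc4 :: "real \<Rightarrow> complex" where "arc4 \<phi> = o4 + (of_real R4 * \<i> * cis turn3) * cis (-1 * \<phi>)"

lemma arc2_parts: "Re (arc2 \<phi>) = 1.705 - 0.705 * cos \<phi>" "Im (arc2 \<phi>) = 0.04 + 0.705 * sin \<phi>"
  by (simp_all add: arc2_def o2_def)
lemma arc3_parts: "Re (arc3 \<phi>) = 1.705 + 0.68 * sin \<phi>" "Im (arc3 \<phi>) = 1.425 - 0.68 * cos \<phi>"
  by (simp_all add: arc3_def o3_def)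
lemma arc4_parts: "Re (arc4 \<phi>) = 2.025 + R4 * (8 / 17 - sin (turn3 - \<phi>))" "Im (arc4 \<phi>) = 0.825 + R4 * (cos (turn3 - \<phi>) - 15 / 17)"
  by (simp_all add: arc4_def o4_def g3_def cos_diff sin_diff algebra_simps)

definition sample_a :: complex where "sample_a = arc2 angle_a"
definition sample_b :: complex where "sample_b = arc3 angle_b"
definition radius_a :: real where "radius_a = Re sample_a / cos8"
definition radius_b :: real where "radius_b = Re sample_b / cos8"

lemma sample_a_eq: "sample_a = of_real radius_a * u0"
  using angle_a_prop(3) cos8_pos by (simp add: complex_eq_iff sample_a_def arc2_parts radius_a_def sin8_eq)
lemma sample_b_eq: "sample_b = of_real radius_b * u0"
  using angle_b_prop(3) cos8_pos by (simp add: complex_eq_iff sample_b_def arc3_parts radius_b_def sin8_eq)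
lemma radius_a_pos: "0 < radius_a" "radius_a < 2"
  using angle_a_trig cos8_bounds by (auto simp: radius_a_def sample_a_def arc2_parts field_simps)
lemma radius_b_pos: "0 < radius_b" "radius_b < 3"
  using angle_b_trig cos8_bounds by (auto simp: radius_b_def sample_b_def arc3_parts field_simps)

lemma arc_values: "arc2 0 = g1" "arc2 (pi / 2) = g2" "arc2 angle_m = gap_mid" "arc3 0 = g2" "arc3 turn3 = g3" "arc4 0 = g3" "arc4 turn4 = sample_e"
  by (simp_all add: complex_eq_iff arc2_parts arc3_parts arc4_parts g1_def g2_def g3_def gap_mid_def)
     (simp_all add: turn4_def sample_e_def o4_def g3_def u0_def cos8_def sin8_def algebra_simps)

lemma link_P: "link 0 = closed_segment 1 g1" "link 1 = arc2 ` {0..pi / 2}" "link 2 = arc3 ` {0..turn3}" "link 3 = arc4 ` {0..turn4}" "link 4 = closed_segment sample_e (4 * u0)"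
  by (simp_all add: circle_arc_def arc2_def arc3_def arc4_def numeral_2_eq_2 numeral_3_eq_3 eval_nat_numeral)

lemma hchain_cases: "hchain = closed_segment 1 g1 \<union> arc2 ` {0..pi / 2} \<union> arc3 ` {0..turn3} \<union> arc4 ` {0..turn4} \<union> closed_segment sample_e (4 * u0)"
proof -
  have "{..<5::nat} = {0, 1, 2, 3, 4}" by auto
  then show ?thesis unfolding hchain_def by (simp only: UN_insert UN_empty link_P Un_empty_right Un_assoc)
qed

lemma dist_lt_sq: "(dist x y)\<^sup>2 < r\<^sup>2 \<Longrightarrow> 0 \<le> r \<Longrightarrow> dist x y < r"
  by (rule power2_less_imp_less)

lemma s_one: "(1::real) = 1 \<or> (1::real) = -1" "(-1::real) = 1 \<or> (-1::real) = -1" by auto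

lemma arc2_chord2: "(dist (arc2 \<phi>) (arc2 \<psi>))\<^sup>2 = 2 * 0.705\<^sup>2 * (1 - cos (\<phi> - \<psi>))"
  unfolding arc2_def circle_arc_chord2[OF s_one(2)] by simp
lemma arc3_chord2: "(dist (arc3 \<phi>) (arc3 \<psi>))\<^sup>2 = 2 * 0.68\<^sup>2 * (1 - cos (\<phi> - \<psi>))"
  unfolding arc3_def circle_arc_chord2[OF s_one(1)] by (simp add: norm_mult)

text \<open>The bounds are budgets: 0.4676 is 0.72 * 0.705 less the length 0.04 of the first
  segment, 0.3852 is 0.72 * 0.535, the third and fourth together stay below 0.3852, and 0.288 is
  0.72 * 0.4.\<close>

lemma gap_numbers:
  "dist g1 sample_a < 0.4676" "dist sample_a gap_mid < 0.3852" "dist gap_mid g2 < 0.2523" "dist g2 sample_b < 0.1301" "dist sample_b g3 < 0.288"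
proof -
  have "(dist g1 sample_a)\<^sup>2 = 2 * 0.705\<^sup>2 * (1 - cos angle_a)"
    unfolding arc_values(1)[symmetric] sample_a_def arc2_chord2 by simp
  then show "dist g1 sample_a < 0.4676" using angle_a_trig by (intro dist_lt_sq) (simp_all add: power2_eq_square)
  have "(dist sample_a gap_mid)\<^sup>2 = 2 * 0.705\<^sup>2 * (1 - (cos angle_a * 0.352 + sin angle_a * 0.936))"
    unfolding arc_values(3)[symmetric] sample_a_def arc2_chord2 cos_diff by simp
  then show "dist sample_a gap_mid < 0.3852" using angle_a_trig by (intro dist_lt_sq) (simp_all add: power2_eq_square)
  have "(dist gap_mid g2)\<^sup>2 = 2 * 0.705\<^sup>2 * (1 - 0.936)"
    unfolding arc_values(3)[symmetric] arc_values(2)[symmetric] arc2_chord2 cos_diff by simp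
  then show "dist gap_mid g2 < 0.2523" by (intro dist_lt_sq) (simp_all add: power2_eq_square)
  have "(dist g2 sample_b)\<^sup>2 = 2 * 0.68\<^sup>2 * (1 - cos angle_b)"
    unfolding arc_values(4)[symmetric] sample_b_def arc3_chord2 by simp
  then show "dist g2 sample_b < 0.1301" using angle_b_trig by (intro dist_lt_sq) (simp_all add: power2_eq_square)
  have "(dist sample_b g3)\<^sup>2 = 2 * 0.68\<^sup>2 * (1 - (cos angle_b * (15 / 17) + sin angle_b * (8 / 17)))"
    unfolding arc_values(5)[symmetric] sample_b_def arc3_chord2 cos_diff by simp
  then show "dist sample_b g3 < 0.288" using angle_b_trig by (intro dist_lt_sq) (simp_all add: power2_eq_square)
qed

text \<open>A ball of radius \<open>L\<close> about \<open>m\<close> that avoids the medial axis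
  gives local feature size at least \<open>L - dist y m\<close> at \<open>y\<close>; the inequality
  is the sampling condition with this bound inserted.\<close>

lemma gap_bound:
  assumes "y \<in> hchain"
  shows "y \<in> closed_segment sample_e (4 * u0) \<or> (\<exists>s\<in>{sample_a, sample_b, sample_e}. \<exists>m L. (m, L) \<in> {(1, 0.705), (gap_mid, 0.535), (g3, 0.4)} \<and> dist y s + 0.72 * dist y m < 0.72 * L)"
    (is "_ \<or> ?G")
proof -
  have g11: "dist g1 1 = 0.04" by (simp add: g1_def dist_norm cmod_def)
  consider "y \<in> closed_segment sample_e (4 * u0)" | "y \<in> closed_segment 1 g1" | \<phi> where "0 \<le> \<phi>" "\<phi> \<le> pi / 2" "y = arc2 \<phi>"
    | \<phi> where "0 \<le> \<phi>" "\<phi> \<le> turn3" "y = arc3 \<phi>" | \<phi> where "0 \<le> \<phi>" "\<phi> \<le> turn4" "y = arc4 \<phi>"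
    using assms unfolding hchain_cases by auto
  then show ?thesis
  proof cases
    case 1 then show ?thesis ..
  next
    case 2
    then have "dist y 1 + dist y g1 = 0.04" using g11 between[of 1 g1 y] between_mem_segment[of 1 g1 y] by (simp add: dist_commute)
    moreover have "dist y sample_a \<le> dist y g1 + dist g1 sample_a" by (rule dist_triangle)
    ultimately have "dist y sample_a + 0.72 * dist y 1 < 0.72 * 0.705" using gap_numbers(1) zero_le_dist[of y 1]
      by (simp del: zero_le_dist)
    then show ?thesis by blast
  next
    case (3 \<phi>)
    note bt = circle_arc_between[OF s_one(2), where o'=o2 and v="-0.705", folded arc2_def]
    consider "\<phi> \<le> angle_a" | "angle_a \<le> \<phi>" "\<phi> \<le> angle_m" | "angle_m \<le> \<phi>" by linarith
    then show ?thesis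
    proof cases
      case 1
      have "dist y sample_a + 0.72 * dist y g1 \<le> dist g1 sample_a"
        using bt(2)[of 0 \<phi> angle_a] 1 3 angle_a_range angle_a_trig by (simp add: arc_values(1) sample_a_def)
      moreover have "dist y 1 \<le> dist y g1 + dist g1 1" by (rule dist_triangle)
      ultimately have "dist y sample_a + 0.72 * dist y 1 < 0.72 * 0.705" using gap_numbers(1) g11 by simp
      then show ?thesis by blast
    next
      case 2
      have "cos (angle_m - angle_a) \<ge> 1 / 10" unfolding cos_diff using angle_a_trig by simp
      then have "dist y sample_a + 0.72 * dist y gap_mid \<le> dist sample_a gap_mid"
        using bt(1)[of angle_a \<phi> angle_m] 2 3 angle_a_range angle_m_range by (simp add: arc_values(3) sample_a_def)
      then have "dist y sample_a + 0.72 * dist y gap_mid < 0.72 * 0.535" using gap_numbers(2) by simp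
      then show ?thesis by blast
    next
      case 3
      \<comment> \<open>Beyond \<open>angle_m\<close> the sample to be reached is
        \<open>sample_b\<close> on the next link, by way of the joint \<open>g2\<close>.\<close>
      have "cos (pi / 2 - angle_m) \<ge> 1 / 10" unfolding cos_diff by simp
      then have "dist y g2 + 0.72 * dist y gap_mid \<le> dist gap_mid g2"
        using bt(2)[of angle_m \<phi> "pi / 2"] 3 \<open>\<phi> \<le> pi / 2\<close> angle_a_range angle_m_range \<open>y = arc2 \<phi>\<close> by (simp add: arc_values(2,3))
      moreover have "dist y sample_b \<le> dist y g2 + dist g2 sample_b" by (rule dist_triangle)
      ultimately have "dist y sample_b + 0.72 * dist y gap_mid < 0.72 * 0.535" using gap_numbers(3,4) by simp
      then show ?thesis by blast
    qed
  next
    case (4 \<phi>)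
    note bt = circle_arc_between[OF s_one(1), where o'=o3 and v="-0.68 * \<i>", folded arc3_def]
    show ?thesis
    proof (cases "\<phi> \<le> angle_b")
      case True
      have "dist y sample_b + 0.72 * dist y g2 \<le> dist g2 sample_b"
        using bt(2)[of 0 \<phi> angle_b] True 4 angle_b_range turn3_bounds angle_b_trig pi_gt_zero by (simp add: arc_values(4) sample_b_def)
      moreover have "dist y gap_mid \<le> dist y g2 + dist g2 gap_mid" by (rule dist_triangle)
      ultimately have "dist y sample_b + 0.72 * dist y gap_mid < 0.72 * 0.535" using gap_numbers(3,4) by (simp add: dist_commute)
      then show ?thesis by blast
    next
      case False
      have "cos (turn3 - angle_b) \<ge> 1 / 10" unfolding cos_diff using angle_b_trig by simp
      then have "dist y sample_b + 0.72 * dist y g3 \<le> dist sample_b g3"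
        using bt(1)[of angle_b \<phi> turn3] False 4 angle_b_range turn3_bounds pi_gt_zero by (simp add: arc_values(5) sample_b_def)
      then have "dist y sample_b + 0.72 * dist y g3 < 0.72 * 0.4" using gap_numbers(5) by simp
      then show ?thesis by blast
    qed
  next
    case (5 \<phi>)
    note bt = circle_arc_between[OF s_one(2), where o'=o4 and v="of_real R4 * \<i> * cis turn3", folded arc4_def]
    have "dist y sample_e + 0.72 * dist y g3 \<le> dist g3 sample_e"
      using bt(2)[of 0 \<phi> turn4] 5 turn4_bounds cos_turn4_bounds pi_gt_zero by (simp add: arc_values(6,7))
    then have "dist y sample_e + 0.72 * dist y g3 < 0.72 * 0.4" using g3_sample_e by simp
    then show ?thesis by blast
  qed
qed

lemma ray_param: "y \<in> closed_segment sample_e (4 * u0) \<longleftrightarrow> (\<exists>t. radius_e \<le> t \<and> t \<le> 4 \<and> y = of_real t * u0)"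
proof
  assume "y \<in> closed_segment sample_e (4 * u0)"
  then obtain s where s: "0 \<le> s" "s \<le> 1" "y = (1 - s) *\<^sub>R sample_e + s *\<^sub>R (4 * u0)" by (auto simp: closed_segment_def)
  then have "y = of_real (radius_e + s * (4 - radius_e)) * u0" by (simp add: sample_e_eq scaleR_conv_of_real algebra_simps)
  moreover have "radius_e \<le> radius_e + s * (4 - radius_e)" using s radius_e_lt by simp
  moreover have "s * (4 - radius_e) \<le> 4 - radius_e" using s radius_e_lt by (intro mult_left_le_one_le) auto
  then have "radius_e + s * (4 - radius_e) \<le> 4" by simp
  ultimately show "\<exists>t. radius_e \<le> t \<and> t \<le> 4 \<and> y = of_real t * u0" by blast
next
  assume "\<exists>t. radius_e \<le> t \<and> t \<le> 4 \<and> y = of_real t * u0"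
  then obtain t where t: "radius_e \<le> t" "t \<le> 4" "y = of_real t * u0" by blast
  define s where "s = (t - radius_e) / (4 - radius_e)"
  have ts: "t = radius_e + s * (4 - radius_e)" using radius_e_lt by (simp add: s_def)
  have "y = (1 - s) *\<^sub>R sample_e + s *\<^sub>R (4 * u0)" 
  proof -
    have "y = of_real (radius_e + s * (4 - radius_e)) * u0" using t(3) ts by (simp only:)
    then show ?thesis by (simp add: sample_e_eq scaleR_conv_of_real algebra_simps)
  qed
  moreover have "0 \<le> s" "s \<le> 1" using t radius_e_lt by (auto simp: s_def field_simps)
  ultimately show "y \<in> closed_segment sample_e (4 * u0)" by (auto simp: closed_segment_def)
qed

lemma arc4_near:
  assumes "0 \<le> \<phi>" "\<phi> \<le> turn4"
  shows "dist (arc4 \<phi>) g3 < 0.4"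
proof -
  have "dist (arc4 \<phi>) sample_e + 0.72 * dist (arc4 \<phi>) g3 \<le> dist g3 sample_e"
    using circle_arc_between(2)[OF s_one(2), where o'=o4 and v="of_real R4 * \<i> * cis turn3", folded arc4_def, of 0 \<phi> turn4]
      assms turn4_bounds cos_turn4_bounds pi_gt_zero by (simp add: arc_values(6,7))
  then show ?thesis using g3_sample_e zero_le_dist[of "arc4 \<phi>" sample_e] by (simp del: zero_le_dist)
qed

text \<open>The wedge between the real axis and the diagonal is a fundamental domain for the
  symmetries of the gadget. The half chain touches its boundary only at 1, and the circle of radius
  4 only at its end, so reflected copies and strands can be attached without unwanted
  intersections.\<close>

lemma hchain_wedge:
  assumes "y \<in> hchain"
  shows "0 \<le> Im y" "Im y < Re y" "Im y = 0 \<Longrightarrow> y = 1" "norm y \<le> 4" "norm y = 4 \<Longrightarrow> y = 4 * u0"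
    and "1 \<le> Re y"
proof -
  have "0 \<le> Im y \<and> Im y < Re y \<and> (Im y = 0 \<longrightarrow> y = 1) \<and> 1 \<le> Re y \<and> (norm y < 4 \<or> y = 4 * u0)"
    using assms unfolding hchain_cases
  proof (elim UnE imageE)
    assume "y \<in> closed_segment 1 g1"
    then obtain s where s: "0 \<le> s" "s \<le> 1" "y = (1 - s) *\<^sub>R 1 + s *\<^sub>R g1" by (auto simp: closed_segment_def)
    then have R: "Re y = 1" "Im y = 0.04 * s" by (simp_all add: g1_def)
    have "norm y < 4" using cmod_le[of y] s(1,2) unfolding R by simp
    then show ?thesis using s(1,2) R by (simp add: complex_eq_iff[of y 1])
  next
    fix \<phi> assume y: "y = arc2 \<phi>" and p: "\<phi> \<in> {0..pi / 2}"
    define c s where "c = cos \<phi>" and "s = sin \<phi>"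
    have b: "0 \<le> c" "0 \<le> s" "c \<le> 1" "s \<le> 1" using p unfolding c_def s_def by (auto intro: cos_ge_zero sin_ge_zero)
    have R: "Re y = 1.705 - 0.705 * c" "Im y = 0.04 + 0.705 * s" by (simp_all add: y arc2_parts c_def s_def)
    show ?thesis using b cmod_le[of y] unfolding R by auto
  next
    fix \<phi> assume y: "y = arc3 \<phi>" and p: "\<phi> \<in> {0..turn3}"
    have "15 / 17 \<le> cos \<phi>" using cos_monotone_0_pi_le[of \<phi> turn3] p turn3_bounds pi_gt_zero by simp
    moreover have "0 \<le> sin \<phi>" using p turn3_bounds pi_gt_zero by (auto intro!: sin_ge_zero)
    moreover define c s where "c = cos \<phi>" and "s = sin \<phi>"
    ultimately have b: "15 / 17 \<le> c" "0 \<le> s" "c \<le> 1" "s \<le> 1" unfolding c_def s_def by auto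
    have R: "Re y = 1.705 + 0.68 * s" "Im y = 1.425 - 0.68 * c" by (simp_all add: y arc3_parts c_def s_def)
    show ?thesis using b cmod_le[of y] unfolding R by auto
  next
    fix \<phi> assume y: "y = arc4 \<phi>" and p: "\<phi> \<in> {0..turn4}"
    have d: "dist y g3 < 0.4" using arc4_near p y by simp
    then have "\<bar>Re y - 2.025\<bar> < 0.4" "\<bar>Im y - 0.825\<bar> < 0.4" using Re_Im_ball[of g3 y "0.4"] by (simp_all add: dist_commute g3_def)
    moreover have "norm y \<le> \<bar>Re y\<bar> + \<bar>Im y\<bar>" by (rule cmod_le)
    ultimately show ?thesis by (auto simp: abs_less_iff abs_if split: if_splits)
  next
    assume "y \<in> closed_segment sample_e (4 * u0)"
    then obtain t where t: "radius_e \<le> t" "t \<le> 4" "y = of_real t * u0" unfolding ray_param by blast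
    have "t > 2.184" using t radius_e_gt by simp
    moreover have "0 < tan8 * cos8" "tan8 * cos8 < cos8 * 1" using cos8_pos tan8_bounds by auto
    moreover have "t * (tan8 * cos8) < t * cos8" "0 < t * (tan8 * cos8)" using calculation by (auto intro!: mult_pos_pos simp: mult_less_cancel_left)
    moreover have "2.184 * 0.92387 \<le> t * cos8" using \<open>t > 2.184\<close> cos8_bounds by (intro mult_mono) auto
    moreover have "norm y = t" using t \<open>t > 2.184\<close> by (simp add: norm_mult)
    ultimately show ?thesis using t by (auto simp: sin8_eq)
  qed
  then show "0 \<le> Im y" "Im y < Re y" "Im y = 0 \<Longrightarrow> y = 1" "norm y \<le> 4" "norm y = 4 \<Longrightarrow> y = 4 * u0" "1 \<le> Re y"
    by (auto simp: norm_mult)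
qed

section \<open>The gadget and folding into one wedge\<close>

definition rot :: "nat \<Rightarrow> complex \<Rightarrow> complex" where "rot t z = cis (real t * pi / 4) * z"
definition pocket :: "complex set" where "pocket = hchain \<union> cnj ` hchain"
text \<open>These are the pockets on one family of alternate octagon sides; the other resolution is
  the image under \<open>rot 1\<close>.\<close>

definition gadget :: "complex set" where "gadget = (\<Union>t\<in>{0,2,4,6}. rot t ` pocket)"

lemma rot_even: "rot 0 z = z" "rot 2 z = \<i> * z" "rot 4 z = - z" "rot 6 z = - \<i> * z"
proof -
  have "real 6 * pi / 4 = pi + pi / 2" by simp
  moreover have "cis (pi + pi / 2) = cis pi * cis (pi / 2)" by (rule cis_mult[symmetric])
  ultimately show "rot 6 z = - \<i> * z" by (simp only: rot_def cis_pi cis_pi_half) simp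
qed (simp_all add: rot_def)

lemma gadget_cases: "x \<in> gadget \<longleftrightarrow> (\<exists>y\<in>hchain. x = y \<or> x = cnj y \<or> x = \<i> * y \<or> x = \<i> * cnj y \<or> x = - y \<or> x = - cnj y \<or> x = - \<i> * y \<or> x = - \<i> * cnj y)"
  unfolding gadget_def pocket_def by (auto simp: rot_even image_Un)

text \<open>All eight images of \<open>y\<close> have the norm of \<open>y\<close>, so comparing
  distances from \<open>q\<close> means comparing inner products. For \<open>q\<close> in the wedge
  the image in the wedge has the largest one, strictly unless \<open>q\<close> or \<open>y\<close>
  is real. The assumption on real \<open>q\<close> settles that tie, as 1 is its own
  conjugate.\<close>

lemma fold_nearest:
  assumes u: "nearest q hchain z" and q: "0 \<le> Im q" "Im q < Re q" "Im q = 0 \<Longrightarrow> z = 1"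
  shows "nearest q gadget z"
proof -
  have zG: "z \<in> gadget" using u unfolding nearest_def gadget_cases by blast
  have "dist q z < dist q x" if x: "x \<in> gadget" "x \<noteq> z" for x
  proof -
    obtain y where y: "y \<in> hchain" and xy: "x = y \<or> x = cnj y \<or> x = \<i> * y \<or> x = \<i> * cnj y \<or> x = - y \<or> x = - cnj y \<or> x = - \<i> * y \<or> x = - \<i> * cnj y"
      using x gadget_cases by blast
    note w = hchain_wedge[OF y]
    define a b u v where "a = Re q" and "b = Im q" and "u = Re y" and "v = Im y"
    have r: "0 \<le> b" "b < a" "0 \<le> v" "v < u" using q w by (auto simp: a_def b_def u_def v_def)
    have nx: "norm x = norm y" using xy by (auto simp: norm_mult)
    have D: "(dist q w)\<^sup>2 = (norm q)\<^sup>2 + (norm w)\<^sup>2 - 2 * inner q w" for w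
      by (simp add: dist_norm power2_norm_eq_inner inner_diff inner_commute)
    have zy: "dist q z \<le> dist q y" using u y unfolding nearest_def by (cases "y = z") (auto simp: less_imp_le)
    \<comment> \<open>For each of the six images other than \<open>y\<close> and its conjugate, the
      difference of inner products is a nonnegative combination of these products.\<close>
    have au: "0 < a * u" "0 \<le> b * v" "0 \<le> a * v" "0 \<le> b * u" "0 < (a - b) * (u - v)" "0 < (a - b) * u"
      using r by auto
    have "inner q x < inner q y \<or> x = y \<or> (x = cnj y \<and> b = 0)"
    proof (cases "x = cnj y")
      case True
      show ?thesis
      proof (cases "b = 0 \<or> v = 0")
        case True
        then show ?thesis using \<open>x = cnj y\<close> w(3) by (auto simp: v_def)
      next
        case False
        then have "0 < b * v" using r by simp
        then show ?thesis using \<open>x = cnj y\<close> by (simp add: inner_complex_def a_def b_def u_def v_def)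
      qed
    next
      case False
      then show ?thesis using xy au
        by (auto simp: inner_complex_def a_def[symmetric] b_def[symmetric] u_def[symmetric] v_def[symmetric] algebra_simps)
    qed
    then show ?thesis
    proof (elim disjE)
      assume "inner q x < inner q y"
      then have "(dist q y)\<^sup>2 < (dist q x)\<^sup>2" unfolding D nx by simp
      then show ?thesis using zy dist_less_iff_square[of q y x] by simp
    next
      assume "x = y"
      then show ?thesis using x y u unfolding nearest_def by blast
    next
      assume h: "x = cnj y \<and> b = 0"
      then have "inner q x = inner q y" by (simp add: inner_complex_def b_def)
      then have "(dist q y)\<^sup>2 = (dist q x)\<^sup>2" unfolding D nx by simp
      then have e: "dist q y = dist q x" by simp
      have "z = 1" using q(3) h by (simp add: b_def)
      then have "y \<noteq> z" using h x by auto
      then show ?thesis using u y e unfolding nearest_def by metis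
    qed
  qed
  then show ?thesis using zG unfolding nearest_def by blast
qed

section \<open>Transport by isometries, and the strands\<close>

definition isometry :: "('a::metric_space \<Rightarrow> 'b::metric_space) \<Rightarrow> bool" where
  "isometry F \<longleftrightarrow> (\<forall>x y. dist (F x) (F y) = dist x y) \<and> surj F"

lemma isometry_dist: "isometry F \<Longrightarrow> dist (F x) (F y) = dist x y" by (simp add: isometry_def)
lemma isometry_inj: "isometry F \<Longrightarrow> inj F" unfolding isometry_def inj_def by (metis dist_eq_0_iff)
lemma isometry_surj: "isometry F \<Longrightarrow> \<exists>x. F x = y" unfolding isometry_def by (metis surjD)
lemma isometry_comp: "isometry F \<Longrightarrow> isometry G \<Longrightarrow> isometry (F \<circ> G)" unfolding isometry_def by (metis comp_apply comp_surj)
lemma isometry_continuous: "isometry F \<Longrightarrow> continuous_on S F"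
  unfolding isometry_def continuous_on_iff by metis

lemma nearest_isometry: "isometry F \<Longrightarrow> nearest q X z \<Longrightarrow> nearest (F q) (F ` X) (F z)"
  unfolding nearest_def isometry_def by auto

text \<open>A competitor outside the ball is farther from \<open>q\<close> than \<open>z\<close> by
  the triangle inequality, so agreement inside the ball is enough.\<close>

lemma nearest_local:
  assumes "nearest q G z" "C \<inter> ball w r = G \<inter> ball w r" "dist w q + dist q z < r"
  shows "nearest q C z"
proof -
  have "dist w z < r" using assms(3) dist_triangle[of w z q] by simp
  then have "z \<in> C" using assms unfolding nearest_def by (metis IntD1 IntI mem_ball)
  moreover have "dist q z < dist q x" if x: "x \<in> C" "x \<noteq> z" for x
  proof (cases "dist w x < r")
    case True
    then have "x \<in> G" using x assms(2) by (metis IntD1 IntI mem_ball)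
    then show ?thesis using assms(1) x unfolding nearest_def by blast
  next
    case False
    then show ?thesis using assms(3) dist_triangle[of w x q] by simp
  qed
  ultimately show ?thesis unfolding nearest_def by blast
qed

lemma nearest_le: "nearest q X z \<Longrightarrow> x \<in> X \<Longrightarrow> dist q z \<le> dist q x"
  unfolding nearest_def by (cases "x = z") (auto simp: less_imp_le)

lemma isometry_cnj: "isometry cnj" unfolding isometry_def
  by (metis (no_types, lifting) complex_cnj_cnj complex_cnj_diff complex_mod_cnj dist_norm surjI)

lemma cnj_gadget: "cnj ` gadget = gadget"
proof -
  have "cnj x \<in> gadget" if "x \<in> gadget" for x using that unfolding gadget_cases
    by (elim bexE disjE; intro bexI; auto)
  then have "cnj ` gadget \<subseteq> gadget" "\<And>x. x \<in> gadget \<Longrightarrow> x \<in> cnj ` gadget" by (auto intro: image_eqI[of _ cnj "cnj x" for x])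
  then show ?thesis by blast
qed

section \<open>Regions free of the medial axis\<close>

lemma hchain_mem: "1 \<in> hchain" "gap_mid \<in> hchain" "g3 \<in> hchain" "sample_a \<in> hchain" "sample_b \<in> hchain" "sample_e \<in> hchain" "4 * u0 \<in> hchain"
proof -
  show "1 \<in> hchain" "sample_e \<in> hchain" "4 * u0 \<in> hchain" unfolding hchain_cases by auto
  have "arc2 angle_m \<in> hchain" unfolding hchain_cases using angle_a_range angle_m_range by (auto intro!: imageI)
  then show "gap_mid \<in> hchain" by (simp add: arc_values)
  have "arc3 turn3 \<in> hchain" unfolding hchain_cases using turn3_bounds pi_gt_zero by (auto intro!: imageI)
  then show "g3 \<in> hchain" by (simp add: arc_values)
  show "sample_a \<in> hchain" unfolding hchain_cases sample_a_def using angle_a_range by (auto intro!: imageI)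
  show "sample_b \<in> hchain" unfolding hchain_cases sample_b_def using angle_b_range by (auto intro!: imageI)
qed

lemma hchain_gadget: "y \<in> hchain \<Longrightarrow> y \<in> gadget" unfolding gadget_cases by blast

text \<open>Of the three balls only the one about 1 crosses the real axis; there conjugation, a
  symmetry of the gadget fixing 1, brings \<open>q\<close> back to the upper side.\<close>

lemma ball_free:
  assumes F: "isometry F" and C: "C \<inter> ball (F 0) 4 = F ` gadget \<inter> ball (F 0) 4"
    and mL: "(m, L) \<in> {(1, 0.705), (gap_mid, 0.535), (g3, 0.4)}"
  shows "ball (F m) L \<inter> medial_axis C = {}"
proof -
  have "q' \<notin> medial_axis C" if "q' \<in> ball (F m) L" for q'
  proof -
    obtain q where q': "q' = F q" using isometry_surj[OF F] by metis
    have dq: "dist m q < L" using that F by (simp add: q' isometry_dist)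
    \<comment> \<open>The nearest point of \<open>q\<close> is no farther from it than
      \<open>m\<close>, so the way from the gadget centre through \<open>q\<close> to that point is
      shorter than \<open>norm m + 2 * L\<close>. Within radius 4 the curve is just the
      gadget.\<close>
    have n: "norm m + 2 * L < 4"
    proof -
      have "norm gap_mid \<le> 1.62" "norm g3 \<le> 2.2"
        by (subst cmod_le_iff_square; simp add: gap_mid_def g3_def power2_eq_square)+
      then show ?thesis using mL by auto
    qed
    have mh: "m \<in> hchain" using mL hchain_mem by auto
    have "\<exists>z. nearest q gadget z"
    proof (cases "0 \<le> Im q")
      case True
      then show ?thesis using ball_good[OF mL dq] fold_nearest by metis
    next
      case False
      have "\<bar>Im q - Im m\<bar> < L" using Re_Im_ball[OF dq] by simp
      then have m1: "m = 1" using mL False by (auto simp: gap_mid_def g3_def)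
      have d: "dist m (cnj q) < L" using dq m1 isometry_dist[OF isometry_cnj, of 1 q] by simp
      have "0 \<le> Im (cnj q)" using False by simp
      then obtain z where "nearest (cnj q) gadget z" using ball_good[OF mL d] fold_nearest by metis
      then have "nearest (cnj (cnj q)) (cnj ` gadget) (cnj z)" by (rule nearest_isometry[OF isometry_cnj])
      then show ?thesis unfolding cnj_gadget by auto
    qed
    then obtain z where z: "nearest q gadget z" ..
    have "dist q z \<le> dist q m" using nearest_le[OF z hchain_gadget[OF mh]] .
    moreover have "norm q \<le> norm m + dist m q" by (metis dist_commute dist_norm norm_triangle_sub)
    ultimately have "dist (F 0) (F q) + dist (F q) (F z) < 4"
      using n dq F by (simp add: isometry_dist dist_commute)
    then have "nearest (F q) C (F z)" using nearest_local[OF nearest_isometry[OF F z] C] by simp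
    then show ?thesis using nearest_notin_medial q' by blast
  qed
  then show ?thesis by blast
qed

lemma gadget_norm: "x \<in> gadget \<Longrightarrow> 1 \<le> norm x" 
proof -
  assume "x \<in> gadget"
  then obtain y where y: "y \<in> hchain" "norm x = norm y" unfolding gadget_cases by (auto simp: norm_mult)
  then show ?thesis using hchain_wedge(6)[OF y(1)] complex_Re_le_cmod[of y] by simp
qed

text \<open>The gadget is centrally symmetric and avoids 0, so a nearest point of the centre comes
  with a second one opposite. Nonemptiness of the medial axis matters because \<open>infdist\<close>
  to the empty set is 0 by definition, which would void every lower bound on
  \<open>lfs\<close>.\<close>

lemma medial_center:
  assumes F: "isometry F" and C: "C \<inter> ball (F 0) 4 = F ` gadget \<inter> ball (F 0) 4"
  shows "F 0 \<in> medial_axis C"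
proof -
  have False if ex: "\<exists>!c. c \<in> C \<and> (\<forall>c'\<in>C. dist (F 0) c \<le> dist (F 0) c')"
  proof -
    obtain c where c: "c \<in> C" "\<forall>c'\<in>C. dist (F 0) c \<le> dist (F 0) c'"
      and uq: "\<And>d. d \<in> C \<Longrightarrow> \<forall>c'\<in>C. dist (F 0) d \<le> dist (F 0) c' \<Longrightarrow> d = c" using ex by metis
    have in_C: "F x \<in> C" if "x \<in> gadget" "norm x < 4" for x
    proof -
      have "F x \<in> F ` gadget \<inter> ball (F 0) 4" using that F by (simp add: isometry_dist)
      then show ?thesis using C by blast
    qed
    have "F 1 \<in> C" using in_C[of 1] hchain_gadget hchain_mem by simp
    then have "dist (F 0) c \<le> 1" using c F by (metis isometry_dist dist_0_norm norm_one)
    then have "c \<in> F ` gadget" using C c by (metis IntD1 IntI le_less_trans mem_ball one_less_numeral_iff semiring_norm(76))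
    then obtain x where x: "x \<in> gadget" "c = F x" by auto
    have nx: "norm x \<le> 1" using \<open>dist (F 0) c \<le> 1\<close> x F by (simp add: isometry_dist)
    have "- x \<in> gadget" using x(1) unfolding gadget_cases by (elim bexE disjE; intro bexI; auto)
    then have "F (- x) \<in> C" using in_C nx by simp
    moreover have "dist (F 0) (F (- x)) = dist (F 0) c" using x F by (simp add: isometry_dist)
    ultimately have "F (- x) = F x" using uq c x by metis
    then have "- x = x" using isometry_inj[OF F] by (simp add: inj_eq)
    then have "x = 0" by (simp add: complex_eq_iff)
    then show False using gadget_norm[OF x(1)] by simp
  qed
  then show ?thesis unfolding medial_axis_def by blast
qed

lemma infdist_ball_free:
  assumes "ball m L \<inter> M = {}" "M \<noteq> {}"
  shows "L - dist x m \<le> infdist x M"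
proof -
  have "L - dist x m \<le> dist x a" if "a \<in> M" for a
  proof -
    have "L \<le> dist m a" using that assms(1) by (metis disjoint_iff mem_ball not_less)
    then show ?thesis using dist_triangle[of m a x] by (simp add: dist_commute)
  qed
  then show ?thesis unfolding infdist_notempty[OF assms(2)] by (intro cINF_greatest[OF assms(2)])
qed

lemma gap_eps:
  assumes F: "isometry F" and C: "C \<inter> ball (F 0) 4 = F ` gadget \<inter> ball (F 0) 4"
    and y: "y \<in> hchain" "y \<notin> closed_segment sample_e (4 * u0)"
  shows "\<exists>s\<in>{sample_a, sample_b, sample_e}. dist (F y) (F s) < 0.72 * lfs C (F y)"
proof -
  obtain s m L where s: "s \<in> {sample_a, sample_b, sample_e}" and mL: "(m, L) \<in> {(1, 0.705), (gap_mid, 0.535), (g3, 0.4)}"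
    and d: "dist y s + 0.72 * dist y m < 0.72 * L" using gap_bound[OF y(1)] y(2) by blast
  have "L - dist (F y) (F m) \<le> lfs C (F y)" unfolding lfs_def
    using medial_center[OF F C] by (intro infdist_ball_free ball_free[OF F C mL]) auto
  then show ?thesis using s d F by (intro bexI[of _ s]) (auto simp: isometry_dist)
qed

text \<open>On the ray only positivity of the local feature size is wanted, so an open neighbourhood
  \<open>W\<close> replaces a ball of given size. Its conditions settle the three alternatives of
  \<open>hchain_nearest\<close> and keep \<open>q\<close> inside the wedge.\<close>

lemma ray_free:
  assumes F: "isometry F" and C: "C \<inter> ball (F 0) 4 = F ` gadget \<inter> ball (F 0) 4"
    and y: "y \<in> closed_segment sample_e (4 * u0)" "norm y < 4"
  shows "\<exists>\<epsilon>>0. ball (F y) \<epsilon> \<inter> medial_axis C = {}"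
proof -
  obtain t where t: "radius_e \<le> t" "t \<le> 4" "y = of_real t * u0" using y unfolding ray_param by blast
  have yh: "y \<in> hchain" using y unfolding hchain_cases by blast
  define W where "W = {q. 0.04 < Im q \<and> Im q < Re q \<and> 1.705 < Re q \<and> inner (g3 - q) (cis turn3) < 0}"
  have "open W" unfolding W_def
    by (intro open_Collect_conj open_Collect_less continuous_intros)
  moreover have "y \<in> W"
  proof -
    have t2: "t > 2.184" using t radius_e_gt by simp
    have "2.184 * 0.92387 \<le> t * cos8" using t2 cos8_bounds by (intro mult_mono) auto
    moreover have "0.41421 * (2.184 * 0.92387) \<le> tan8 * (t * cos8)" 
      by (rule mult_mono) (use calculation tan8_bounds in auto)
    moreover have "inner (g3 - y) (cis turn3) < 0"
    proof -
      have "g3 - y = - (of_real R4 * \<i> * (u0 - cis turn3)) - of_real (t - radius_e) * u0"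
        unfolding t(3) using sample_e_eq by (simp add: sample_e_def o4_def algebra_simps)
      moreover have "inner (\<i> * (u0 - cis turn3)) (cis turn3) = sin turn4" "inner u0 (cis turn3) = cos turn4"
        by (simp_all add: inner_complex_def turn4_def sin_diff cos_diff cos8_def sin8_def algebra_simps)
      ultimately have "inner (g3 - y) (cis turn3) = - (R4 * sin turn4) - (t - radius_e) * cos turn4"
        by (simp add: inner_diff_left mult.assoc scaleR_conv_of_real[symmetric] del: of_real_diff)
      moreover have "R4 * sin turn4 > 0" "(t - radius_e) * cos turn4 \<ge> 0" using R4_gt sin_turn4_pos t turn4_bounds cos_ge_zero[of turn4] by auto
      ultimately show ?thesis by simp
    qed
    ultimately show ?thesis using hchain_wedge(2)[OF yh] t t2 unfolding W_def by (simp add: sin8_eq algebra_simps)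
  qed
  ultimately obtain e1 where e1: "e1 > 0" "ball y e1 \<subseteq> W" by (meson open_contains_ball)
  define \<epsilon> where "\<epsilon> = min e1 ((4 - norm y) / 2)"
  have "\<epsilon> > 0" using e1 y by (simp add: \<epsilon>_def)
  moreover have "q' \<notin> medial_axis C" if "q' \<in> ball (F y) \<epsilon>" for q'
  proof -
    obtain q where q': "q' = F q" using isometry_surj[OF F] by metis
    have dq: "dist y q < \<epsilon>" using that F by (simp add: q' isometry_dist)
    then have "q \<in> W" using e1 by (auto simp: \<epsilon>_def)
    then have w: "0.04 < Im q" "Im q < Re q" "1.705 < Re q" "inner (g3 - q) (cis turn3) < 0" by (auto simp: W_def)
    then obtain z where "nearest q hchain z" using hchain_nearest[of q] by auto
    then have z: "nearest q gadget z" using w by (intro fold_nearest) auto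
    have "dist q z \<le> dist q y" using nearest_le[OF z hchain_gadget[OF yh]] .
    moreover have "norm q \<le> norm y + dist y q" by (metis dist_commute dist_norm norm_triangle_sub)
    ultimately have "dist (F 0) (F q) + dist (F q) (F z) < 4"
      using dq F unfolding \<epsilon>_def by (simp add: isometry_dist dist_commute)
    then have "nearest (F q) C (F z)" using nearest_local[OF nearest_isometry[OF F z] C] by simp
    then show ?thesis using nearest_notin_medial q' by blast
  qed
  ultimately show ?thesis by blast
qed

section \<open>Interior points and joints of smooth pieces\<close>

lemma smooth_piece_near:
  assumes "smooth_piece X A S B T" "p \<in> X" "p \<noteq> A" "p \<noteq> B"
  shows "\<exists>\<epsilon>>0. \<forall>q\<in>ball p \<epsilon>. \<exists>w. nearest q X w"
proof -
  define W where "W = {q. inner (A - q) S < 0 \<and> 0 < inner (B - q) T}"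
  have "open W" unfolding W_def by (intro open_Collect_conj open_Collect_less continuous_intros)
  moreover have "p \<in> W" using assms unfolding W_def smooth_piece_def by blast
  ultimately obtain e where "e > 0" "ball p e \<subseteq> W" by (meson open_contains_ball)
  moreover have "\<exists>w. nearest q X w" if "q \<in> W" for q using that assms(1) unfolding W_def smooth_piece_def by blast
  ultimately show ?thesis by blast
qed

text \<open>A negative sign at the outer start and a positive one at the outer end exclude the bad
  pattern on both pieces, whatever the sign at the joint. This is an open condition, and
  \<open>B\<close> itself satisfies it.\<close>

lemma two_smooth_piece_near:
  assumes X: "smooth_piece X A S B T" and Y: "smooth_piece Y B T D U" and "A \<noteq> B" "B \<noteq> D"
  shows "\<exists>\<epsilon>>0. \<forall>q\<in>ball B \<epsilon>. \<exists>w. nearest q (X \<union> Y) w"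
proof -
  define W where "W = {q. inner (A - q) S < 0 \<and> 0 < inner (D - q) U}"
  have "open W" unfolding W_def by (intro open_Collect_conj open_Collect_less continuous_intros)
  moreover have "B \<in> X" "B \<in> Y" using X Y by (simp_all add: smooth_piece_def)
  then have "inner (A - B) S < 0" "0 < inner (D - B) U" using X Y assms(3,4) unfolding smooth_piece_def by metis+
  then have "B \<in> W" by (simp add: W_def)
  ultimately obtain e where e: "e > 0" "ball B e \<subseteq> W" by (meson open_contains_ball)
  have "\<exists>w. nearest q (X \<union> Y) w" if q: "q \<in> W" for q
  proof -
    have U: "(\<Union>i<2::nat. (if i = 0 then X else Y)) = X \<union> Y" by (auto simp: less_2_cases_iff)
    have "\<exists>w. nearest q (\<Union>i<2::nat. (if i = 0 then X else Y)) w"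
    proof (rule chain_nearest(1)[of 2 "\<lambda>i. if i = 0 then X else Y" "\<lambda>i. [A, B, D] ! i" "\<lambda>i. [S, T, U] ! i"])
      fix i :: nat assume "i < 2"
      then have i: "i = 0 \<or> i = 1" by auto
      show "smooth_piece (if i = 0 then X else Y) ([A, B, D] ! i) ([S, T, U] ! i) ([A, B, D] ! Suc i) ([S, T, U] ! Suc i)"
        using i X Y by (elim disjE) simp_all
      show "\<not> (0 \<le> inner ([A, B, D] ! i - q) ([S, T, U] ! i) \<and> inner ([A, B, D] ! Suc i - q) ([S, T, U] ! Suc i) \<le> 0)"
        using i q by (elim disjE) (simp_all add: W_def)
    qed simp
    then show ?thesis unfolding U .
  qed
  then show ?thesis using e by blast
qed

text \<open>The closed rest \<open>E'\<close> keeps a positive distance from \<open>z\<close>, so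
  for points close to \<open>z\<close> only \<open>E\<close> competes.\<close>

lemma local_split:
  assumes F: "isometry F" and C: "C = E \<union> E'" "closed E'" "z \<notin> E'" "z \<in> E"
    and u: "\<exists>\<epsilon>>0. \<forall>q\<in>ball z \<epsilon>. \<exists>w. nearest q E w"
  shows "\<exists>\<epsilon>>0. ball (F z) \<epsilon> \<inter> medial_axis (F ` C) = {}"
proof -
  obtain e where e: "e > 0" "\<forall>q\<in>ball z e. \<exists>w. nearest q E w" using u by blast
  obtain d where d: "d > 0" "ball z d \<subseteq> - E'" using C(2,3) by (metis ComplI open_Compl open_contains_ball)
  define \<epsilon> where "\<epsilon> = min e (d / 2)"
  have "q' \<notin> medial_axis (F ` C)" if "q' \<in> ball (F z) \<epsilon>" for q'
  proof -
    obtain q where q': "q' = F q" using isometry_surj[OF F] by metis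
    have dq: "dist z q < \<epsilon>" using that F by (simp add: q' isometry_dist)
    then have "q \<in> ball z e" by (simp add: \<epsilon>_def)
    then obtain w where w: "nearest q E w" using e by blast
    have "dist q w \<le> dist q z" using nearest_le[OF w C(4)] .
    moreover have "C \<inter> ball z d = E \<inter> ball z d" using C d by blast
    ultimately have "nearest q C w" using nearest_local[OF w, of C z d] dq by (simp add: \<epsilon>_def dist_commute)
    then show ?thesis using nearest_notin_medial nearest_isometry[OF F] q' by blast
  qed
  moreover have "\<epsilon> > 0" using e d by (simp add: \<epsilon>_def)
  ultimately show ?thesis by blast
qed

text \<open>
  The circle with centre \<open>Complex 5 (strand_height \<theta>)\<close> and radius \<open>strand_radius \<theta>\<close> is orthogonal to the circle of radius 4 about 0 and to the
  line \<open>Re z = 5\<close>. These circles form a pencil, so that different strands are disjoint.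
\<close>

definition strand_height :: "real \<Rightarrow> real" where "strand_height \<theta> = (4 - 5 * cos \<theta>) / sin \<theta>"
definition strand_radius :: "real \<Rightarrow> real" where "strand_radius \<theta> = (5 - 4 * cos \<theta>) / sin \<theta>"
text \<open>The parameter is measured from the topmost point of the circle: \<open>\<theta>\<close>
  gives the end at distance 4 from 0 and \<open>- \<theta>\<close> its mirror image.\<close>

definition strand_point :: "real \<Rightarrow> real \<Rightarrow> complex" where "strand_point \<theta> \<alpha> = Complex 5 (strand_height \<theta>) + of_real (strand_radius \<theta>) * \<i> * cis \<alpha>"
definition strand :: "real \<Rightarrow> complex set" where "strand \<theta> = strand_point \<theta> ` {-\<theta>..\<theta>}"
definition mirror :: "complex \<Rightarrow> complex" where "mirror z = 10 - cnj z"

lemma isometry_mirror: "isometry mirror"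
proof -
  have "mirror (mirror x) = x" for x by (simp add: mirror_def)
  moreover have "dist (mirror x) (mirror y) = dist x y" for x y
    using isometry_dist[OF isometry_cnj, of x y] by (simp add: mirror_def dist_norm norm_minus_commute)
  ultimately show ?thesis unfolding isometry_def by (metis surjI)
qed

lemma strand_point_parts: "Re (strand_point \<theta> \<alpha>) = 5 - strand_radius \<theta> * sin \<alpha>" "Im (strand_point \<theta> \<alpha>) = strand_height \<theta> + strand_radius \<theta> * cos \<alpha>"
  by (simp_all add: strand_point_def)

lemma sum_squares_expand:
  "(5 - r * s)\<^sup>2 + (y + r * c)\<^sup>2 = 25 + y\<^sup>2 + r\<^sup>2 * (s\<^sup>2 + c\<^sup>2) - 2 * r * (5 * s - y * c)" for r s y c :: real
  by (simp add: power2_eq_square algebra_simps)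

lemma mirror_strand_point: "mirror (strand_point \<theta> \<alpha>) = strand_point \<theta> (- \<alpha>)"
  by (simp add: complex_eq_iff mirror_def strand_point_parts)

context
  fixes \<theta> :: real
  assumes range: "0 < \<theta>" "\<theta> < pi"
begin

lemma sin_ang: "sin \<theta> > 0" using range by (intro sin_gt_zero) auto
lemma strand_radius_pos: "strand_radius \<theta> > 0" 
proof -
  have "5 - 4 * cos \<theta> > 0" using cos_le_one[of \<theta>] by linarith
  then show ?thesis unfolding strand_radius_def using sin_ang by simp
qed
lemma strand_point_start: "strand_point \<theta> \<theta> = 4 * cis \<theta>"
proof -
  have "strand_height \<theta> + strand_radius \<theta> * cos \<theta> = 4 * sin \<theta>"
  proof -
    have "strand_height \<theta> + strand_radius \<theta> * cos \<theta> = 4 * (1 - (cos \<theta>)\<^sup>2) / sin \<theta>"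
      by (simp add: strand_height_def strand_radius_def power2_eq_square add_divide_distrib[symmetric] algebra_simps)
    also have "1 - (cos \<theta>)\<^sup>2 = sin \<theta> * sin \<theta>" by (metis power2_eq_square sin_squared_eq)
    finally show ?thesis using sin_ang by simp
  qed
  then show ?thesis using sin_ang by (simp add: complex_eq_iff strand_point_parts strand_radius_def)
qed

lemma cos_le_abs: "\<bar>\<alpha>\<bar> \<le> \<theta> \<Longrightarrow> cos \<theta> \<le> cos \<alpha>"
  using cos_monotone_0_pi_le[of "\<bar>\<alpha>\<bar>" \<theta>] range by simp

lemma strand_point_Im_pos: assumes "\<bar>\<alpha>\<bar> \<le> \<theta>" shows "0 < Im (strand_point \<theta> \<alpha>)"
proof -
  have "strand_radius \<theta> * cos \<theta> \<le> strand_radius \<theta> * cos \<alpha>" using cos_le_abs[OF assms] strand_radius_pos by simp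
  moreover have "strand_height \<theta> + strand_radius \<theta> * cos \<theta> = 4 * sin \<theta>" using strand_point_start strand_point_parts(2)[of \<theta> \<theta>] by simp
  ultimately show ?thesis using sin_ang by (simp add: strand_point_parts)
qed

lemma strand_radius_sq: "(strand_radius \<theta>)\<^sup>2 = (strand_height \<theta>)\<^sup>2 + 9"
proof -
  have "(5 - 4 * cos \<theta>)\<^sup>2 = (4 - 5 * cos \<theta>)\<^sup>2 + 9 * (1 - (cos \<theta>)\<^sup>2)" by (simp add: power2_eq_square algebra_simps)
  also have "1 - (cos \<theta>)\<^sup>2 = (sin \<theta>)\<^sup>2" by (simp add: sin_squared_eq)
  finally show ?thesis using sin_ang by (simp add: strand_radius_def strand_height_def power_divide field_simps)
qed

lemma strand_point_norm: assumes "\<bar>\<alpha>\<bar> \<le> \<theta>" shows "4 \<le> norm (strand_point \<theta> \<alpha>)" "norm (strand_point \<theta> \<alpha>) = 4 \<Longrightarrow> \<alpha> = \<theta>"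
proof -
  \<comment> \<open>Up to a positive factor this is the excess of the squared norm over 16, written
    as two terms that are nonnegative in the given range; the first vanishes only for
    \<open>\<alpha> = \<theta>\<close>.\<close>
  define k where "k = 5 * (1 - cos (\<theta> - \<alpha>)) + 4 * (cos \<alpha> - cos \<theta>)"
  have "(norm (strand_point \<theta> \<alpha>))\<^sup>2 = 25 + (strand_height \<theta>)\<^sup>2 + (strand_radius \<theta>)\<^sup>2 * ((sin \<alpha>)\<^sup>2 + (cos \<alpha>)\<^sup>2) - 2 * strand_radius \<theta> * (5 * sin \<alpha> - strand_height \<theta> * cos \<alpha>)"
    unfolding cmod_power2 strand_point_parts by (rule sum_squares_expand)
  also have "\<dots> = 16 + 2 * strand_radius \<theta> * (strand_radius \<theta> - 5 * sin \<alpha> + strand_height \<theta> * cos \<alpha>)"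
  proof -
    have "25 + (strand_height \<theta>)\<^sup>2 + (strand_radius \<theta>)\<^sup>2 = 16 + 2 * strand_radius \<theta> * strand_radius \<theta>" using strand_radius_sq by (simp add: power2_eq_square)
    then show ?thesis by (simp add: algebra_simps)
  qed
  also have "strand_radius \<theta> - 5 * sin \<alpha> + strand_height \<theta> * cos \<alpha> = k / sin \<theta>"
    unfolding k_def strand_radius_def strand_height_def cos_diff using sin_ang by (simp add: field_simps)
  finally have e: "(norm (strand_point \<theta> \<alpha>))\<^sup>2 = 16 + 2 * strand_radius \<theta> * (k / sin \<theta>)" .
  have k0: "k \<ge> 0" unfolding k_def using cos_le_abs[OF assms] by simp
  then have "4\<^sup>2 \<le> (norm (strand_point \<theta> \<alpha>))\<^sup>2" unfolding e using strand_radius_pos sin_ang by simp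
  then show "4 \<le> norm (strand_point \<theta> \<alpha>)" by (rule power2_le_imp_le) simp
  assume "norm (strand_point \<theta> \<alpha>) = 4"
  then have "k = 0" using e strand_radius_pos sin_ang by simp
  then have "1 \<le> cos (\<theta> - \<alpha>)" unfolding k_def using cos_le_abs[OF assms] by simp
  then have "cos (\<theta> - \<alpha>) = 1" using cos_le_one[of "\<theta> - \<alpha>"] by simp
  moreover have "0 \<le> \<theta> - \<alpha>" "\<theta> - \<alpha> < 2 * pi" using assms range by auto
  moreover obtain n :: int where n: "\<theta> - \<alpha> = of_int n * 2 * pi" using \<open>cos (\<theta> - \<alpha>) = 1\<close> cos_one_2pi_int by blast
  ultimately have "0 \<le> real_of_int n" "real_of_int n < 1" using pi_gt_zero by (auto simp: zero_le_mult_iff)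
  then have "n = 0" by linarith
  then show "\<alpha> = \<theta>" using n by simp
qed

lemma strand_point_inj: assumes "\<bar>\<alpha>\<bar> \<le> \<theta>" "\<bar>\<beta>\<bar> \<le> \<theta>" "strand_point \<theta> \<alpha> = strand_point \<theta> \<beta>" shows "\<alpha> = \<beta>"
proof -
  have "cis \<alpha> = cis \<beta>" using assms(3) strand_radius_pos by (simp add: strand_point_def)
  then have "sin \<alpha> = sin \<beta> \<and> cos \<alpha> = cos \<beta>" by (simp add: complex_eq_iff)
  then obtain n :: int where n: "\<alpha> = \<beta> + 2 * pi * n" using sin_cos_eq_iff by metis
  have "\<bar>2 * pi * n\<bar> < 2 * pi" using assms range n by linarith
  then have "\<bar>real_of_int n\<bar> < 1" by (simp add: abs_mult)
  then show ?thesis using n by simp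
qed

text \<open>This is the equation of the pencil: the right side depends on the point alone, so a
  point off the real axis determines \<open>strand_height\<close>. Disjointness of strands follows
  from it.\<close>

lemma strand_point_circle: "2 * Im (strand_point \<theta> \<alpha>) * strand_height \<theta> = (norm (strand_point \<theta> \<alpha>))\<^sup>2 - 10 * Re (strand_point \<theta> \<alpha>) + 16"
proof -
  have "(norm (strand_point \<theta> \<alpha>))\<^sup>2 = 25 + (strand_height \<theta>)\<^sup>2 + (strand_radius \<theta>)\<^sup>2 * ((sin \<alpha>)\<^sup>2 + (cos \<alpha>)\<^sup>2) - 2 * strand_radius \<theta> * (5 * sin \<alpha> - strand_height \<theta> * cos \<alpha>)"
    unfolding cmod_power2 strand_point_parts by (rule sum_squares_expand)
  then show ?thesis using strand_radius_sq unfolding strand_point_parts by (simp add: power2_eq_square algebra_simps)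
qed

text \<open>A whole strand subtends \<open>2 * \<theta>\<close>, which may exceed \<open>pi\<close>;
  cut at its top, each half is short enough for \<open>smooth_piece_arc\<close>, and both halves
  have tangent 1 at the cut.\<close>

lemma left_smooth_piece: "smooth_piece (strand_point \<theta> ` {0..\<theta>}) (4 * cis \<theta>) (cis \<theta>) (strand_point \<theta> 0) 1"
proof -
  define v where "v = of_real (strand_radius \<theta>) * \<i> * cis \<theta>"
  have s: "sgn v = \<i> * cis \<theta>" unfolding v_def sgn_mult sgn_of_real using strand_radius_pos by (simp add: sgn_eq)
  have e: "Complex 5 (strand_height \<theta>) + v = 4 * cis \<theta>" using strand_point_start by (simp add: strand_point_def v_def)
  have e2: "Complex 5 (strand_height \<theta>) + v * cis (-1 * \<theta>) = strand_point \<theta> 0" by (simp add: strand_point_def v_def mult.assoc cis_mult)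
  have "circle_arc (Complex 5 (strand_height \<theta>)) v (-1) \<theta> = strand_point \<theta> ` ((\<lambda>\<phi>. \<theta> - \<phi>) ` {0..\<theta>})"
    unfolding circle_arc_def image_image by (intro image_cong refl) (simp add: strand_point_def v_def mult.assoc cis_mult)
  also have "(\<lambda>\<phi>. \<theta> - \<phi>) ` {0..\<theta>} = {0..\<theta>}" using image_diff_atLeastAtMost[of \<theta> 0 \<theta>] by simp
  finally have X: "circle_arc (Complex 5 (strand_height \<theta>)) v (-1) \<theta> = strand_point \<theta> ` {0..\<theta>}" .
  have t: "of_real (-1) * \<i> * (\<i> * cis \<theta>) = cis \<theta>" "cis \<theta> * cis (-1 * \<theta>) = 1"
    by (simp_all add: mult.assoc[symmetric] cis_mult)
  have "smooth_piece (circle_arc (Complex 5 (strand_height \<theta>)) v (-1) \<theta>) (Complex 5 (strand_height \<theta>) + v) (of_real (-1) * \<i> * sgn v) (Complex 5 (strand_height \<theta>) + v * cis (-1 * \<theta>)) (of_real (-1) * \<i> * sgn v * cis (-1 * \<theta>))"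
    using range strand_radius_pos by (intro smooth_piece_arc) (auto simp: v_def)
  then show ?thesis unfolding X e e2 s t .
qed

lemma right_smooth_piece: "\<exists>B T. smooth_piece (strand_point \<theta> ` {-\<theta>..0}) (strand_point \<theta> 0) 1 B T \<and> B = strand_point \<theta> (-\<theta>)"
proof -
  define v where "v = of_real (strand_radius \<theta>) * \<i>"
  have s: "sgn v = \<i>" unfolding v_def sgn_mult sgn_of_real using strand_radius_pos by (simp add: sgn_eq)
  have e: "Complex 5 (strand_height \<theta>) + v = strand_point \<theta> 0" by (simp add: strand_point_def v_def)
  have e2: "Complex 5 (strand_height \<theta>) + v * cis (-1 * \<theta>) = strand_point \<theta> (-\<theta>)" by (simp add: strand_point_def v_def)
  have "circle_arc (Complex 5 (strand_height \<theta>)) v (-1) \<theta> = strand_point \<theta> ` (uminus ` {0..\<theta>})"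
    unfolding circle_arc_def image_image by (intro image_cong refl) (simp add: strand_point_def v_def)
  then have X: "circle_arc (Complex 5 (strand_height \<theta>)) v (-1) \<theta> = strand_point \<theta> ` {-\<theta>..0}" by simp
  have t: "of_real (-1) * \<i> * \<i> = (1::complex)" by simp
  have "smooth_piece (circle_arc (Complex 5 (strand_height \<theta>)) v (-1) \<theta>) (Complex 5 (strand_height \<theta>) + v) (of_real (-1) * \<i> * sgn v) (Complex 5 (strand_height \<theta>) + v * cis (-1 * \<theta>)) (of_real (-1) * \<i> * sgn v * cis (-1 * \<theta>))"
    using range strand_radius_pos by (intro smooth_piece_arc) (auto simp: v_def)
  then show ?thesis unfolding X e e2 s t by blast
qed

end

text \<open>In terms of the half sum \<open>m\<close> and half difference \<open>d\<close> of the
  angles, equal heights force \<open>4 * cos m = 5 * cos d\<close>. This is impossible since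
  \<open>cos m \<le> cos d\<close> and \<open>cos d > 0\<close>.\<close>

lemma strand_height_inj:
  assumes a: "0 < \<theta>" "\<theta> < pi" "0 < \<eta>" "\<eta> < pi" and e: "strand_height \<theta> = strand_height \<eta>"
  shows "\<theta> = \<eta>"
proof (rule ccontr)
  assume ne: "\<theta> \<noteq> \<eta>"
  have s: "sin \<theta> > 0" "sin \<eta> > 0" using a by (auto intro: sin_gt_zero)
  define d m where "d = (\<eta> - \<theta>) / 2" and "m = (\<eta> + \<theta>) / 2"
  have md: "\<eta> = m + d" "\<theta> = m - d" by (simp_all add: d_def m_def field_simps)
  have "4 * (sin \<eta> - sin \<theta>) = 5 * sin (\<eta> - \<theta>)"
    using e s unfolding strand_height_def by (simp add: sin_diff field_simps)
  moreover have "sin \<eta> - sin \<theta> = 2 * cos m * sin d" unfolding md by (simp add: sin_add sin_diff)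
  moreover have "\<eta> - \<theta> = 2 * d" by (simp add: d_def)
  ultimately have "4 * (2 * cos m * sin d) = 5 * (2 * sin d * cos d)" by (simp only: sin_double)
  then have "8 * cos m * sin d = 10 * sin d * cos d" by simp
  moreover have "\<bar>d\<bar> < pi / 2" "d \<noteq> 0" using a ne by (auto simp: d_def)
  then have "- pi < d" "d < pi" "- (pi / 2) < d" "d < pi / 2" using pi_gt_zero by linarith+
  then have "sin d \<noteq> 0" "cos d > 0"
    using sin_eq_0_pi[of d] \<open>d \<noteq> 0\<close> cos_gt_zero_pi by blast+
  ultimately have c: "4 * cos m = 5 * cos d" by simp
  have "cos m \<le> cos d"
  proof -
    have "\<bar>d\<bar> \<le> m" "m \<le> pi" using a by (auto simp: d_def m_def)
    then show ?thesis using cos_monotone_0_pi_le[of "\<bar>d\<bar>" m] by simp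
  qed
  then show False using c \<open>cos d > 0\<close> by simp
qed

lemma strand_disjoint:
  assumes "0 < \<theta>" "\<theta> < pi" "0 < \<eta>" "\<eta> < pi" "\<theta> \<noteq> \<eta>"
  shows "strand \<theta> \<inter> strand \<eta> = {}"
proof (rule ccontr)
  assume "strand \<theta> \<inter> strand \<eta> \<noteq> {}"
  then obtain \<alpha> \<beta> where "\<alpha> \<in> {-\<theta>..\<theta>}" "\<beta> \<in> {-\<eta>..\<eta>}" "strand_point \<theta> \<alpha> = strand_point \<eta> \<beta>" unfolding strand_def by blast
  then have ab: "\<bar>\<alpha>\<bar> \<le> \<theta>" "\<bar>\<beta>\<bar> \<le> \<eta>" "strand_point \<theta> \<alpha> = strand_point \<eta> \<beta>" by auto
  have "2 * Im (strand_point \<theta> \<alpha>) * strand_height \<theta> = 2 * Im (strand_point \<theta> \<alpha>) * strand_height \<eta>"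
    using strand_point_circle[of \<theta> \<alpha>] strand_point_circle[of \<eta> \<beta>] assms ab(3) by simp
  then have "strand_height \<theta> = strand_height \<eta>" using strand_point_Im_pos[of \<theta> \<alpha>] assms ab(1) by simp
  then show False using strand_height_inj assms by blast
qed

section \<open>The glued curves\<close>

text \<open>
  \<open>pocket_at t\<close> joins the ports \<open>t - 1\<close> and \<open>t\<close> (mod 8) of the gadget at 0. In \<open>curve par par'\<close> the gadget at 0 uses the
  pockets \<open>t\<close> of parity \<open>par\<close>, and its mirror image about \<open>Re z = 5\<close> those of parity \<open>par'\<close>.
\<close>

definition ang :: "nat \<Rightarrow> real" where "ang j = real (2 * j + 1) * pi / 8"
definition port :: "nat \<Rightarrow> complex" where "port j = 4 * cis (ang j)"
definition ray :: "nat \<Rightarrow> complex set" where "ray j = closed_segment (of_real radius_e * cis (ang j)) (4 * cis (ang j))"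
text \<open>The half chain without its ray: the rays are common to both resolutions, the cores are
  what a change of parity replaces.\<close>

definition chain_core :: "complex set" where "chain_core = closed_segment 1 g1 \<union> arc2 ` {0..pi / 2} \<union> arc3 ` {0..turn3} \<union> arc4 ` {0..turn4}"
definition pocket_core :: "nat \<Rightarrow> complex set" where "pocket_core t = rot t ` (chain_core \<union> cnj ` chain_core)"
definition pocket_at :: "nat \<Rightarrow> complex set" where "pocket_at t = rot t ` pocket"
text \<open>The pencil is parametrised by angles between 0 and \<open>pi\<close>; ports 4 to 7 lie
  in the lower half plane and get conjugate strands.\<close>

definition strand_at :: "nat \<Rightarrow> complex set" where "strand_at j = (if j < 4 then strand (ang j) else cnj ` strand (ang (7 - j)))"
definition parity :: "nat \<Rightarrow> nat set" where "parity par = {t. t < 8 \<and> t mod 2 = par}"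
definition curve :: "nat \<Rightarrow> nat \<Rightarrow> complex set" where
  "curve par par' = (\<Union>t\<in>parity par. pocket_at t) \<union> (\<Union>j<8. strand_at j) \<union> mirror ` (\<Union>t\<in>parity par'. pocket_at t)"

lemma parity_eq: "parity 0 = {0, 2, 4, 6}" "parity 1 = {1, 3, 5, 7}"
proof -
  have "{t::nat. t < 8} = {0, 1, 2, 3, 4, 5, 6, 7}" by auto
  then have "parity p = {t \<in> {0, 1, 2, 3, 4, 5, 6, 7}. t mod 2 = p}" for p unfolding parity_def by blast
  then show "parity 0 = {0, 2, 4, 6}" "parity 1 = {1, 3, 5, 7}" by auto
qed

lemma less8: "(\<forall>j<8::nat. P j) \<longleftrightarrow> P 0 \<and> P 1 \<and> P 2 \<and> P 3 \<and> P 4 \<and> P 5 \<and> P 6 \<and> P 7"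
proof -
  have "{..<8::nat} = {0, 1, 2, 3, 4, 5, 6, 7}" by auto
  then have "(\<forall>j\<in>{..<8::nat}. P j) \<longleftrightarrow> (\<forall>j\<in>{0, 1, 2, 3, 4, 5, 6, 7}. P j)" by (simp only:)
  moreover have "(\<forall>j<8::nat. P j) \<longleftrightarrow> (\<forall>j\<in>{..<8::nat}. P j)" by auto
  ultimately show ?thesis by simp
qed

lemma ang_range: "j < 4 \<Longrightarrow> 0 < ang j" "j < 4 \<Longrightarrow> ang j < pi"
proof -
  show "0 < ang j" unfolding ang_def by simp
  assume "j < 4"
  then have "real (2 * j + 1) \<le> 7" by simp
  then have "real (2 * j + 1) * pi \<le> 7 * pi" by (intro mult_right_mono) auto
  then show "ang j < pi" unfolding ang_def using pi_gt_zero by simp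
qed

lemma cis_2pi_add: "cis (x + 2 * pi) = cis x" by (simp add: complex_eq_iff)

lemma cis_ang_cnj: "j < 8 \<Longrightarrow> cnj (cis (ang (7 - j))) = cis (ang j)"
proof -
  assume "j < 8"
  then have "ang j = - ang (7 - j) + 2 * pi" by (simp add: ang_def of_nat_diff field_simps)
  then show ?thesis by (simp only: cis_2pi_add cis_cnj)
qed

lemma cis_ang_inj: "i < 8 \<Longrightarrow> j < 8 \<Longrightarrow> cis (ang i) = cis (ang j) \<Longrightarrow> i = j"
proof -
  assume ij: "i < 8" "j < 8" and e: "cis (ang i) = cis (ang j)"
  then have "sin (ang i) = sin (ang j) \<and> cos (ang i) = cos (ang j)" by (simp add: complex_eq_iff)
  then obtain n :: int where n: "ang i = ang j + 2 * pi * n" using sin_cos_eq_iff by metis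
  then have "pi * (real i - real j) = pi * (8 * real_of_int n)" unfolding ang_def by (simp add: field_simps)
  then have "real i - real j = 8 * real_of_int n" by simp
  moreover have "\<bar>real i - real j\<bar> < 8" using ij by auto
  ultimately have "\<bar>real_of_int n\<bar> < 1" by simp
  then have "n = 0" by simp
  then show "i = j" using \<open>real i - real j = 8 * real_of_int n\<close> by simp
qed

lemma rot_u0: "rot t u0 = cis (ang t)" 
  by (simp add: rot_def u0_def cis_mult ang_def field_simps)
text \<open>On natural numbers \<open>(t + 7) mod 8\<close> is the predecessor of \<open>t\<close>
  around the octagon; its strand line is the second edge of the sector of pocket
  \<open>t\<close>.\<close>

lemma rot_cnj_u0: "t < 8 \<Longrightarrow> rot t (cnj u0) = cis (ang ((t + 7) mod 8))"
proof (cases "t = 0")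
  case True
  have "cis (ang 7) = cis (- (pi / 8) + 2 * pi)" by (simp add: ang_def field_simps)
  also have "\<dots> = cis (- (pi / 8))" by (rule cis_2pi_add)
  finally show ?thesis using True by (simp add: rot_def u0_def cis_cnj)
next
  case False
  assume "t < 8"
  then have m: "(t + 7) mod 8 = t - 1" using False by (simp add: mod_if)
  have "ang (t - 1) = real t * pi / 4 - pi / 8" using False by (simp add: ang_def of_nat_diff field_simps)
  then show ?thesis unfolding m by (simp add: rot_def u0_def cis_cnj cis_mult)
qed

lemma rot_linear: "linear (rot t)" unfolding rot_def
  by (intro linearI) (simp_all add: algebra_simps)
lemma cnj_linear: "linear cnj" by (intro linearI) (simp_all)

lemma isometry_rot: "isometry (rot t)"
proof -
  have "rot t (cis (- (real t * pi / 4)) * z) = z" for z by (simp add: rot_def mult.assoc[symmetric] cis_mult)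
  moreover have "dist (rot t x) (rot t y) = dist x y" for x y
    by (simp add: rot_def dist_norm right_diff_distrib[symmetric] norm_mult)
  ultimately show ?thesis unfolding isometry_def by (metis surjI)
qed

lemma norm_rot [simp]: "norm (rot t z) = norm z" by (simp add: rot_def norm_mult)
lemma rot_0 [simp]: "rot t 0 = 0" by (simp add: rot_def)

lemma rot_comp: "rot s (rot t z) = rot (s + t) z"
  by (simp add: rot_def mult.assoc[symmetric] cis_mult distrib_right add_divide_distrib)
lemma rot_8: "rot (t + 8) z = rot t z"
proof -
  have "real (t + 8) * pi / 4 = real t * pi / 4 + 2 * pi" by (simp add: field_simps)
  then show ?thesis unfolding rot_def by (simp only: cis_2pi_add)
qed
lemma rot_mod: "rot (t mod 8) z = rot t z"
proof (induction t rule: less_induct)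
  case (less t)
  show ?case
  proof (cases "t < 8")
    case False
    then have "t mod 8 = (t - 8) mod 8" by (simp add: le_mod_geq)
    then show ?thesis using less[of "t - 8"] rot_8[of "t - 8" z] False by simp
  qed simp
qed

lemma hchain_chain_core: "hchain = chain_core \<union> closed_segment sample_e (4 * u0)" unfolding hchain_cases chain_core_def ..

lemma rot_ray: "rot t ` closed_segment sample_e (4 * u0) = ray t"
  unfolding closed_segment_linear_image[OF rot_linear, symmetric] ray_def sample_e_eq
  by (simp add: rot_u0[symmetric] rot_def algebra_simps)
lemma rot_cnj_ray: "t < 8 \<Longrightarrow> rot t ` cnj ` closed_segment sample_e (4 * u0) = ray ((t + 7) mod 8)"
  unfolding closed_segment_linear_image[OF cnj_linear, symmetric] closed_segment_linear_image[OF rot_linear, symmetric] ray_def sample_e_eq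
  by (simp add: rot_cnj_u0[symmetric] rot_def algebra_simps)

lemma pocket_at_split: "t < 8 \<Longrightarrow> pocket_at t = pocket_core t \<union> ray t \<union> ray ((t + 7) mod 8)"
  unfolding pocket_at_def pocket_core_def pocket_def hchain_chain_core image_Un by (simp add: rot_ray rot_cnj_ray Un_ac)

text \<open>Each strand line bounds exactly one pocket of each parity, so either parity contributes
  all eight rays.\<close>

lemma pocket_at_union:
  assumes "par < 2"
  shows "(\<Union>t\<in>parity par. pocket_at t) = (\<Union>t\<in>parity par. pocket_core t) \<union> (\<Union>j<8. ray j)"
proof -
  have "{..<8::nat} = {0, 1, 2, 3, 4, 5, 6, 7}" by auto
  then have r: "(\<Union>j<8. ray j) = ray 0 \<union> ray 1 \<union> ray 2 \<union> ray 3 \<union> ray 4 \<union> ray 5 \<union> ray 6 \<union> ray 7"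
    by (simp add: Un_ac)
  consider "par = 0" | "par = 1" using assms by linarith
  then show ?thesis unfolding r by cases (simp_all add: parity_eq parity_eq(2)[unfolded One_nat_def] pocket_at_split Un_ac)
qed

lemma chain_core_compact: "compact chain_core"
proof -
  have "continuous_on S arc2" "continuous_on S arc3" "continuous_on S arc4" for S
    unfolding arc2_def arc3_def arc4_def by (intro continuous_intros)+
  then show ?thesis unfolding chain_core_def by (intro compact_Un compact_continuous_image) auto
qed

lemma isometry_compact: "isometry F \<Longrightarrow> compact S \<Longrightarrow> compact (F ` S)"
  using isometry_continuous compact_continuous_image by blast

lemma pocket_core_compact: "compact (pocket_core t)" unfolding pocket_core_def
  by (intro isometry_compact[OF isometry_rot] compact_Un chain_core_compact isometry_compact[OF isometry_cnj])
lemma ray_compact: "compact (ray j)" unfolding ray_def by simp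
lemma pocket_at_compact: "compact (pocket_at t)" unfolding pocket_at_def pocket_def hchain_chain_core
  by (intro isometry_compact[OF isometry_rot] compact_Un chain_core_compact isometry_compact[OF isometry_cnj]) simp_all
lemma strand_point_cont: "continuous_on S (strand_point \<theta>)" unfolding strand_point_def by (intro continuous_intros)
lemma strand_compact: "compact (strand \<theta>)" unfolding strand_def by (intro compact_continuous_image strand_point_cont) auto
lemma strand_at_compact: "compact (strand_at j)" unfolding strand_at_def using strand_compact isometry_compact[OF isometry_cnj] by simp

lemma hchain_norm_chain_core: "y \<in> chain_core \<Longrightarrow> norm y < 4"
proof (rule ccontr)
  assume y: "y \<in> chain_core" "\<not> norm y < 4"
  then have "y \<in> hchain" by (simp add: hchain_chain_core)
  then have e: "y = 4 * u0" using hchain_wedge(4,5)[of y] y by simp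
  \<comment> \<open>The core stays within real part 2.5, whereas the real part of
    \<open>4 * u0\<close> exceeds 3.6.\<close>
  have "Re y \<le> 2.5" 
  proof -
    have "\<bar>Re z\<bar> \<le> 2.5" if "z \<in> chain_core" for z
      using that unfolding chain_core_def
    proof (elim UnE imageE)
      assume "z \<in> closed_segment 1 g1"
      then obtain s where "z = (1 - s) *\<^sub>R 1 + s *\<^sub>R g1" by (auto simp: closed_segment_def)
      then have "Re z = 1" by (simp add: g1_def)
      then show ?thesis by simp
    next
      fix \<phi> assume "z = arc2 \<phi>"
      then show ?thesis using cos_le_one[of \<phi>] cos_ge_minus_one[of \<phi>] by (simp add: arc2_parts abs_le_iff del: cos_le_one cos_ge_minus_one)
    next
      fix \<phi> assume "z = arc3 \<phi>"
      then show ?thesis using sin_le_one[of \<phi>] sin_ge_minus_one[of \<phi>] by (simp add: arc3_parts abs_le_iff del: sin_le_one sin_ge_minus_one)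
    next
      fix \<phi> assume p: "\<phi> \<in> {0..turn4}" and z: "z = arc4 \<phi>"
      have "dist z g3 < 0.4" using arc4_near p z by simp
      then have "\<bar>Re z - 2.025\<bar> < 0.4" using Re_Im_ball[of g3 z "0.4"] by (simp add: dist_commute g3_def)
      then show ?thesis by (simp add: abs_if split: if_splits)
    qed
    then show ?thesis using y by force
  qed
  then show False using cos8_bounds e by simp
qed

lemma pocket_core_norm: "x \<in> pocket_core t \<Longrightarrow> norm x < 4" unfolding pocket_core_def using hchain_norm_chain_core by auto

lemma ray_iff: "x \<in> ray j \<longleftrightarrow> (\<exists>s. radius_e \<le> s \<and> s \<le> 4 \<and> x = of_real s * cis (ang j))"
proof -
  have e: "rot j (of_real s * u0) = of_real s * cis (ang j)" for s
    by (simp add: rot_u0[symmetric] rot_def)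
  have "x \<in> ray j \<longleftrightarrow> (\<exists>y. y \<in> closed_segment sample_e (4 * u0) \<and> x = rot j y)" unfolding rot_ray[symmetric] by auto
  also have "\<dots> \<longleftrightarrow> (\<exists>s. radius_e \<le> s \<and> s \<le> 4 \<and> x = rot j (of_real s * u0))" unfolding ray_param by auto
  finally show ?thesis unfolding e .
qed

lemma ray_norm: "x \<in> ray j \<Longrightarrow> norm x \<le> 4" "x \<in> ray j \<Longrightarrow> norm x = 4 \<Longrightarrow> x = port j"
  using radius_e_gt unfolding ray_iff port_def by (auto simp: norm_mult)

lemma pocket_at_norm: "x \<in> pocket_at t \<Longrightarrow> norm x \<le> 4"
  unfolding pocket_at_def pocket_def using hchain_wedge(4) by auto
lemma pocket_at_norm4: "t < 8 \<Longrightarrow> x \<in> pocket_at t \<Longrightarrow> norm x = 4 \<Longrightarrow> x \<in> {port t, port ((t + 7) mod 8)}"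
  using pocket_at_split[of t] pocket_core_norm[of x t] ray_norm(2)[of x t] ray_norm(2)[of x "(t + 7) mod 8"] by auto

lemma strand_at_norm: 
  assumes "j < 8" "x \<in> strand_at j" 
  shows "4 \<le> norm x" "norm x = 4 \<Longrightarrow> x = port j"
proof -
  have "4 \<le> norm x \<and> (norm x = 4 \<longrightarrow> x = port j)"
  proof (cases "j < 4")
    case True
    then obtain \<alpha> where "\<alpha> \<in> {-ang j..ang j}" "x = strand_point (ang j) \<alpha>" using assms unfolding strand_at_def strand_def by auto
    then show ?thesis using strand_point_norm[OF ang_range[OF True], of \<alpha>] strand_point_start[OF ang_range[OF True]] by (auto simp: port_def abs_le_iff)
  next
    case False
    define i where "i = 7 - j"
    have i: "i < 4" using False assms by (simp add: i_def)
    then obtain \<alpha> where a: "\<alpha> \<in> {-ang i..ang i}" "x = cnj (strand_point (ang i) \<alpha>)" using assms False unfolding strand_at_def strand_def i_def by auto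
    have "cis (ang j) = cnj (cis (ang i))" unfolding i_def using cis_ang_cnj[OF assms(1)] by simp
    then show ?thesis using a strand_point_norm[OF ang_range[OF i], of \<alpha>] strand_point_start[OF ang_range[OF i]] by (auto simp: port_def abs_le_iff)
  qed
  then show "4 \<le> norm x" "norm x = 4 \<Longrightarrow> x = port j" by auto
qed

lemma mirror_mirror [simp]: "mirror (mirror z) = z" by (simp add: mirror_def)
lemma mirror_cnj: "mirror (cnj z) = cnj (mirror z)" by (simp add: mirror_def)
lemma mirror_strand: "mirror ` strand \<theta> = strand \<theta>"
proof -
  have "mirror ` strand \<theta> = strand_point \<theta> ` (uminus ` {-\<theta>..\<theta>})" unfolding strand_def image_image mirror_strand_point ..
  then show ?thesis unfolding strand_def by simp
qed
lemma mirror_strand_at: "mirror ` strand_at j = strand_at j"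
proof -
  have "mirror ` cnj ` S = cnj ` mirror ` S" for S by (simp add: image_image mirror_cnj)
  then show ?thesis unfolding strand_at_def by (simp add: mirror_strand)
qed

lemma mirror_curve: "mirror ` curve par par' = curve par' par"
  unfolding curve_def image_Un image_UN image_image mirror_mirror mirror_strand_at by (auto simp: mirror_strand_at)

lemma cnj_rot: "t < 8 \<Longrightarrow> cnj (rot t z) = rot ((8 - t) mod 8) (cnj z)"
proof -
  assume "t < 8"
  then have "real (8 - t) * pi / 4 = - (real t * pi / 4) + 2 * pi" by (simp add: of_nat_diff field_simps)
  then have "cis (real (8 - t) * pi / 4) = cnj (cis (real t * pi / 4))" by (simp only: cis_2pi_add cis_cnj)
  then show ?thesis unfolding rot_mod by (simp add: rot_def)
qed
lemma cnj_pocket: "cnj ` pocket = pocket" unfolding pocket_def image_Un image_image by auto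
lemma cnj_pocket_at: "t < 8 \<Longrightarrow> cnj ` pocket_at t = pocket_at ((8 - t) mod 8)"
  unfolding pocket_at_def image_image cnj_rot by (subst cnj_pocket[symmetric]) (simp add: image_image cnj_rot)
lemma cnj_strand_at: "j < 8 \<Longrightarrow> cnj ` strand_at j = strand_at (7 - j)"
  unfolding strand_at_def by (auto simp: image_image)

lemma cnj_PEs: "par < 2 \<Longrightarrow> cnj ` (\<Union>t\<in>parity par. pocket_at t) = (\<Union>t\<in>parity par. pocket_at t)"
proof -
  assume "par < 2"
  then consider "par = 0" | "par = Suc 0" by linarith
  then show ?thesis
    by cases (simp_all add: parity_eq parity_eq(2)[unfolded One_nat_def] image_Un cnj_pocket_at Un_ac)
qed
lemma cnj_curve: "par < 2 \<Longrightarrow> par' < 2 \<Longrightarrow> cnj ` curve par par' = curve par par'"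
proof -
  assume p: "par < 2" "par' < 2"
  have "cnj ` (\<Union>j<8. strand_at j) = (\<Union>j<8. strand_at j)"
  proof -
    have "{..<8::nat} = {0, 1, 2, 3, 4, 5, 6, 7}" by auto
    then show ?thesis by (simp add: image_Un cnj_strand_at Un_ac)
  qed
  moreover have "cnj ` mirror ` S = mirror ` cnj ` S" for S by (simp add: image_image mirror_cnj)
  ultimately show ?thesis unfolding curve_def image_Un using cnj_PEs p by simp
qed

lemma rot_gadget: "t < 8 \<Longrightarrow> rot t ` gadget = (\<Union>s\<in>parity (t mod 2). pocket_at s)"
proof -
  assume t: "t < 8"
  have e: "rot t ` gadget = (\<Union>s\<in>{0,2,4,6}. pocket_at ((t + s) mod 8))"
    unfolding gadget_def pocket_at_def image_UN image_image rot_comp rot_mod ..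
  have "\<forall>t<8. (\<Union>s\<in>{0,2,4,6}. pocket_at ((t + s) mod 8)) = (\<Union>s\<in>parity (t mod 2). pocket_at s)"
    unfolding less8 by (simp add: parity_eq Un_ac del: One_nat_def) (simp add: numeral_2_eq_2)
  then show ?thesis using t e by simp
qed

lemma mirror_far: "norm x \<le> 4 \<Longrightarrow> norm (mirror x) \<ge> 6"
proof -
  assume "norm x \<le> 4"
  moreover have "norm (10 - cnj x) \<ge> norm (10::complex) - norm (cnj x)" by (rule norm_triangle_ineq2)
  ultimately show ?thesis by (simp add: mirror_def)
qed

text \<open>Strands and the mirrored gadget stay outside the open disc of radius 4, so inside it
  only pockets of one parity are seen. The second form, with \<open>cnj\<close>, lets the results on
  the upper half of a pocket serve for its lower half.\<close>

lemma curve_ball: 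
  assumes F: "isometry F" and t: "t < 8" "t mod 2 = par"
  shows "F ` curve par par' \<inter> ball (F 0) 4 = (F \<circ> rot t) ` gadget \<inter> ball ((F \<circ> rot t) 0) 4"
    and "F ` curve par par' \<inter> ball (F 0) 4 = (F \<circ> rot t \<circ> cnj) ` gadget \<inter> ball ((F \<circ> rot t \<circ> cnj) 0) 4"
proof -
  have "curve par par' \<inter> ball 0 4 = (\<Union>s\<in>parity par. pocket_at s) \<inter> ball 0 4"
  proof -
    have "norm x \<ge> 4" if xx: "x \<in> (\<Union>j<8. strand_at j) \<union> mirror ` (\<Union>t\<in>parity par'. pocket_at t)" for x
    proof -
      consider j where "j < 8" "x \<in> strand_at j" | t w where "w \<in> pocket_at t" "x = mirror w" using xx by auto
      then show ?thesis
      proof cases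
        case 1 then show ?thesis using strand_at_norm(1) by blast
      next
        case 2 then show ?thesis using mirror_far[of w] pocket_at_norm[of w t] by simp
      qed
    qed
    then have "((\<Union>j<8. strand_at j) \<union> mirror ` (\<Union>t\<in>parity par'. pocket_at t)) \<inter> ball 0 4 = {}"
      unfolding disjoint_iff by (metis dist_0_norm mem_ball not_less)
    then show ?thesis unfolding curve_def by blast
  qed
  then have "curve par par' \<inter> ball 0 4 = rot t ` gadget \<inter> ball 0 4" using rot_gadget t by simp
  moreover have b: "ball (F 0) 4 = F ` ball 0 4"
  proof (intro equalityI subsetI)
    fix x assume x: "x \<in> ball (F 0) 4"
    obtain y where y: "F y = x" using isometry_surj[OF F] by blast
    then have "y \<in> ball 0 4" using x isometry_dist[OF F, of 0 y] by simp
    then show "x \<in> F ` ball 0 4" using y by blast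
  next
    fix x assume "x \<in> F ` ball 0 4"
    then show "x \<in> ball (F 0) 4" using isometry_dist[OF F] by auto
  qed
  ultimately have "F ` curve par par' \<inter> ball (F 0) 4 = F ` rot t ` gadget \<inter> ball (F 0) 4"
    unfolding b by (metis image_Int isometry_inj[OF F])
  then show "F ` curve par par' \<inter> ball (F 0) 4 = (F \<circ> rot t) ` gadget \<inter> ball ((F \<circ> rot t) 0) 4"
    "F ` curve par par' \<inter> ball (F 0) 4 = (F \<circ> rot t \<circ> cnj) ` gadget \<inter> ball ((F \<circ> rot t \<circ> cnj) 0) 4"
    by (simp_all only: image_comp[symmetric] cnj_gadget comp_apply rot_0 complex_cnj_zero)
qed

section \<open>The common part and its distance from the medial axis\<close>

lemma strand_at_disjoint: 
  assumes "i < 8" "j < 8" "i \<noteq> j" shows "strand_at i \<inter> strand_at j = {}"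
proof -
  have pos: "0 < Im x" if "x \<in> strand (ang k)" "k < 4" for x k
    using that strand_point_Im_pos[OF ang_range[OF that(2)]] unfolding strand_def by auto
  have d: "strand (ang k) \<inter> strand (ang l) = {}" if "k < 4" "l < 4" "k \<noteq> l" for k l
  proof -
    have "ang k \<noteq> ang l" using that by (simp add: ang_def)
    then show ?thesis using strand_disjoint ang_range that by metis
  qed
  have sg: "i < 4 \<Longrightarrow> x \<in> strand_at i \<Longrightarrow> 0 < Im x" "i < 8 \<Longrightarrow> \<not> i < 4 \<Longrightarrow> x \<in> strand_at i \<Longrightarrow> Im x < 0" for i x
    unfolding strand_at_def using pos by (auto simp: image_iff)
  consider "i < 4" "j < 4" | "i < 4" "\<not> j < 4" | "\<not> i < 4" "j < 4" | "\<not> i < 4" "\<not> j < 4" by blast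
  then show ?thesis
  proof cases
    case 4
    then have "strand (ang (7 - i)) \<inter> strand (ang (7 - j)) = {}" using d assms by simp
    then show ?thesis unfolding strand_at_def using 4
      by (simp add: image_Int[symmetric, OF isometry_inj[OF isometry_cnj]])
  qed (use sg assms d in \<open>fastforce simp: strand_at_def\<close>)+
qed

text \<open>\<open>local_split\<close> is applied with both halves of the strand at its top, with
  ray and half strand at the port, and with one half elsewhere. Nonnegative parameters are enough
  because \<open>mirror\<close> exchanges the halves.\<close>

lemma strand_free:
  assumes F: "isometry F" and p: "par < 2" "par' < 2" and j: "j < 4" and a: "0 \<le> \<alpha>" "\<alpha> \<le> ang j"
  shows "\<exists>\<epsilon>>0. ball (F (strand_point (ang j) \<alpha>)) \<epsilon> \<inter> medial_axis (F ` curve par par') = {}"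
proof -
  define \<theta> where "\<theta> = ang j"
  have t: "0 < \<theta>" "\<theta> < pi" using ang_range[OF j] by (simp_all add: \<theta>_def)
  define z where "z = strand_point \<theta> \<alpha>"
  have ab: "\<bar>\<alpha>\<bar> \<le> \<theta>" using a by (simp add: \<theta>_def)
  define L R where "L = strand_point \<theta> ` {0..\<theta>}" and "R = strand_point \<theta> ` {-\<theta>..0}"
  define O1 where "O1 = (\<Union>i\<in>{..<8} - {j}. strand_at i) \<union> mirror ` (\<Union>t\<in>parity par'. pocket_at t)"
  have fT: "finite (parity q)" for q unfolding parity_def by simp
  have LR: "strand_at j = L \<union> R"
  proof -
    have "{-\<theta>..\<theta>} = {0..\<theta>} \<union> {-\<theta>..0}" using t by auto
    then show ?thesis unfolding strand_at_def strand_def L_def R_def \<theta>_def[symmetric] using j by (simp add: image_Un)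
  qed
  have ins: "{..<8::nat} = insert j ({..<8} - {j})" using j by auto
  have UN8: "(\<Union>i<8. f i) = f j \<union> (\<Union>i\<in>{..<8} - {j}. f i)" for f :: "nat \<Rightarrow> complex set" using ins UN_insert by metis
  have SEu: "(\<Union>i<8. strand_at i) = strand_at j \<union> (\<Union>i\<in>{..<8} - {j}. strand_at i)" by (rule UN8)
  have CCeq: "curve par par' = (\<Union>t\<in>parity par. pocket_at t) \<union> L \<union> R \<union> O1"
    unfolding curve_def SEu LR O1_def by blast
  have cl: "closed (\<Union>t\<in>parity q. pocket_at t)" "closed (\<Union>t\<in>parity q. pocket_core t)" "closed R" for q
    using fT pocket_at_compact pocket_core_compact unfolding R_def
    by (auto intro!: closed_UN compact_imp_closed compact_continuous_image strand_point_cont)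
  have clO: "closed O1" unfolding O1_def
    by (intro closed_Un closed_UN compact_imp_closed strand_at_compact isometry_compact[OF isometry_mirror] compact_UN fT pocket_at_compact) auto
  have zSE: "z \<in> strand_at j" 
  proof -
    have "strand_point \<theta> \<alpha> \<in> strand \<theta>" unfolding strand_def by (rule imageI) (use ab in auto)
    then show ?thesis using j by (simp add: z_def strand_at_def \<theta>_def)
  qed
  have zO: "z \<notin> O1"
  proof -
    have "z \<notin> strand_at i" if "i \<in> {..<8} - {j}" for i using strand_at_disjoint[of i j] that j zSE by auto
    moreover have "z \<notin> mirror ` (\<Union>t\<in>parity par'. pocket_at t)"
    proof
      assume "z \<in> mirror ` (\<Union>t\<in>parity par'. pocket_at t)"
      then have "norm (mirror z) \<le> 4" using pocket_at_norm by auto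
      then have "norm (strand_point \<theta> (- \<alpha>)) \<le> 4" by (simp add: z_def mirror_strand_point)
      then have "- \<alpha> = \<theta>" using strand_point_norm[OF t, of "- \<alpha>"] ab by force
      then show False using a t by simp
    qed
    ultimately show ?thesis unfolding O1_def by blast
  qed
  have zL: "z \<in> L" unfolding z_def L_def using a by (auto simp: \<theta>_def)
  have zR: "z \<notin> R" if "\<alpha> \<noteq> 0"
  proof
    assume "z \<in> R"
    then obtain \<beta> where "\<beta> \<in> {-\<theta>..0}" "strand_point \<theta> \<alpha> = strand_point \<theta> \<beta>" unfolding R_def z_def by auto
    then show False using strand_point_inj[OF t ab, of \<beta>] a that by auto
  qed
  have zP: "z \<notin> (\<Union>t\<in>parity par. pocket_at t)" if "\<alpha> \<noteq> \<theta>"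
    using strand_point_norm[OF t ab] pocket_at_norm that unfolding z_def by force
  have top: "strand_point \<theta> 0 \<noteq> 4 * cis \<theta>" using strand_point_inj[OF t, of 0 \<theta>] strand_point_start[OF t] t by auto
  have "\<exists>\<epsilon>>0. ball (F z) \<epsilon> \<inter> medial_axis (F ` curve par par') = {}"
  proof -
    consider "\<alpha> = 0" | "\<alpha> = \<theta>" "\<alpha> \<noteq> 0" | "\<alpha> \<noteq> 0" "\<alpha> \<noteq> \<theta>" by blast
    then show ?thesis
    proof cases
      case 1
      obtain B T where B: "smooth_piece R (strand_point \<theta> 0) 1 B T" "B = strand_point \<theta> (-\<theta>)" using right_smooth_piece[OF t] unfolding R_def by blast
      have "strand_point \<theta> 0 \<noteq> B" using strand_point_inj[OF t, of 0 "-\<theta>"] B t by auto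
      then have "\<exists>\<epsilon>>0. \<forall>q\<in>ball z \<epsilon>. \<exists>w. nearest q (L \<union> R) w"
        using two_smooth_piece_near[OF left_smooth_piece[OF t] B(1)] top 1 unfolding z_def L_def by auto
      then show ?thesis
        using zL zO zP 1 t by (intro local_split[OF F, of _ "L \<union> R" "(\<Union>t\<in>parity par. pocket_at t) \<union> O1"]) (auto simp: CCeq cl clO)
    next
      case 2
      define E' where "E' = (\<Union>t\<in>parity par. pocket_core t) \<union> (\<Union>i\<in>{..<8} - {j}. ray i) \<union> R \<union> O1"
      have zv: "z = port j" unfolding z_def 2 port_def \<theta>_def[symmetric] by (rule strand_point_start[OF t])
      then have nz: "norm z = 4" by (simp add: port_def norm_mult)
      have "(\<Union>i<8. ray i) = ray j \<union> (\<Union>i\<in>{..<8} - {j}. ray i)" by (rule UN8)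
      then have ce: "curve par par' = (ray j \<union> L) \<union> E'" unfolding CCeq pocket_at_union[OF p(1)] E'_def by blast
      have "closed E'" unfolding E'_def using cl clO
        by (intro closed_Un closed_UN) (auto intro: compact_imp_closed ray_compact pocket_core_compact fT)
      moreover have "z \<notin> E'"
      proof -
        have "z \<notin> (\<Union>t\<in>parity par. pocket_core t)" using pocket_core_norm nz by force
        moreover have "z \<notin> ray i" if "i \<in> {..<8} - {j}" for i
        proof
          assume "z \<in> ray i"
          then have "port i = port j" using ray_norm(2) nz zv by metis
          then have "cis (ang i) = cis (ang j)" by (simp add: port_def)
          then show False using cis_ang_inj[of i j] that j by auto
        qed
        ultimately show ?thesis unfolding E'_def using zO zR 2 by auto
      qed
      moreover have "\<exists>\<epsilon>>0. \<forall>q\<in>ball z \<epsilon>. \<exists>w. nearest q (ray j \<union> L) w"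
      proof -
        have e: "4 * cis \<theta> - of_real radius_e * cis \<theta> = of_real (4 - radius_e) * cis \<theta>" by (simp add: algebra_simps)
        have "norm (4 * cis \<theta> - of_real radius_e * cis \<theta>) > 0" unfolding e norm_mult norm_of_real using radius_e_lt by simp
        then have ne: "of_real radius_e * cis \<theta> \<noteq> 4 * cis \<theta>" by auto
        have sg: "sgn (4 * cis \<theta> - of_real radius_e * cis \<theta>) = cis \<theta>" unfolding e sgn_mult sgn_of_real using radius_e_lt by (simp add: sgn_eq)
        have "smooth_piece (ray j) (of_real radius_e * cis \<theta>) (cis \<theta>) (4 * cis \<theta>) (cis \<theta>)"
          using smooth_piece_segment[OF ne] unfolding sg ray_def \<theta>_def[symmetric] .
        then show ?thesis using two_smooth_piece_near[OF _ left_smooth_piece[OF t]] ne top zv unfolding port_def L_def \<theta>_def[symmetric] by metis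
      qed
      ultimately show ?thesis using zL by (intro local_split[OF F ce]) auto
    next
      case 3
      have "z \<noteq> 4 * cis \<theta>" "z \<noteq> strand_point \<theta> 0"
        using strand_point_inj[OF t ab, of \<theta>] strand_point_inj[OF t ab, of 0] strand_point_start[OF t] 3 t unfolding z_def by auto
      then have "\<exists>\<epsilon>>0. \<forall>q\<in>ball z \<epsilon>. \<exists>w. nearest q L w"
        using smooth_piece_near[OF left_smooth_piece[OF t]] zL unfolding L_def by blast
      then show ?thesis
        using zL zO zP zR 3 by (intro local_split[OF F, of _ L "(\<Union>t\<in>parity par. pocket_at t) \<union> R \<union> O1"]) (auto simp: CCeq intro!: closed_Un cl clO)
    qed
  qed
  then show ?thesis unfolding z_def \<theta>_def .
qed

text \<open>It is contained in all four curves, so a net chosen here serves them at once.\<close>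

definition common_part :: "complex set" where "common_part = (\<Union>j<8. ray j) \<union> (\<Union>j<8. strand_at j) \<union> mirror ` (\<Union>j<8. ray j)"

lemma common_part_compact: "compact common_part" unfolding common_part_def
  by (intro compact_Un compact_UN isometry_compact[OF isometry_mirror] ray_compact strand_at_compact) auto

lemma port_strand_at: "j < 8 \<Longrightarrow> port j \<in> strand_at j"
proof (cases "j < 4")
  case True
  have "strand_point (ang j) (ang j) \<in> strand (ang j)" unfolding strand_def using ang_range[OF True] by (intro imageI) simp
  then show ?thesis using strand_point_start[OF ang_range[OF True]] True unfolding strand_at_def port_def by simp
next
  case False
  assume "j < 8"
  define i where "i = 7 - j"
  have i: "i < 4" using False by (simp add: i_def)
  have "cis (ang j) = cnj (cis (ang i))" unfolding i_def using cis_ang_cnj[OF \<open>j < 8\<close>] by simp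
  moreover have "strand_point (ang i) (ang i) \<in> strand (ang i)" unfolding strand_def using ang_range[OF i] by (intro imageI) simp
  ultimately show ?thesis using strand_point_start[OF ang_range[OF i]] False unfolding strand_at_def port_def i_def[symmetric]
    by (simp add: image_iff) (metis complex_cnj_mult complex_cnj_numeral)
qed

text \<open>Conjugation and \<open>mirror\<close> move any point to an upper strand with nonnegative
  parameter or to a ray of the gadget at 0; precomposing \<open>F\<close> with them reduces each
  case to an earlier one.\<close>

lemma common_part_free:
  assumes F: "isometry F" and p: "par < 2" "par' < 2" and z: "z \<in> common_part"
  shows "\<exists>\<epsilon>>0. ball (F z) \<epsilon> \<inter> medial_axis (F ` curve par par') = {}"
proof -
  have S4: "\<exists>\<epsilon>>0. ball (G z) \<epsilon> \<inter> medial_axis (G ` curve q q') = {}"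
    if G: "isometry G" "q < 2" "q' < 2" and j: "j < 4" and z: "z \<in> strand (ang j)" for G :: "complex \<Rightarrow> real^2" and q q' j z
  proof -
    obtain \<alpha> where a: "\<alpha> \<in> {-ang j..ang j}" "z = strand_point (ang j) \<alpha>" using z unfolding strand_def by auto
    show ?thesis
    proof (cases "0 \<le> \<alpha>")
      case True then show ?thesis using strand_free[OF G j, of \<alpha>] a by simp
    next
      case False
      have "\<exists>\<epsilon>>0. ball ((G \<circ> mirror) (strand_point (ang j) (- \<alpha>))) \<epsilon> \<inter> medial_axis ((G \<circ> mirror) ` curve q' q) = {}"
        using strand_free[OF isometry_comp[OF G(1) isometry_mirror] G(3,2) j, of "- \<alpha>"] a False by simp
      then show ?thesis unfolding image_comp[symmetric] mirror_curve comp_apply mirror_strand_point using a by simp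
    qed
  qed
  have S8: "\<exists>\<epsilon>>0. ball (G z) \<epsilon> \<inter> medial_axis (G ` curve q q') = {}"
    if G: "isometry G" "q < 2" "q' < 2" and j: "j < 8" and z: "z \<in> strand_at j" for G :: "complex \<Rightarrow> real^2" and q q' j z
  proof (cases "j < 4")
    case True then show ?thesis using S4[OF G] z by (simp add: strand_at_def)
  next
    case False
    then obtain w where w: "w \<in> strand (ang (7 - j))" "z = cnj w" using z by (auto simp: strand_at_def)
    have "\<exists>\<epsilon>>0. ball ((G \<circ> cnj) w) \<epsilon> \<inter> medial_axis ((G \<circ> cnj) ` curve q q') = {}"
      using S4[OF isometry_comp[OF G(1) isometry_cnj] G(2,3) _ w(1)] False by simp
    then show ?thesis unfolding image_comp[symmetric] cnj_curve[OF G(2,3)] using w by simp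
  qed
  have R8: "\<exists>\<epsilon>>0. ball (G z) \<epsilon> \<inter> medial_axis (G ` curve q q') = {}"
    if G: "isometry G" "q < 2" "q' < 2" and j: "j < 8" and z: "z \<in> ray j" for G :: "complex \<Rightarrow> real^2" and q q' j z
  proof (cases "norm z = 4")
    case True then show ?thesis using S8[OF G j] ray_norm(2)[OF z] port_strand_at[OF j] by simp
  next
    case False
    then have n: "norm z < 4" using ray_norm(1)[OF z] by simp
    show ?thesis
    proof (cases "j mod 2 = q")
      case True
      obtain y where y: "y \<in> closed_segment sample_e (4 * u0)" "z = rot j y" using z unfolding rot_ray[symmetric] by auto
      have "G ` curve q q' \<inter> ball ((G \<circ> rot j) 0) 4 = (G \<circ> rot j) ` gadget \<inter> ball ((G \<circ> rot j) 0) 4"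
        using curve_ball(1)[OF G(1) j True] by simp
      then show ?thesis using ray_free[OF isometry_comp[OF G(1) isometry_rot[of j]], of "G ` curve q q'" y] y n by simp
    next
      case False
      \<comment> \<open>A ray whose index has the other parity is the lower edge of the next pocket,
        hence reached through \<open>cnj\<close>.\<close>
      define t where "t = (j + 1) mod 8"
      have "\<forall>j<8. j mod 2 \<noteq> q \<longrightarrow> (j + 1) mod 8 mod 2 = q \<and> ((j + 1) mod 8 + 7) mod 8 = j"
        unfolding less8 using G(2) by auto
      then have t: "t < 8" "t mod 2 = q" "(t + 7) mod 8 = j" using False j unfolding t_def by auto
      obtain y where y: "y \<in> closed_segment sample_e (4 * u0)" "z = rot t (cnj y)"
        using z rot_cnj_ray[OF t(1)] unfolding t(3) by auto
      have "G ` curve q q' \<inter> ball ((G \<circ> rot t \<circ> cnj) 0) 4 = (G \<circ> rot t \<circ> cnj) ` gadget \<inter> ball ((G \<circ> rot t \<circ> cnj) 0) 4"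
        using curve_ball(2)[OF G(1) t(1,2)] by simp
      then show ?thesis using ray_free[OF isometry_comp[OF isometry_comp[OF G(1) isometry_rot[of t]] isometry_cnj], of "G ` curve q q'" y] y n by simp
    qed
  qed
  consider j where "j < 8" "z \<in> ray j" | j where "j < 8" "z \<in> strand_at j" | j w where "j < 8" "w \<in> ray j" "z = mirror w"
    using z unfolding common_part_def by auto
  then show ?thesis
  proof cases
    case 1 then show ?thesis using R8[OF F p] by blast
  next
    case 2 then show ?thesis using S8[OF F p] by blast
  next
    case 3
    have "\<exists>\<epsilon>>0. ball ((F \<circ> mirror) w) \<epsilon> \<inter> medial_axis ((F \<circ> mirror) ` curve par' par) = {}"
      using R8[OF isometry_comp[OF F isometry_mirror] p(2,1) 3(1,2)] .
    then show ?thesis unfolding image_comp[symmetric] mirror_curve using 3 by simp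
  qed
qed

section \<open>Topology of the glued curves\<close>

definition is_arc :: "'a::topological_space set \<Rightarrow> 'a \<Rightarrow> 'a \<Rightarrow> bool" where
  "is_arc X v w \<longleftrightarrow> (\<exists>g. arc g \<and> path_image g = X \<and> pathstart g = v \<and> pathfinish g = w)"

lemma is_arc_sym: "is_arc X v w \<Longrightarrow> is_arc X w v"
  unfolding is_arc_def by (metis arc_reversepath path_image_reversepath pathfinish_reversepath pathstart_reversepath)

lemma is_arc_join: "is_arc X v w \<Longrightarrow> is_arc Y w y \<Longrightarrow> X \<inter> Y \<subseteq> {w} \<Longrightarrow> is_arc (X \<union> Y) v y"
  unfolding is_arc_def by (metis arc_join path_image_join pathfinish_join pathstart_join)

lemma is_arc_isometry:
  assumes "isometry F" "is_arc X v w" shows "is_arc (F ` X) (F v) (F w)"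
proof -
  obtain g where g: "arc g" "path_image g = X" "pathstart g = v" "pathfinish g = w" using assms unfolding is_arc_def by blast
  have "path (F \<circ> g)" using g isometry_continuous[OF assms(1)] by (intro path_continuous_image) (auto simp: arc_def)
  moreover have "inj_on (F \<circ> g) {0..1}" using g(1) isometry_inj[OF assms(1)] unfolding arc_def
    by (intro comp_inj_on) (auto intro: inj_on_subset)
  ultimately have "arc (F \<circ> g)" by (simp add: arc_def)
  then show ?thesis unfolding is_arc_def using g path_image_compose[of F g]
    by (intro exI[of _ "F \<circ> g"]) (auto simp: pathstart_def pathfinish_def path_image_compose)
qed

lemma is_arc_param:
  fixes P :: "real \<Rightarrow> 'a::topological_space"
  assumes "a < b" "continuous_on {a..b} P" "inj_on P {a..b}"
  shows "is_arc (P ` {a..b}) (P a) (P b)"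
proof -
  define f where "f t = a + t * (b - a)" for t :: real
  have fi: "f ` {0..1} = {a..b}"
  proof -
    have "f ` {0..1} = (\<lambda>x. (b - a) * x + a) ` {0..1}" unfolding f_def by (intro image_cong) (auto simp: algebra_simps)
    then show ?thesis using assms(1) by (subst (asm) image_affinity_atLeastAtMost) (auto split: if_splits)
  qed
  have "continuous_on {0..1} f" unfolding f_def by (intro continuous_intros)
  then have "path (P \<circ> f)" unfolding path_def using assms(2) fi by (intro continuous_on_compose) auto
  moreover have "inj_on f {0..1}" using assms(1) by (auto simp: f_def inj_on_def)
  then have "inj_on (P \<circ> f) {0..1}" using assms(3) fi by (intro comp_inj_on) auto
  ultimately have "arc (P \<circ> f)" by (simp add: arc_def)
  moreover have "path_image (P \<circ> f) = P ` {a..b}" unfolding path_image_def image_comp[symmetric] fi ..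
  ultimately show ?thesis unfolding is_arc_def
    by (intro exI[of _ "P \<circ> f"]) (simp add: pathstart_def pathfinish_def f_def)
qed

section \<open>Simple arcs from monotonicity\<close>

definition coord_sum :: "complex \<Rightarrow> real" where "coord_sum z = Re z + Im z"
text \<open>All headings of the half chain lie in the closed first quadrant, so
  \<open>coord_sum\<close> increases strictly along it. As \<open>coord_sum\<close> is extremal at
  the ends of each piece, neighbouring pieces meet only at the joint, and concatenation gives an arc
  without further checks.\<close>

definition monotone_arc :: "complex set \<Rightarrow> complex \<Rightarrow> complex \<Rightarrow> bool" where
  "monotone_arc X v w \<longleftrightarrow> is_arc X v w \<and> (\<forall>x\<in>X. x \<noteq> v \<longrightarrow> coord_sum v < coord_sum x) \<and> (\<forall>x\<in>X. x \<noteq> w \<longrightarrow> coord_sum x < coord_sum w)"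

lemma is_arc_mem: "is_arc X v w \<Longrightarrow> v \<in> X \<and> w \<in> X \<and> v \<noteq> w"
  unfolding is_arc_def by (metis arc_distinct_ends pathfinish_in_path_image pathstart_in_path_image)

lemma monotone_arc_join: assumes "monotone_arc X v w" "monotone_arc Y w y" shows "monotone_arc (X \<union> Y) v y"
proof -
  have vw: "coord_sum v < coord_sum w" "coord_sum w < coord_sum y" using assms is_arc_mem unfolding monotone_arc_def by metis+
  have "X \<inter> Y \<subseteq> {w}" using assms unfolding monotone_arc_def by (auto, metis less_asym)
  then have "is_arc (X \<union> Y) v y" using assms is_arc_join unfolding monotone_arc_def by metis
  moreover have "coord_sum v < coord_sum x" if "x \<in> X \<union> Y" "x \<noteq> v" for x
    using that assms vw unfolding monotone_arc_def by (metis Un_iff less_trans)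
  moreover have "coord_sum x < coord_sum y" if "x \<in> X \<union> Y" "x \<noteq> y" for x
    using that assms vw unfolding monotone_arc_def by (metis Un_iff less_trans)
  ultimately show ?thesis unfolding monotone_arc_def by blast
qed

lemma monotone_arc_param:
  fixes a b :: real
  assumes "a < b" "continuous_on {a..b} P" and m: "\<And>x y. a \<le> x \<Longrightarrow> x < y \<Longrightarrow> y \<le> b \<Longrightarrow> coord_sum (P x) < coord_sum (P y)"
  shows "monotone_arc (P ` {a..b}) (P a) (P b)"
proof -
  have "inj_on P {a..b}"
  proof (rule inj_onI, rule ccontr)
    fix x y assume "x \<in> {a..b}" "y \<in> {a..b}" "P x = P y" "x \<noteq> y"
    then show False using m[of x y] m[of y x] by (cases x y rule: linorder_cases) auto
  qed
  then have "is_arc (P ` {a..b}) (P a) (P b)" by (rule is_arc_param[OF assms(1,2)])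
  then show ?thesis unfolding monotone_arc_def using m assms(1)
    by (auto simp: image_iff) (metis less_eq_real_def order_refl)+
qed

lemma monotone_arc_segment: assumes "coord_sum A < coord_sum B" shows "monotone_arc (closed_segment A B) A B"
proof -
  have e: "closed_segment A B = (\<lambda>u. (1 - u) *\<^sub>R A + u *\<^sub>R B) ` {0..1}" by (rule closed_segment_image_interval)
  have "coord_sum ((1 - x) *\<^sub>R A + x *\<^sub>R B) = coord_sum A + x * (coord_sum B - coord_sum A)" for x by (simp add: coord_sum_def algebra_simps)
  then have "monotone_arc ((\<lambda>u. (1 - u) *\<^sub>R A + u *\<^sub>R B) ` {0..1}) ((1 - 0) *\<^sub>R A + 0 *\<^sub>R B) ((1 - 1) *\<^sub>R A + 1 *\<^sub>R B)"
    using assms by (intro monotone_arc_param continuous_intros) auto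
  then show ?thesis unfolding e[symmetric] by simp
qed

lemma P_cont: "continuous_on S arc2" "continuous_on S arc3" "continuous_on S arc4"
  unfolding arc2_def arc3_def arc4_def by (intro continuous_intros)+

lemma monotone_arc_arc2: assumes "0 < b" "b \<le> pi / 2" shows "monotone_arc (arc2 ` {0..b}) (arc2 0) (arc2 b)"
proof (rule monotone_arc_param[OF assms(1) P_cont(1)])
  fix x y assume h: "0 \<le> x" "x < y" "y \<le> b"
  have "cos y < cos x" "sin x < sin y" using h assms pi_gt_zero
    by (auto intro!: cos_monotone_0_pi sin_monotone_2pi)
  then show "coord_sum (arc2 x) < coord_sum (arc2 y)" by (simp add: coord_sum_def arc2_parts)
qed

lemma monotone_arc_arc3: "monotone_arc (arc3 ` {0..turn3}) (arc3 0) (arc3 turn3)"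
proof (rule monotone_arc_param[OF _ P_cont(2)])
  show "0 < turn3" using turn3_bounds pi_gt_zero by simp
  fix x y assume h: "0 \<le> x" "x < y" "y \<le> turn3"
  have "cos y < cos x" "sin x < sin y" using h turn3_bounds pi_gt_zero
    by (auto intro!: cos_monotone_0_pi sin_monotone_2pi)
  then show "coord_sum (arc3 x) < coord_sum (arc3 y)" by (simp add: coord_sum_def arc3_parts)
qed

lemma monotone_arc_arc4: "monotone_arc (arc4 ` {0..turn4}) (arc4 0) (arc4 turn4)"
proof (rule monotone_arc_param[OF turn4_bounds(1) P_cont(3)])
  fix x y assume h: "0 \<le> x" "x < y" "y \<le> turn4"
  have "cos (turn3 - x) < cos (turn3 - y)" "sin (turn3 - y) < sin (turn3 - x)" using h turn3_bounds turn4_bounds pi_gt_zero unfolding turn4_def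
    by (auto intro!: cos_monotone_0_pi sin_monotone_2pi)
  then have "R4 * (8 / 17 - sin (turn3 - x)) < R4 * (8 / 17 - sin (turn3 - y))" "R4 * (cos (turn3 - x) - 15 / 17) < R4 * (cos (turn3 - y) - 15 / 17)"
    using R4_gt by auto
  then show "coord_sum (arc4 x) < coord_sum (arc4 y)" unfolding coord_sum_def arc4_parts by linarith
qed

lemma monotone_arc_start: "monotone_arc (closed_segment 1 g1) 1 g1" by (rule monotone_arc_segment) (simp add: coord_sum_def g1_def)

lemma monotone_arc_hchain: "monotone_arc hchain 1 (4 * u0)"
proof -
  have "monotone_arc (closed_segment sample_e (4 * u0)) sample_e (4 * u0)"
  proof (rule monotone_arc_segment)
    have "0 < cos8 + sin8" using cos8_pos tan8_bounds by (simp add: sin8_eq add_pos_pos)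
    then have "radius_e * (cos8 + sin8) < 4 * (cos8 + sin8)" using radius_e_lt by (intro mult_strict_right_mono) auto
    then show "coord_sum sample_e < coord_sum (4 * u0)" by (simp add: coord_sum_def sample_e_eq distrib_left)
  qed
  moreover have "monotone_arc (arc2 ` {0..pi / 2}) g1 g2" "monotone_arc (arc3 ` {0..turn3}) g2 g3" "monotone_arc (arc4 ` {0..turn4}) g3 sample_e"
    using monotone_arc_arc2[of "pi / 2"] monotone_arc_arc3 monotone_arc_arc4 by (simp_all add: arc_values)
  ultimately show ?thesis unfolding hchain_cases using monotone_arc_start by (meson monotone_arc_join)
qed

text \<open>From the real axis to the first crossing: together with its conjugate this is the
  stretch between two consecutive samples that reveals parity 0.\<close>

definition first_gap :: "complex set" where "first_gap = closed_segment 1 g1 \<union> arc2 ` {0..angle_a}"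

lemma monotone_arc_first_gap: "monotone_arc first_gap 1 sample_a"
proof -
  have "monotone_arc (arc2 ` {0..angle_a}) g1 sample_a" using monotone_arc_arc2[of angle_a] angle_a_range by (simp add: arc_values sample_a_def)
  then show ?thesis unfolding first_gap_def using monotone_arc_start by (meson monotone_arc_join)
qed

lemma first_gap_hchain: "first_gap \<subseteq> hchain" unfolding first_gap_def hchain_cases using angle_a_range by auto

text \<open>A common point of \<open>X\<close> and its conjugate is real, and 1 is the only real
  point of the half chain.\<close>

lemma is_arc_double:
  assumes "monotone_arc X 1 w" "X \<subseteq> hchain"
  shows "is_arc (X \<union> cnj ` X) (cnj w) w"
proof -
  have "is_arc X 1 w" using assms by (simp add: monotone_arc_def)
  then have "is_arc (cnj ` X) (cnj w) 1" using is_arc_sym[OF is_arc_isometry[OF isometry_cnj]] by fastforce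
  moreover have "cnj ` X \<inter> X \<subseteq> {1}"
  proof
    fix x assume "x \<in> cnj ` X \<inter> X"
    then obtain y where y: "y \<in> hchain" "x = cnj y" "x \<in> hchain" using assms by auto
    then have "Im x = 0" using hchain_wedge(1)[of y] hchain_wedge(1)[of x] by simp
    then show "x \<in> {1}" using hchain_wedge(3) y by simp
  qed
  ultimately show ?thesis using is_arc_join[of "cnj ` X" "cnj w" 1 X w] \<open>is_arc X 1 w\<close> by (simp add: Un_commute)
qed

lemma is_arc_pocket_at: "t < 8 \<Longrightarrow> is_arc (pocket_at t) (port ((t + 7) mod 8)) (port t)"
proof -
  assume t: "t < 8"
  have "is_arc (pocket_at t) (rot t (cnj (4 * u0))) (rot t (4 * u0))"
    unfolding pocket_at_def pocket_def by (intro is_arc_isometry[OF isometry_rot] is_arc_double monotone_arc_hchain) simp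
  moreover have "rot t (cnj (4 * u0)) = port ((t + 7) mod 8)" "rot t (4 * u0) = port t"
  proof -
    have "rot t (cnj (4 * u0)) = 4 * rot t (cnj u0)" "rot t (4 * u0) = 4 * rot t u0" by (simp_all add: rot_def)
    then show "rot t (cnj (4 * u0)) = port ((t + 7) mod 8)" "rot t (4 * u0) = port t"
      by (simp_all add: port_def rot_u0 rot_cnj_u0[OF t])
  qed
  ultimately show ?thesis by simp
qed

lemma is_arc_strand: "0 < \<theta> \<Longrightarrow> \<theta> < pi \<Longrightarrow> is_arc (strand \<theta>) (4 * cis \<theta>) (mirror (4 * cis \<theta>))"
proof -
  assume t: "0 < \<theta>" "\<theta> < pi"
  have "inj_on (strand_point \<theta>) {-\<theta>..\<theta>}" by (rule inj_onI) (rule strand_point_inj[OF t], auto)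
  then have "is_arc (strand \<theta>) (strand_point \<theta> (-\<theta>)) (strand_point \<theta> \<theta>)" unfolding strand_def using t by (intro is_arc_param strand_point_cont) auto
  then show ?thesis using is_arc_sym strand_point_start[OF t] mirror_strand_point[of \<theta> \<theta>] by metis
qed

lemma is_arc_strand_at: "j < 8 \<Longrightarrow> is_arc (strand_at j) (port j) (mirror (port j))"
proof (cases "j < 4")
  case True then show ?thesis unfolding strand_at_def port_def using is_arc_strand[OF ang_range[OF True]] by simp
next
  case False
  assume "j < 8"
  then have i: "7 - j < 4" using False by simp
  have "cnj (4 * cis (ang (7 - j))) = port j" using cis_ang_cnj[OF \<open>j < 8\<close>] by (simp add: port_def)
  moreover have "is_arc (cnj ` strand (ang (7 - j))) (cnj (4 * cis (ang (7 - j)))) (mirror (cnj (4 * cis (ang (7 - j)))))"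
    unfolding mirror_cnj by (rule is_arc_isometry[OF isometry_cnj is_arc_strand[OF ang_range[OF i]]])
  ultimately show ?thesis unfolding strand_at_def using False by simp
qed

section \<open>Combinatorics of the gluing\<close>

datatype edge = PocketP nat | Strand nat | PocketQ nat
datatype vert = PortP nat | PortQ nat

fun edge_set :: "edge \<Rightarrow> complex set" where
  "edge_set (PocketP t) = pocket_at t" | "edge_set (Strand j) = strand_at j" | "edge_set (PocketQ t) = mirror ` pocket_at t"
fun vertex_pos :: "vert \<Rightarrow> complex" where "vertex_pos (PortP j) = port j" | "vertex_pos (PortQ j) = mirror (port j)"
fun edge_ends :: "edge \<Rightarrow> vert set" where
  "edge_ends (PocketP t) = {PortP ((t + 7) mod 8), PortP t}" | "edge_ends (Strand j) = {PortP j, PortQ j}" | "edge_ends (PocketQ t) = {PortQ ((t + 7) mod 8), PortQ t}"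
definition edge_family :: "nat \<Rightarrow> nat \<Rightarrow> edge set" where
  "edge_family par par' = PocketP ` parity par \<union> Strand ` {..<8} \<union> PocketQ ` parity par'"

lemma curve_edge_family: "curve par par' = (\<Union>e\<in>edge_family par par'. edge_set e)"
  unfolding curve_def edge_family_def by (simp add: UN_Un image_UN)

text \<open>A pocket lies in an open sector of half-angle \<open>pi / 4\<close>. Pockets of equal
  parity are rotated against each other by multiples of \<open>pi / 2\<close>, so their sectors are
  disjoint.\<close>

lemma pocket_at_disjoint:
  assumes "t < 8" "t' < 8" "t mod 2 = t' mod 2" "t \<noteq> t'"
  shows "pocket_at t \<inter> pocket_at t' = {}"
proof -
  have sec: "\<bar>Im y\<bar> < Re y" if yP: "y \<in> pocket" for y
  proof -
    obtain x where x: "x \<in> hchain" "y = x \<or> y = cnj x" using yP unfolding pocket_def by auto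
    then have "\<bar>Im y\<bar> = Im x" "Re y = Re x" using hchain_wedge(1)[OF x(1)] by auto
    then show ?thesis using hchain_wedge(2)[OF x(1)] by simp
  qed
  have lt: "pocket_at s \<inter> pocket_at s' = {}" if s: "s < s'" "s' < 8" "s mod 2 = s' mod 2" for s s'
  proof (rule ccontr)
    assume "pocket_at s \<inter> pocket_at s' \<noteq> {}"
    then obtain y y' where y: "y \<in> pocket" "y' \<in> pocket" "rot s y = rot s' y'" unfolding pocket_at_def by auto
    have "rot s' y' = rot s (rot (s' - s) y')" unfolding rot_comp using s by simp
    then have e: "y = rot (s' - s) y'" using y(3) isometry_inj[OF isometry_rot] by (metis injD)
    have "even (s' - s)" using s by presburger
    moreover have "0 < s' - s" "s' - s < 8" using s by auto
    moreover have "d = 2 \<or> d = 4 \<or> d = 6" if "even d" "0 < d" "d < 8" for d :: nat using that by presburger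
    ultimately have "s' - s \<in> {2, 4, 6}" by blast
    then show False using e sec[OF y(1)] sec[OF y(2)] by (auto simp: rot_even)
  qed
  show ?thesis using lt[of t t'] lt[of t' t] assms by (metis Int_commute linorder_neqE_nat)
qed

lemma pocket_at_strand_at:
  assumes "t < 8" "j < 8" "x \<in> pocket_at t" "x \<in> strand_at j"
  shows "x = port j" "j = t \<or> j = (t + 7) mod 8"
proof -
  have n: "norm x = 4" using pocket_at_norm[OF assms(3)] strand_at_norm(1)[OF assms(2,4)] by simp
  show x: "x = port j" using strand_at_norm(2)[OF assms(2,4) n] .
  have "port j = port t \<or> port j = port ((t + 7) mod 8)" using pocket_at_norm4[OF assms(1,3) n] x by auto
  then show "j = t \<or> j = (t + 7) mod 8" using cis_ang_inj[OF assms(2)] assms(1) by (auto simp: port_def)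
qed

lemma inter_edge_ends:
  assumes e: "e \<in> edge_family par par'" "e' \<in> edge_family par par'" "e \<noteq> e'"
  shows "edge_set e \<inter> edge_set e' \<subseteq> vertex_pos ` (edge_ends e \<inter> edge_ends e')"
proof -
  have PS: "edge_set (PocketP t) \<inter> edge_set (Strand j) \<subseteq> vertex_pos ` (edge_ends (PocketP t) \<inter> edge_ends (Strand j))" if "t < 8" "j < 8" for t j
  proof
    fix x assume "x \<in> edge_set (PocketP t) \<inter> edge_set (Strand j)"
    then have "x = port j" "j = t \<or> j = (t + 7) mod 8" using pocket_at_strand_at[OF that, of x] by auto
    then show "x \<in> vertex_pos ` (edge_ends (PocketP t) \<inter> edge_ends (Strand j))" by (intro image_eqI[of _ _ "PortP j"]) auto
  qed
  have QS: "edge_set (PocketQ t) \<inter> edge_set (Strand j) \<subseteq> vertex_pos ` (edge_ends (PocketQ t) \<inter> edge_ends (Strand j))" if "t < 8" "j < 8" for t j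
  proof
    fix x assume "x \<in> edge_set (PocketQ t) \<inter> edge_set (Strand j)"
    then obtain y where y: "y \<in> pocket_at t" "x = mirror y" "x \<in> strand_at j" by auto
    then have "y \<in> strand_at j" using mirror_strand_at[of j] by (metis image_eqI mirror_mirror)
    then have "y = port j" "j = t \<or> j = (t + 7) mod 8" using pocket_at_strand_at[OF that y(1)] by auto
    then show "x \<in> vertex_pos ` (edge_ends (PocketQ t) \<inter> edge_ends (Strand j))" using y by (intro image_eqI[of _ _ "PortQ j"]) auto
  qed
  have PQ: "edge_set (PocketP t) \<inter> edge_set (PocketQ t') = {}" for t t' using pocket_at_norm mirror_far by (force simp: disjoint_iff)
  have T: "t \<in> parity p \<Longrightarrow> t < 8" "t \<in> parity p \<Longrightarrow> t mod 2 = p" for t p by (auto simp: parity_def)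
  have PP: "edge_set (PocketP t) \<inter> edge_set (PocketP t') = {}" if "t \<in> parity p" "t' \<in> parity p" "t \<noteq> t'" for t t' p
    using pocket_at_disjoint[of t t'] that T by simp
  have QQ: "edge_set (PocketQ t) \<inter> edge_set (PocketQ t') = {}" if "t \<in> parity p" "t' \<in> parity p" "t \<noteq> t'" for t t' p
    using PP[OF that] isometry_inj[OF isometry_mirror] by (simp add: image_Int[symmetric])
  have SS: "edge_set (Strand i) \<inter> edge_set (Strand j) = {}" if "i < 8" "j < 8" "i \<noteq> j" for i j
    using strand_at_disjoint[OF that] by simp
  have dj: "edge_ends e \<inter> edge_ends e' = edge_ends e' \<inter> edge_ends e" "edge_set e \<inter> edge_set e' = edge_set e' \<inter> edge_set e" by auto
  show ?thesis
  proof (cases e)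
    case (PocketP t)
    show ?thesis
    proof (cases e')
      case (PocketP t') then show ?thesis using \<open>e = PocketP t\<close> e PP[of t par t'] unfolding edge_family_def by auto
    next
      case (Strand j) then show ?thesis using \<open>e = PocketP t\<close> e PS[of t j] T unfolding edge_family_def by auto
    next
      case (PocketQ t') then show ?thesis using \<open>e = PocketP t\<close> PQ[of t t'] by simp
    qed
  next
    case (Strand i)
    show ?thesis
    proof (cases e')
      case (PocketP t') then show ?thesis unfolding dj using \<open>e = Strand i\<close> e PS[of t' i] T unfolding edge_family_def by auto
    next
      case (Strand j) then show ?thesis using \<open>e = Strand i\<close> e SS[of i j] unfolding edge_family_def by auto
    next
      case (PocketQ t') then show ?thesis unfolding dj using \<open>e = Strand i\<close> e QS[of t' i] T unfolding edge_family_def by auto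
    qed
  next
    case (PocketQ t)
    show ?thesis
    proof (cases e')
      case (PocketP t') then show ?thesis unfolding dj using \<open>e = PocketQ t\<close> PQ[of t' t] by simp
    next
      case (Strand j) then show ?thesis using \<open>e = PocketQ t\<close> e QS[of t j] T unfolding edge_family_def by auto
    next
      case (PocketQ t') then show ?thesis using \<open>e = PocketQ t\<close> e QQ[of t par' t'] unfolding edge_family_def by auto
    qed
  qed
qed

lemma edge_arc:
  assumes "e \<in> edge_family par par'" "edge_ends e = {v, w}" "v \<noteq> w"
  shows "is_arc (edge_set e) (vertex_pos v) (vertex_pos w)"
proof -
  have "\<exists>v w. edge_ends e = {v, w} \<and> is_arc (edge_set e) (vertex_pos v) (vertex_pos w)"
    using assms(1) is_arc_pocket_at is_arc_strand_at is_arc_isometry[OF isometry_mirror is_arc_pocket_at] unfolding edge_family_def parity_def by fastforce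
  then obtain v' w' where h: "edge_ends e = {v', w'}" "is_arc (edge_set e) (vertex_pos v') (vertex_pos w')" by blast
  then have "(v' = v \<and> w' = w) \<or> (v' = w \<and> w' = v)" using assms by (metis doubleton_eq_iff)
  then show ?thesis using h is_arc_sym by blast
qed

text \<open>Whether a union of pieces is a simple arc becomes a computation on lists: by
  \<open>inter_edge_ends\<close> pieces meet only in shared end vertices, so a path without repeated
  vertices or edges is enough.\<close>

fun edge_path :: "vert \<Rightarrow> (edge \<times> vert) list \<Rightarrow> bool" where
  "edge_path v [] = True"
| "edge_path v ((e, w) # l) = (edge_ends e = {v, w} \<and> v \<noteq> w \<and> v \<notin> snd ` set l \<and> e \<notin> fst ` set l \<and> edge_path w l)"

fun path_end :: "vert \<Rightarrow> (edge \<times> vert) list \<Rightarrow> vert" where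
  "path_end v [] = v" | "path_end v ((e, w) # l) = path_end w l"

lemma edge_path_edge_ends: "edge_path v l \<Longrightarrow> e \<in> fst ` set l \<Longrightarrow> edge_ends e \<subseteq> insert v (snd ` set l)"
  by (induction v l rule: edge_path.induct) auto

lemma chain_arc:
  assumes "edge_path v l" "l \<noteq> []" "fst ` set l \<subseteq> edge_family par par'"
  shows "is_arc (\<Union>e\<in>fst ` set l. edge_set e) (vertex_pos v) (vertex_pos (path_end v l))"
  using assms
proof (induction v l rule: edge_path.induct)
  case (2 v e w l)
  have a: "is_arc (edge_set e) (vertex_pos v) (vertex_pos w)" using 2 edge_arc[of e par par' v w] by simp
  show ?case
  proof (cases "l = []")
    case True then show ?thesis using a by simp
  next
    case False
    then have b: "is_arc (\<Union>e\<in>fst ` set l. edge_set e) (vertex_pos w) (vertex_pos (path_end w l))" using 2 by simp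
    have "edge_set e \<inter> edge_set e' \<subseteq> {vertex_pos w}" if e': "e' \<in> fst ` set l" for e'
    proof -
      have "edge_set e \<inter> edge_set e' \<subseteq> vertex_pos ` (edge_ends e \<inter> edge_ends e')" using 2(2-4) e' by (intro inter_edge_ends[of _ par par']) auto
      moreover have "edge_ends e' \<subseteq> insert w (snd ` set l)" using edge_path_edge_ends[of w l e'] 2 e' by simp
      then have "edge_ends e \<inter> edge_ends e' \<subseteq> {w}" using 2 by auto
      ultimately show ?thesis by blast
    qed
    then have "edge_set e \<inter> (\<Union>e\<in>fst ` set l. edge_set e) \<subseteq> {vertex_pos w}" by blast
    then show ?thesis using is_arc_join[OF a b] by simp
  qed
qed simp

text \<open>A simple closed path is homeomorphic to the circle in the complex plane, while
  \<open>closed_curve\<close> asks for the unit circle of \<open>real^2\<close>; the two circles are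
  homeomorphic.\<close>

lemma closed_curve_loop:
  assumes F: "isometry F" and X: "is_arc X v w" "is_arc Y w v" "X \<inter> Y \<subseteq> {v, w}"
  shows "closed_curve (F ` (X \<union> Y))" "connected (F ` (X \<union> Y))"
proof -
  obtain g where g: "arc g" "path_image g = X" "pathstart g = v" "pathfinish g = w" using X unfolding is_arc_def by blast
  obtain k where k: "arc k" "path_image k = Y" "pathstart k = w" "pathfinish k = v" using X unfolding is_arc_def by blast
  have s: "simple_path (g +++ k)" using g k X(3) by (intro simple_path_join_loop) auto
  have im: "path_image (g +++ k) = X \<union> Y" using g k by (simp add: path_image_join)
  define c where "c = F \<circ> (g +++ k)"
  have "simple_path c" unfolding c_def using s isometry_continuous[OF F] isometry_inj[OF F]
    by (intro simple_path_continuous_image) (auto intro: inj_on_subset)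
  moreover have "pathfinish c = pathstart c" unfolding c_def using g k by (simp add: pathfinish_compose pathstart_compose)
  ultimately have "path_image c homeomorphic sphere (0::complex) 1"
    by (intro homeomorphic_simple_path_image_circle) auto
  moreover have "sphere (0::complex) 1 homeomorphic sphere (0::real^2) 1"
    by (intro homeomorphic_spheres_gen) auto
  ultimately have "sphere (0::real^2) 1 homeomorphic path_image c"
    using homeomorphic_trans homeomorphic_sym by blast
  then obtain f f' where "homeomorphism (sphere (0::real^2) 1) (path_image c) f f'" unfolding homeomorphic_def by blast
  then have f: "continuous_on (sphere 0 1) f" "path_image c = f ` sphere 0 1" "inj_on f (sphere 0 1)"
    unfolding homeomorphism_def by (auto intro: inj_on_inverseI)
  have ic: "path_image c = F ` (X \<union> Y)" unfolding c_def path_image_compose im ..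
  show "closed_curve (F ` (X \<union> Y))" unfolding closed_curve_def ic[symmetric] using f by blast
  show "connected (F ` (X \<union> Y))" unfolding ic[symmetric]
    using \<open>simple_path c\<close> simple_path_imp_path connected_path_image by blast
qed

lemma cycle_curve:
  assumes F: "isometry F" and l: "edge_path v l" "l \<noteq> []" "fst ` set l \<subseteq> edge_family par par'"
    and e: "e \<in> edge_family par par'" "e \<notin> fst ` set l" "edge_ends e = {path_end v l, v}" "path_end v l \<noteq> v"
  shows "closed_curve (F ` (\<Union>e\<in>insert e (fst ` set l). edge_set e))" "connected (F ` (\<Union>e\<in>insert e (fst ` set l). edge_set e))"
proof -
  have "edge_set e' \<inter> edge_set e \<subseteq> {vertex_pos v, vertex_pos (path_end v l)}" if "e' \<in> fst ` set l" for e'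
    using inter_edge_ends[of e' par par' e] e l that by (auto simp: subset_eq)
  then have i: "(\<Union>e\<in>fst ` set l. edge_set e) \<inter> edge_set e \<subseteq> {vertex_pos v, vertex_pos (path_end v l)}" by blast
  have u: "(\<Union>e\<in>insert e (fst ` set l). edge_set e) = (\<Union>e\<in>fst ` set l. edge_set e) \<union> edge_set e" by auto
  note r = closed_curve_loop[OF F chain_arc[OF l] edge_arc[OF e(1,3,4)] i]
  show "closed_curve (F ` (\<Union>e\<in>insert e (fst ` set l). edge_set e))" "connected (F ` (\<Union>e\<in>insert e (fst ` set l). edge_set e))"
    unfolding u using r by auto
qed

section \<open>Connected and disconnected gluings\<close>

lemma CC01_curve:
  assumes F: "isometry F"
  shows "closed_curve (F ` curve 0 1)" "connected (F ` curve 0 1)"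
proof -
  \<comment> \<open>Even pockets on one side pair the ports 7-0, 1-2, 3-4, 5-6, odd pockets on the
    other pair 0-1, 2-3, 4-5, 6-7. Alternating them runs through all eight strands, the last of
    which, \<open>Strand 7\<close>, closes the cycle.\<close>
  define l where "l = [(PocketP 0, PortP 0), (Strand 0, PortQ 0), (PocketQ 1, PortQ 1), (Strand 1, PortP 1),
    (PocketP 2, PortP 2), (Strand 2, PortQ 2), (PocketQ 3, PortQ 3), (Strand 3, PortP 3),
    (PocketP 4, PortP 4), (Strand 4, PortQ 4), (PocketQ 5, PortQ 5), (Strand 5, PortP 5),
    (PocketP 6, PortP 6), (Strand 6, PortQ 6), (PocketQ 7, PortQ 7)]"
  have e8: "{..<8::nat} = {0, 1, 2, 3, 4, 5, 6, 7}" by auto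
  have path: "edge_path (PortP 7) l" unfolding l_def by (simp add: insert_commute)
  have fm: "insert (Strand 7) (fst ` set l) = edge_family 0 1" unfolding edge_family_def parity_eq e8 l_def by auto
  have "closed_curve (F ` (\<Union>e\<in>insert (Strand 7) (fst ` set l). edge_set e)) \<and> connected (F ` (\<Union>e\<in>insert (Strand 7) (fst ` set l). edge_set e))"
    using fm by (intro conjI cycle_curve[OF F path, where par=0 and par'=1]) (auto simp: l_def)
  then show "closed_curve (F ` curve 0 1)" "connected (F ` curve 0 1)" unfolding fm curve_edge_family by auto
qed

text \<open>With equal parities a pocket and its mirror image have the same two ports, so the cycle
  closes after two strands.\<close>

definition loop_at :: "nat \<Rightarrow> complex set" where
  "loop_at t = pocket_at t \<union> strand_at t \<union> mirror ` pocket_at t \<union> strand_at ((t + 7) mod 8)"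

lemma loop_at_curve:
  assumes F: "isometry F" and t: "t < 8"
  shows "closed_curve (F ` loop_at t)"
proof -
  define s where "s = (t + 7) mod 8"
  have st: "s \<noteq> t" "s < 8" using t by (auto simp: s_def mod_if split: if_splits)
  define l where "l = [(PocketP t, PortP t), (Strand t, PortQ t), (PocketQ t, PortQ s)]"
  have tt: "t \<in> parity (t mod 2)" using t by (simp add: parity_def)
  have path: "edge_path (PortP s) l" using st unfolding l_def s_def by auto
  have "closed_curve (F ` (\<Union>e\<in>insert (Strand s) (fst ` set l). edge_set e))"
    using st tt t by (intro cycle_curve(1)[OF F path, where par="t mod 2" and par'="t mod 2"]) (auto simp: l_def edge_family_def)
  moreover have "(\<Union>e\<in>insert (Strand s) (fst ` set l). edge_set e) = loop_at t" by (auto simp: l_def loop_at_def s_def)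
  ultimately show ?thesis by simp
qed

lemma curve_loop_at: "par < 2 \<Longrightarrow> curve par par = (\<Union>t\<in>parity par. loop_at t)"
proof -
  assume "par < 2"
  then consider "par = 0" | "par = 1" by linarith
  moreover have e8: "{..<8::nat} = {0, 1, 2, 3, 4, 5, 6, 7}" by auto
  ultimately show ?thesis unfolding curve_def loop_at_def e8 by cases (auto simp: parity_eq parity_eq(2)[unfolded One_nat_def])
qed

text \<open>A loop uses the ports \<open>t\<close> and its predecessor. For distinct
  \<open>t\<close> of equal parity these pairs are disjoint, as the predecessors are distinct and
  have the opposite parity.\<close>

lemma loop_at_disjoint:
  assumes "t \<in> parity par" "t' \<in> parity par" "t \<noteq> t'"
  shows "loop_at t \<inter> loop_at t' = {}"
proof -
  define s s' where "s = (t + 7) mod 8" and "s' = (t' + 7) mod 8"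
  have T: "t < 8" "t' < 8" "t mod 2 = par" "t' mod 2 = par" using assms by (auto simp: parity_def)
  have st: "s < 8" "s' < 8" by (auto simp: s_def s'_def)
  have m2: "(k + 7) mod 8 mod 2 = (k + 7) mod 2" for k :: nat by (simp add: mod_mod_cancel)
  have odd: "(k + 7) mod 2 \<noteq> k mod 2" for k :: nat by (simp add: mod2_eq_if)
  have p: "s mod 2 \<noteq> t mod 2" "s' mod 2 \<noteq> t' mod 2" unfolding s_def s'_def m2 by (rule odd)+
  have "(s + 1) mod 8 = t" "(s' + 1) mod 8 = t'" unfolding s_def s'_def using T by (simp_all add: mod_Suc_eq)
  then have "s \<noteq> s'" using assms(3) by auto
  then have ne: "s \<noteq> t'" "s \<noteq> s'" "t \<noteq> s'" using p T by auto
  define A where "A = {PocketP t, Strand t, PocketQ t, Strand s}"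
  define B where "B = {PocketP t', Strand t', PocketQ t', Strand s'}"
  have AB: "A \<subseteq> edge_family par par" "B \<subseteq> edge_family par par" using assms st T unfolding A_def B_def edge_family_def by auto
  have "edge_set a \<inter> edge_set b = {}" if ab: "a \<in> A" "b \<in> B" for a b
  proof -
    have "a \<noteq> b" "edge_ends a \<inter> edge_ends b = {}" using ab ne assms(3) unfolding A_def B_def s_def[symmetric] s'_def[symmetric]
      by (auto simp: s_def[symmetric] s'_def[symmetric])
    then show ?thesis using inter_edge_ends[of a par par b] ab AB by auto
  qed
  moreover have "loop_at t = (\<Union>a\<in>A. edge_set a)" "loop_at t' = (\<Union>b\<in>B. edge_set b)"
    by (auto simp: loop_at_def A_def B_def s_def s'_def)
  ultimately show ?thesis by blast
qed

lemma pocket_at_nonempty: "pocket_at t \<noteq> {}" unfolding pocket_at_def pocket_def using hchain_mem by auto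

lemma loop_at_compact: "compact (loop_at t)" unfolding loop_at_def
  by (intro compact_Un pocket_at_compact strand_at_compact isometry_compact[OF isometry_mirror])

lemma curve_diag:
  assumes F: "isometry F" and par: "par < 2"
  shows "curve_union (F ` curve par par)" "\<not> connected (F ` curve par par)"
proof -
  have U: "F ` curve par par = \<Union> ((\<lambda>t. F ` loop_at t) ` parity par)" unfolding curve_loop_at[OF par] by auto
  have dj: "F ` loop_at t \<inter> F ` loop_at t' = {}" if "t \<in> parity par" "t' \<in> parity par" "t \<noteq> t'" for t t'
    using loop_at_disjoint[OF that] isometry_inj[OF F] by (simp add: image_Int[symmetric])
  show "curve_union (F ` curve par par)" unfolding curve_union_def
  proof (intro exI conjI)
    show "F ` curve par par = \<Union> ((\<lambda>t. F ` loop_at t) ` parity par)" by (rule U)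
    show "finite ((\<lambda>t. F ` loop_at t) ` parity par)" by (simp add: parity_def)
    show "\<forall>K\<in>(\<lambda>t. F ` loop_at t) ` parity par. closed_curve K" using loop_at_curve[OF F] by (auto simp: parity_def)
    show "pairwise disjnt ((\<lambda>t. F ` loop_at t) ` parity par)" using dj by (auto simp: pairwise_def disjnt_def)
  qed
  obtain t t' where t: "t \<in> parity par" "t' \<in> parity par" "t \<noteq> t'"
  proof -
    consider "par = 0" | "par = 1" using par by linarith
    then show ?thesis using that[of 0 2] that[of 1 3] by cases (auto simp: parity_eq parity_eq(2)[unfolded One_nat_def])
  qed
  define A where "A = F ` loop_at t"
  define B where "B = (\<Union>s\<in>parity par - {t}. F ` loop_at s)"
  have "closed A" "closed B" unfolding A_def B_def
    by (auto intro!: compact_imp_closed closed_UN isometry_compact[OF F] loop_at_compact simp: parity_def)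
  moreover have "A \<inter> B = {}" unfolding A_def B_def using dj t by auto
  moreover have "F ` curve par par = A \<union> B" unfolding U A_def B_def using t by auto
  moreover have "A \<noteq> {}" "B \<noteq> {}" unfolding A_def B_def using t pocket_at_nonempty by (auto simp: loop_at_def)
  ultimately show "\<not> connected (F ` curve par par)" unfolding connected_closed by (metis Int_commute Un_upper1 inf.absorb_iff2 inf_bot_right inf_sup_ord(3) inf_sup_ord(4) order_refl)
qed

section \<open>Sampling and sample graphs\<close>

definition first_sample :: "nat \<Rightarrow> complex" where "first_sample j = of_real radius_a * cis (ang j)"
text \<open>The radius 4 adds the ports, so that a pocket meets the rest of the curve in samples
  only; \<open>edge_absent\<close> rests on this.\<close>

definition gsamples :: "complex set" where "gsamples = (\<lambda>(h, j). of_real h * cis (ang j)) ` ({radius_a, radius_b, radius_e, 4} \<times> {..<8})"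

lemma gsamples_finite: "finite gsamples" unfolding gsamples_def by simp
lemma gsamples_I: "h \<in> {radius_a, radius_b, radius_e, 4} \<Longrightarrow> j < 8 \<Longrightarrow> of_real h * cis (ang j) \<in> gsamples" unfolding gsamples_def by force
lemma gsamples_norm: "x \<in> gsamples \<Longrightarrow> norm x \<le> 4"
  unfolding gsamples_def using radius_a_pos radius_b_pos radius_e_gt radius_e_lt by (auto simp: norm_mult)

lemma rot_scaled: "rot t (of_real h * u0) = of_real h * cis (ang t)"
  "t < 8 \<Longrightarrow> rot t (cnj (of_real h * u0)) = of_real h * cis (ang ((t + 7) mod 8))"
proof -
  have "rot t (of_real h * u0) = of_real h * rot t u0" "rot t (cnj (of_real h * u0)) = of_real h * rot t (cnj u0)"
    by (simp_all add: rot_def)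
  then show "rot t (of_real h * u0) = of_real h * cis (ang t)"
    "t < 8 \<Longrightarrow> rot t (cnj (of_real h * u0)) = of_real h * cis (ang ((t + 7) mod 8))"
    by (simp_all add: rot_u0 rot_cnj_u0)
qed

text \<open>Strand line \<open>j\<close> bounds pocket \<open>j\<close> and pocket
  \<open>j + 1\<close> (mod 8), one of which has parity \<open>par\<close>. The points at the given
  radii belong to both pockets, being fixed by the reflection in that line.\<close>

lemma gsamples_pocket_at:
  assumes "par < 2" "x \<in> gsamples" shows "x \<in> (\<Union>t\<in>parity par. pocket_at t)"
proof -
  obtain h j where h: "h \<in> {radius_a, radius_b, radius_e, 4}" "j < 8" "x = of_real h * cis (ang j)" using assms unfolding gsamples_def by auto
  have hchain: "of_real h * u0 \<in> hchain" using h(1) hchain_mem sample_a_eq sample_b_eq sample_e_eq by auto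
  show ?thesis
  proof (cases "j mod 2 = par")
    case True
    have "x = rot j (of_real h * u0)" using rot_scaled h by simp
    then have "x \<in> pocket_at j" using hchain unfolding pocket_at_def pocket_def by blast
    then show ?thesis using True h by (auto simp: parity_def)
  next
    case False
    define t where "t = (j + 1) mod 8"
    have "\<forall>j<8. j mod 2 \<noteq> par \<longrightarrow> (j + 1) mod 8 mod 2 = par \<and> ((j + 1) mod 8 + 7) mod 8 = j"
      unfolding less8 using assms(1) by auto
    then have t: "t < 8" "t mod 2 = par" "(t + 7) mod 8 = j" using False h unfolding t_def by auto
    have "x = rot t (cnj (of_real h * u0))" using rot_scaled(2)[OF t(1)] t h by simp
    then have "x \<in> pocket_at t" using hchain unfolding pocket_at_def pocket_def by blast
    then show ?thesis using t by (auto simp: parity_def)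
  qed
qed

lemma mirror_common_part: "mirror ` common_part = common_part"
  unfolding common_part_def image_Un image_UN mirror_strand_at by (auto simp: image_image)

lemma common_part_curve: "par < 2 \<Longrightarrow> par' < 2 \<Longrightarrow> common_part \<subseteq> curve par par'"
  unfolding common_part_def curve_def pocket_at_union by auto

lemma medial_ne: 
  assumes F: "isometry F" and p: "par < 2" shows "medial_axis (F ` curve par par') \<noteq> {}"
proof -
  have "F ` curve par par' \<inter> ball ((F \<circ> rot par) 0) 4 = (F \<circ> rot par) ` gadget \<inter> ball ((F \<circ> rot par) 0) 4"
    using curve_ball(1)[OF F, of par par par'] p by simp
  then show ?thesis using medial_center[OF isometry_comp[OF F isometry_rot[of par]]] by blast
qed

text \<open>The local feature size is continuous and attains its minimum on the compact common part,
  where \<open>common_part_free\<close> makes it positive.\<close>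

lemma lfs_common_part:
  assumes F: "isometry F" and p: "par < 2" "par' < 2"
  shows "\<exists>\<mu>>0. \<forall>z\<in>common_part. \<mu> \<le> lfs (F ` curve par par') (F z)"
proof -
  have c: "compact (F ` common_part)" using isometry_compact[OF F common_part_compact] .
  have "port 0 \<in> (\<Union>j<8. strand_at j)" using port_strand_at[of 0] by (intro UN_I[of 0]) auto
  then have ne: "F ` common_part \<noteq> {}" unfolding common_part_def by blast
  have "continuous_on (F ` common_part) (lfs (F ` curve par par'))" unfolding lfs_def by (intro continuous_intros)
  then obtain x where x: "x \<in> F ` common_part" "\<forall>y\<in>F ` common_part. lfs (F ` curve par par') x \<le> lfs (F ` curve par par') y"
    using continuous_attains_inf[OF c ne] by blast
  obtain z where z: "z \<in> common_part" "x = F z" using x by auto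
  obtain \<epsilon> where e: "\<epsilon> > 0" "ball (F z) \<epsilon> \<inter> medial_axis (F ` curve par par') = {}" using common_part_free[OF F p z(1)] by blast
  have "\<epsilon> - dist (F z) (F z) \<le> lfs (F ` curve par par') (F z)"
    unfolding lfs_def by (rule infdist_ball_free[OF e(2) medial_ne[OF F p(1)]])
  then show ?thesis using e x z by (intro exI[of _ "lfs (F ` curve par par') x"]) auto
qed

lemma pocket_at_eps:
  assumes F: "isometry F" and p: "par < 2" "par' < 2" and t: "t \<in> parity par" and z: "z \<in> pocket_at t" "z \<notin> common_part"
  shows "\<exists>s\<in>gsamples. dist (F z) (F s) < 0.72 * lfs (F ` curve par par') (F z)"
proof -
  have t8: "t < 8" "t mod 2 = par" using t by (auto simp: parity_def)
  have in_gsamples: "rot t s \<in> gsamples" "rot t (cnj s) \<in> gsamples" if sS: "s \<in> {sample_a, sample_b, sample_e}" for s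
  proof -
    obtain h where h: "h \<in> {radius_a, radius_b, radius_e}" "s = of_real h * u0" using sS sample_a_eq sample_b_eq sample_e_eq by auto
    show "rot t s \<in> gsamples" "rot t (cnj s) \<in> gsamples" unfolding h(2) using h(1) t8 rot_scaled(2)[OF t8(1)]
      by (auto simp: rot_scaled(1) intro!: gsamples_I)
  qed
  obtain y where y: "y \<in> hchain" "z = rot t y \<or> z = rot t (cnj y)" using z(1) unfolding pocket_at_def pocket_def by auto
  have nr: "y \<notin> closed_segment sample_e (4 * u0)"
  proof
    assume "y \<in> closed_segment sample_e (4 * u0)"
    then have "z \<in> ray t \<or> z \<in> ray ((t + 7) mod 8)" using y(2) rot_ray[of t] rot_cnj_ray[OF t8(1)] by blast
    then have "z \<in> common_part" unfolding common_part_def using t8 by (auto intro: bexI[of _ t] bexI[of _ "(t + 7) mod 8"])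
    then show False using z(2) by simp
  qed
  from y(2) show ?thesis
  proof
    assume zz: "z = rot t y"
    have "F ` curve par par' \<inter> ball ((F \<circ> rot t) 0) 4 = (F \<circ> rot t) ` gadget \<inter> ball ((F \<circ> rot t) 0) 4"
      using curve_ball(1)[OF F t8] by simp
    from gap_eps[OF isometry_comp[OF F isometry_rot] this y(1) nr]
    obtain s where "s \<in> {sample_a, sample_b, sample_e}" "dist (F (rot t y)) (F (rot t s)) < 0.72 * lfs (F ` curve par par') (F (rot t y))" by auto
    then show ?thesis using in_gsamples zz by blast
  next
    assume zz: "z = rot t (cnj y)"
    have "F ` curve par par' \<inter> ball ((F \<circ> rot t \<circ> cnj) 0) 4 = (F \<circ> rot t \<circ> cnj) ` gadget \<inter> ball ((F \<circ> rot t \<circ> cnj) 0) 4"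
      using curve_ball(2)[OF F t8] by simp
    from gap_eps[OF isometry_comp[OF isometry_comp[OF F isometry_rot] isometry_cnj] this y(1) nr]
    obtain s where "s \<in> {sample_a, sample_b, sample_e}" "dist (F (rot t (cnj y))) (F (rot t (cnj s))) < 0.72 * lfs (F ` curve par par') (F (rot t (cnj y)))" by auto
    then show ?thesis using in_gsamples zz by blast
  qed
qed

text \<open>At the second gadget the estimate for the first is applied to
  \<open>F \<circ> mirror\<close>, which interchanges the parities. The common part is left to the
  net \<open>N\<close>.\<close>

lemma eps_curve:
  assumes F: "isometry F" and p: "par < 2" "par' < 2"
    and S: "S = gsamples \<union> mirror ` gsamples \<union> N" "finite N" "N \<subseteq> common_part"
    and net: "\<And>z. z \<in> common_part \<Longrightarrow> \<exists>s\<in>N. dist z s < 0.72 * lfs (F ` curve par par') (F z)"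
  shows "eps_sample (F ` curve par par') (F ` S) 0.72"
proof -
  have fin: "finite S" using S gsamples_finite by simp
  have s1: "gsamples \<subseteq> (\<Union>t\<in>parity par. pocket_at t)" "gsamples \<subseteq> (\<Union>t\<in>parity par'. pocket_at t)" using gsamples_pocket_at[OF p(1)] gsamples_pocket_at[OF p(2)] by auto
  have "gsamples \<subseteq> curve par par'" using s1(1) unfolding curve_def by blast
  moreover have "mirror ` gsamples \<subseteq> curve par par'" using image_mono[OF s1(2), of mirror] unfolding curve_def by blast
  ultimately have sub: "S \<subseteq> curve par par'" using S(1,3) common_part_curve[OF p] by blast
  have "\<exists>s\<in>S. dist (F z) (F s) < 0.72 * lfs (F ` curve par par') (F z)" if z: "z \<in> curve par par'" for z
  proof (cases "z \<in> common_part")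
    case True
    then obtain s where "s \<in> N" "dist z s < 0.72 * lfs (F ` curve par par') (F z)" using net by blast
    then show ?thesis using S(1) isometry_dist[OF F] by (intro bexI[of _ s]) auto
  next
    case False
    then have "z \<notin> (\<Union>j<8. strand_at j)" unfolding common_part_def by blast
    then consider t where "t \<in> parity par" "z \<in> pocket_at t" | t w where "t \<in> parity par'" "w \<in> pocket_at t" "z = mirror w"
      using z unfolding curve_def by auto
    then show ?thesis
    proof cases
      case 1 then show ?thesis using pocket_at_eps[OF F p 1 False] S by blast
    next
      case 2
      have "w \<notin> common_part" using False 2(3) mirror_common_part by blast
      then obtain s where "s \<in> gsamples" "dist ((F \<circ> mirror) w) ((F \<circ> mirror) s) < 0.72 * lfs ((F \<circ> mirror) ` curve par' par) ((F \<circ> mirror) w)"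
        using pocket_at_eps[OF isometry_comp[OF F isometry_mirror] p(2,1) 2(1,2)] by blast
      then show ?thesis using 2(3) S unfolding image_comp[symmetric] mirror_curve by auto
    qed
  qed
  note near = this
  have "infdist x (F ` S) < 0.72 * lfs (F ` curve par par') x" if x: "x \<in> F ` curve par par'" for x
  proof -
    obtain z where z: "z \<in> curve par par'" "x = F z" using x by blast
    obtain s where s: "s \<in> S" "dist x (F s) < 0.72 * lfs (F ` curve par par') x" using near[OF z(1)] z(2) by blast
    have "infdist x (F ` S) \<le> dist x (F s)" using s(1) by (intro infdist_le imageI)
    then show ?thesis using s(2) by (rule le_less_trans)
  qed
  then show ?thesis unfolding eps_sample_def using fin sub by auto
qed

section \<open>Edges that reveal the parity\<close>

lemma ang_sector:
  assumes "j < 8" "0 < h" shows "\<not> \<bar>Im (of_real h * cis (ang j))\<bar> < tan8 * Re (of_real h * cis (ang j))"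
proof
  assume "\<bar>Im (of_real h * cis (ang j))\<bar> < tan8 * Re (of_real h * cis (ang j))"
  then have a: "h * \<bar>sin (ang j)\<bar> < h * (tan8 * cos (ang j))" using assms by (simp add: abs_mult algebra_simps)
  then have "\<bar>sin (ang j)\<bar> < tan8 * cos (ang j)" using assms by simp
  then have b: "0 < cos8 * (sin (ang j) + tan8 * cos (ang j))" "0 < cos8 * (tan8 * cos (ang j) - sin (ang j))" using cos8_pos by auto
  \<comment> \<open>Lying in the sector of half-angle \<open>pi / 8\<close> about the positive real
    axis makes \<open>sin (ang j + pi / 8)\<close> positive and \<open>sin (ang j - pi / 8)\<close>
    negative. Both arguments are multiples of \<open>pi / 4\<close>, and on each half of the range
    of \<open>j\<close> one of the signs fails.\<close>
  have e1: "sin (ang j + pi / 8) = cos8 * (sin (ang j) + tan8 * cos (ang j))"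
    unfolding sin_add cos8_def[symmetric] sin8_def[symmetric] sin8_eq by (simp add: algebra_simps)
  have e2: "sin (ang j - pi / 8) = - (cos8 * (tan8 * cos (ang j) - sin (ang j)))"
    unfolding sin_diff cos8_def[symmetric] sin8_def[symmetric] sin8_eq by (simp add: algebra_simps)
  have t: "ang j + pi / 8 = real (j + 1) * (pi / 4)" "ang j - pi / 8 = real j * (pi / 4)" by (simp_all add: ang_def field_simps)
  show False
  proof (cases "j \<le> 4")
    case True
    then have "real j * (pi / 4) \<le> 4 * (pi / 4)" by (intro mult_right_mono) auto
    then have "0 \<le> sin (real j * (pi / 4))" by (intro sin_ge_zero) auto
    then show False using b(2) e2 t by simp
  next
    case False
    have "4 * (pi / 4) \<le> real (j + 1) * (pi / 4)" using False by (intro mult_right_mono) auto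
    moreover have "real (j + 1) * (pi / 4) \<le> 8 * (pi / 4)" using assms(1) by (intro mult_right_mono) auto
    ultimately have "0 \<le> sin (real (j + 1) * (pi / 4) - pi)" by (intro sin_ge_zero) auto
    then have "sin (real (j + 1) * (pi / 4)) \<le> 0" by simp
    then show False using b(1) e1 t by simp
  qed
qed

lemma S_sector:
  assumes "x \<in> gsamples \<union> mirror ` gsamples \<union> common_part" shows "\<not> (\<bar>Im x\<bar> < tan8 * Re x \<and> norm x < 4)"
proof -
  have r: "\<not> \<bar>Im x\<bar> < tan8 * Re x" if xr: "x \<in> ray j" "j < 8" for x j
  proof -
    obtain s where s: "radius_e \<le> s" "x = of_real s * cis (ang j)" using xr(1) unfolding ray_iff by blast
    then show ?thesis using ang_sector[OF xr(2), of s] radius_e_gt by simp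
  qed
  consider "x \<in> gsamples" | y where "y \<in> gsamples" "x = mirror y" | j where "j < 8" "x \<in> ray j" | j where "j < 8" "x \<in> strand_at j"
    | j y where "y \<in> ray j" "x = mirror y" using assms unfolding common_part_def by auto
  then show ?thesis
  proof cases
    case 1
    then show ?thesis unfolding gsamples_def using ang_sector radius_a_pos radius_b_pos radius_e_gt by fastforce
  next
    case 2 then show ?thesis using mirror_far[of y] gsamples_norm[of y] by simp
  next
    case 3 then show ?thesis using r by blast
  next
    case 4 then show ?thesis using strand_at_norm(1) by force
  next
    case 5 then show ?thesis using mirror_far[of y] ray_norm(1)[of y j] by simp
  qed
qed

text \<open>Together with \<open>S_sector\<close> this shows that the stretch carries no sample
  before \<open>sample_a\<close>: it lies strictly between two neighbouring strand lines.\<close>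

lemma first_gap_sector: assumes "y \<in> first_gap" "y \<noteq> sample_a" shows "\<bar>Im y\<bar> < tan8 * Re y \<and> norm y < 4"
proof -
  have yh: "y \<in> hchain" using assms first_gap_hchain by blast
  have "Im y < tan8 * Re y" using assms(1) unfolding first_gap_def
  proof
    assume "y \<in> closed_segment 1 g1"
    then obtain s where s: "0 \<le> s" "s \<le> 1" "y = (1 - s) *\<^sub>R 1 + s *\<^sub>R g1" by (auto simp: closed_segment_def)
    then have "Re y = 1" "Im y = 0.04 * s" by (simp_all add: g1_def)
    then show ?thesis using s(1,2) tan8_bounds by simp
  next
    assume "y \<in> arc2 ` {0..angle_a}"
    then obtain \<phi> where p: "0 \<le> \<phi>" "\<phi> \<le> angle_a" "y = arc2 \<phi>" by auto
    then have lt: "\<phi> < angle_a" using assms(2) unfolding sample_a_def by (cases "\<phi> = angle_a") auto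
    \<comment> \<open>Being below the strand line compares
      \<open>sin \<phi> + tan8 * cos \<phi>\<close>, a multiple of
      \<open>sin (\<phi> + pi / 8)\<close>, with its value at the crossing. The sine is increasing
      as far as needed because \<open>angle_a + pi / 8\<close> is at most
      \<open>pi / 2\<close>.\<close>
    have "angle_a \<le> 3 * pi / 8"
    proof (rule ccontr)
      assume "\<not> angle_a \<le> 3 * pi / 8"
      then have "cos angle_a \<le> cos (3 * pi / 8)" using angle_a_range by (intro cos_monotone_0_pi_le) auto
      also have "cos (3 * pi / 8) = sin8" unfolding sin8_def by (simp add: cos_sin_eq field_simps)
      finally show False using angle_a_trig sin8_eq cos8_bounds tan8_bounds mult_strict_mono[of tan8 "0.5" cos8 1] by simp
    qed
    then have "sin (\<phi> + pi / 8) < sin (angle_a + pi / 8)" using p lt by (intro sin_monotone_2pi) auto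
    moreover have "sin (x + pi / 8) = cos8 * (sin x + tan8 * cos x)" for x
      unfolding sin_add cos8_def[symmetric] sin8_def[symmetric] sin8_eq by (simp add: algebra_simps)
    ultimately have "sin \<phi> + tan8 * cos \<phi> < sin angle_a + tan8 * cos angle_a" using cos8_pos by simp
    moreover have "0.705 * (sin angle_a + tan8 * cos angle_a) = tan8 * 1.705 - 0.04" using angle_a_prop(3) by (simp add: field_simps)
    ultimately have "0.705 * (sin \<phi> + tan8 * cos \<phi>) < tan8 * 1.705 - 0.04" by simp
    then show ?thesis unfolding p(3) arc2_parts by (simp add: field_simps)
  qed
  moreover have "norm y < 4"
  proof -
    have "y \<noteq> 4 * u0"
    proof
      assume "y = 4 * u0"
      then have "Im y = tan8 * Re y" by (simp add: sin8_eq)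
      then show False using calculation by simp
    qed
    then show ?thesis using hchain_wedge(4,5)[OF yh] by force
  qed
  ultimately show ?thesis using hchain_wedge(1)[OF yh] by simp
qed

lemma first_sample_eq: "first_sample 0 = sample_a" "first_sample 7 = cnj sample_a"
proof -
  show "first_sample 0 = sample_a" unfolding first_sample_def rot_scaled(1)[symmetric] rot_even(1) sample_a_eq ..
  have "rot 0 (cnj (of_real radius_a * u0)) = of_real radius_a * cis (ang 7)" using rot_scaled(2)[of 0 radius_a] by simp
  then show "first_sample 7 = cnj sample_a" unfolding first_sample_def sample_a_eq rot_even(1) by (rule sym)
qed

lemma first_sample_S: "j < 8 \<Longrightarrow> first_sample j \<in> gsamples" unfolding first_sample_def by (intro gsamples_I) auto

text \<open>The witness is the first gap together with its conjugate, an arc through 1 whose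
  interior stays in the sample-free sector.\<close>

lemma edge_present:
  assumes F: "isometry F" and S: "gsamples \<subseteq> S" "S \<subseteq> gsamples \<union> mirror ` gsamples \<union> common_part"
  shows "consecutive (F ` curve 0 par') (F ` S) (F (first_sample 7)) (F (first_sample 0))"
proof -
  define U where "U = first_gap \<union> cnj ` first_gap"
  have "is_arc U (cnj sample_a) sample_a" unfolding U_def by (rule is_arc_double[OF monotone_arc_first_gap first_gap_hchain])
  then have "is_arc (F ` U) (F (first_sample 7)) (F (first_sample 0))" unfolding first_sample_eq by (rule is_arc_isometry[OF F])
  then obtain g where g: "arc g" "path_image g = F ` U" "pathstart g = F (first_sample 7)" "pathfinish g = F (first_sample 0)"
    unfolding is_arc_def by blast
  have UC: "F ` U \<subseteq> F ` curve 0 par'"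
  proof -
    have "U \<subseteq> pocket_at 0" unfolding U_def pocket_at_def pocket_def using first_gap_hchain by (auto simp: rot_even)
    then show ?thesis unfolding curve_def parity_eq by auto
  qed
  have av: "g ` {0<..<1} \<inter> F ` S = {}"
  proof (rule ccontr)
    assume "g ` {0<..<1} \<inter> F ` S \<noteq> {}"
    then obtain t s where t: "t \<in> {0<..<1}" "s \<in> S" "g t = F s" by blast
    have "g t \<in> path_image g" unfolding path_image_def using t(1) by (intro imageI) auto
    then have "s \<in> U" using g t isometry_inj[OF F] by (auto simp: inj_image_mem_iff)
    moreover have inj: "inj_on g {0..1}" using g(1) by (simp add: arc_def)
    have "g t \<noteq> g 1" "g t \<noteq> g 0" using inj_onD[OF inj, of t 1] inj_onD[OF inj, of t 0] t(1) by auto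
    then have "s \<noteq> sample_a" "s \<noteq> cnj sample_a" using g(3,4) t(3) unfolding first_sample_eq pathstart_def pathfinish_def by metis+
    moreover have "\<bar>Im s\<bar> < tan8 * Re s \<and> norm s < 4" if sU: "s \<in> U" "s \<noteq> sample_a" "s \<noteq> cnj sample_a"
    proof -
      obtain y where y: "y \<in> first_gap" "s = y \<or> s = cnj y" using sU(1) unfolding U_def by blast
      then have "y \<noteq> sample_a" using sU by auto
      then show ?thesis using first_gap_sector[OF y(1)] y(2) by auto
    qed
    ultimately have "\<bar>Im s\<bar> < tan8 * Re s \<and> norm s < 4" by blast
    then show False using S_sector[of s] S t by blast
  qed
  define K where "K = connected_component_set (F ` curve 0 par') (F (first_sample 0))"
  have aC: "F (first_sample 0) \<in> F ` curve 0 par'" using g UC pathfinish_in_path_image by (metis subsetD)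
  have K: "K \<in> components (F ` curve 0 par')" unfolding K_def using aC by (rule componentsI)
  have UK: "F ` U \<subseteq> K" unfolding K_def
  proof (rule connected_component_maximal)
    show "F (first_sample 0) \<in> F ` U" using g pathfinish_in_path_image by metis
    show "connected (F ` U)" using g arc_imp_path connected_path_image by metis
  qed (rule UC)
  have e: "F (first_sample 7) \<in> F ` U" "F (first_sample 0) \<in> F ` U" using g pathfinish_in_path_image pathstart_in_path_image by metis+
  have "next_sample (F ` curve 0 par') (F ` S) (F (first_sample 7)) (F (first_sample 0))" unfolding next_sample_def
  proof (intro conjI bexI[OF _ K] exI[of _ g])
    show "F (first_sample 7) \<in> F ` S" "F (first_sample 0) \<in> F ` S" using first_sample_S[of 7] first_sample_S[of 0] S by auto
    show "F (first_sample 7) \<in> K" "F (first_sample 0) \<in> K" "path_image g \<subseteq> K" using e UK g(2) by auto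
    show "simple_path g" using g(1) by (rule arc_imp_simple_path)
  qed (use g av in auto)
  then show ?thesis unfolding consecutive_def ..
qed

text \<open>The path without its ends is connected and misses the overlap of the closed sets
  \<open>N\<close> and \<open>N'\<close>, so it lies in one of them, and by closedness so do its
  ends. The start rules out \<open>N'\<close>.\<close>

lemma path_stays:
  fixes g :: "real \<Rightarrow> 'a::metric_space"
  assumes g: "path g" "path_image g \<subseteq> N \<union> N'" "closed N" "closed N'" "N \<inter> N' \<subseteq> S" "g ` {0<..<1} \<inter> S = {}"
    and a: "pathstart g \<notin> N'"
  shows "pathfinish g \<in> N"
proof -
  let ?I = "{0<..<1::real}"
  have co: "continuous_on {0..1} g" using g(1) by (simp add: path_def)
  then have conn: "connected (g ` ?I)" by (intro connected_continuous_image) (auto intro: continuous_on_subset)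
  have sub: "g ` ?I \<subseteq> N \<union> N'" 
  proof -
    have "g ` ?I \<subseteq> g ` {0..1}" by (intro image_mono) auto
    then show ?thesis using g(2) unfolding path_image_def by (rule order_trans)
  qed
  have cl: "closure ?I = {0..1}" by simp
  have ext: "g ` {0..1} \<subseteq> M" if "closed M" "g ` ?I \<subseteq> M" for M
    using image_closure_subset[of ?I g M] that co unfolding cl by simp
  have "N \<inter> N' \<inter> g ` ?I = {}" using g(5,6) by blast
  then have "N \<inter> g ` ?I = {} \<or> N' \<inter> g ` ?I = {}"
    using connected_closedD[OF conn _ sub g(3,4)] by blast
  then have "g ` ?I \<subseteq> N' \<or> g ` ?I \<subseteq> N" using sub by blast
  then show ?thesis
  proof
    assume "g ` ?I \<subseteq> N'"
    then have "g 0 \<in> N'" using ext[OF g(4)] by auto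
    then show ?thesis using a by (simp add: pathstart_def)
  next
    assume "g ` ?I \<subseteq> N"
    then show ?thesis using ext[OF g(3)] by (auto simp: pathfinish_def)
  qed
qed

text \<open>In parity 1 the sample \<open>first_sample 0\<close> sits in pocket 1, which meets the
  rest of the curve only in its two ports. These are samples, so a path from there without inner
  samples cannot leave the pocket, and \<open>first_sample 7\<close> is outside it.\<close>

lemma edge_absent:
  assumes F: "isometry F" and S: "gsamples \<subseteq> S"
  shows "\<not> consecutive (F ` curve 1 par') (F ` S) (F (first_sample 7)) (F (first_sample 0))"
proof -
  define N where "N = F ` pocket_at 1"
  define N' where "N' = F ` (\<Union>e\<in>edge_family 1 par' - {PocketP 1}. edge_set e)"
  have f1: "PocketP 1 \<in> edge_family 1 par'" unfolding edge_family_def parity_eq by auto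
  have CN: "F ` curve 1 par' = N \<union> N'"
  proof -
    have "curve 1 par' = edge_set (PocketP 1) \<union> (\<Union>e\<in>edge_family 1 par' - {PocketP 1}. edge_set e)" unfolding curve_edge_family using f1 by blast
    then show ?thesis unfolding N_def N'_def by (simp add: image_Un)
  qed
  have esc: "compact (edge_set e)" for e by (cases e) (auto intro: pocket_at_compact strand_at_compact isometry_compact[OF isometry_mirror])
  have "finite (edge_family 1 par')" unfolding edge_family_def parity_def by auto
  then have cl: "closed N" "closed N'" unfolding N_def N'_def
    by (auto intro!: compact_imp_closed isometry_compact[OF F] pocket_at_compact compact_UN esc)
  have int: "x \<in> vertex_pos ` edge_ends (PocketP 1)" if "x \<in> pocket_at 1" "x \<in> (\<Union>e\<in>edge_family 1 par' - {PocketP 1}. edge_set e)" for x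
    using inter_edge_ends[OF f1] that by fastforce
  have v4: "norm x = 4" if "x \<in> vertex_pos ` edge_ends (PocketP 1)" for x using that by (auto simp: port_def norm_mult)
  have NN: "N \<inter> N' \<subseteq> F ` S"
  proof
    fix x assume "x \<in> N \<inter> N'"
    then obtain y where y: "y \<in> pocket_at 1" "y \<in> (\<Union>e\<in>edge_family 1 par' - {PocketP 1}. edge_set e)" "x = F y"
      unfolding N_def N'_def using isometry_inj[OF F] by (auto dest: injD)
    then have "y \<in> gsamples" using int[OF y(1,2)] gsamples_I[of 4 0] gsamples_I[of 4 1] by (auto simp: port_def)
    then show "x \<in> F ` S" using y S by blast
  qed
  have a0: "first_sample 0 \<in> pocket_at 1"
  proof -
    have "first_sample 0 = rot 1 (cnj sample_a)" using rot_scaled(2)[of 1 radius_a] by (simp add: first_sample_def sample_a_eq)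
    then show ?thesis unfolding pocket_at_def pocket_def using hchain_mem by blast
  qed
  have "F (first_sample 0) \<notin> N'"
  proof
    assume "F (first_sample 0) \<in> N'"
    then have "first_sample 0 \<in> (\<Union>e\<in>edge_family 1 par' - {PocketP 1}. edge_set e)" unfolding N'_def using isometry_inj[OF F] by (simp add: inj_image_mem_iff)
    then have "norm (first_sample 0) = 4" using v4 int a0 by blast
    then show False using radius_a_pos by (simp add: first_sample_def norm_mult)
  qed
  moreover have "F (first_sample 7) \<notin> N"
  proof
    assume "F (first_sample 7) \<in> N"
    then have "first_sample 7 \<in> pocket_at 1" unfolding N_def using isometry_inj[OF F] by (simp add: inj_image_mem_iff)
    then obtain y where y: "y \<in> pocket" "first_sample 7 = rot 1 y" unfolding pocket_at_def by auto
    \<comment> \<open>\<open>rot 7\<close> undoes \<open>rot 1\<close>. The point pulled back has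
      direction \<open>- \<i> * u0\<close>, outside the sector
      \<open>\<bar>Im y\<bar> < Re y\<close> that contains the unrotated pocket.\<close>
    have "rot 7 (first_sample 7) = rot 8 y" using y by (simp add: rot_comp)
    also have "\<dots> = y" using rot_8[of 0 y] by (simp add: rot_even)
    finally have "y = rot 7 (of_real radius_a * cis (ang 7))" by (simp add: first_sample_def)
    also have "\<dots> = rot 14 (of_real radius_a * u0)" by (simp add: rot_scaled(1)[symmetric] rot_comp)
    also have "\<dots> = rot 6 (of_real radius_a * u0)" using rot_8[of 6] by simp
    finally have ye: "y = - \<i> * (of_real radius_a * u0)" by (simp add: rot_even)
    obtain x where x: "x \<in> hchain" "y = x \<or> y = cnj x" using y(1) unfolding pocket_def by auto
    have "\<bar>Im y\<bar> = Im x" "Re y = Re x" using x hchain_wedge(1)[OF x(1)] by auto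
    then have "\<bar>Im y\<bar> < Re y" using hchain_wedge(2)[OF x(1)] by simp
    then have "radius_a * cos8 < radius_a * sin8" using ye radius_a_pos cos8_pos by (simp add: abs_mult)
    then have "cos8 < tan8 * cos8" using radius_a_pos sin8_eq by simp
    moreover have "tan8 * cos8 < 1 * cos8" using tan8_bounds cos8_pos by (intro mult_strict_right_mono) auto
    ultimately show False by simp
  qed
  moreover have key: "pathfinish g \<in> N" if "simple_path g" "path_image g \<subseteq> F ` curve 1 par'" "g ` {0<..<1} \<inter> F ` S = {}" "pathstart g \<notin> N'" for g
    using path_stays[OF _ _ cl NN] that simple_path_imp_path CN by metis
  \<comment> \<open>The argument needs a path that starts at \<open>first_sample 0\<close>; reversal
    covers the opposite direction allowed by \<open>consecutive\<close>.\<close>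
  have rev: "reversepath g ` {0<..<1} = g ` {0<..<1}" for g :: "real \<Rightarrow> real^2"
  proof (intro equalityI subsetI)
    fix y assume "y \<in> reversepath g ` {0<..<1}"
    then obtain x where "x \<in> {0<..<1}" "y = g (1 - x)" by (auto simp: reversepath_def)
    then show "y \<in> g ` {0<..<1}" by (intro image_eqI[of _ _ "1 - x"]) auto
  next
    fix y assume "y \<in> g ` {0<..<1}"
    then obtain x where "x \<in> {0<..<1}" "y = g x" by auto
    then show "y \<in> reversepath g ` {0<..<1}" by (intro image_eqI[of _ _ "1 - x"]) (auto simp: reversepath_def)
  qed
  ultimately show ?thesis
  proof -
    have False if g: "simple_path g" "path_image g \<subseteq> F ` curve 1 par'" "g ` {0<..<1} \<inter> F ` S = {}"
      "pathstart g = F (first_sample 0)" "pathfinish g = F (first_sample 7)" for g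
      using key[OF g(1-3)] g(4,5) \<open>F (first_sample 0) \<notin> N'\<close> \<open>F (first_sample 7) \<notin> N\<close> by simp
    note F0 = this
    have F7: False if g: "simple_path g" "path_image g \<subseteq> F ` curve 1 par'" "g ` {0<..<1} \<inter> F ` S = {}"
      "pathstart g = F (first_sample 7)" "pathfinish g = F (first_sample 0)" for g
      using F0[of "reversepath g"] g rev by (simp add: simple_path_reversepath)
    have ex: "\<exists>g. simple_path g \<and> path_image g \<subseteq> F ` curve 1 par' \<and> g ` {0<..<1} \<inter> F ` S = {} \<and> pathstart g = a \<and> pathfinish g = b"
      if n: "next_sample (F ` curve 1 par') (F ` S) a b" for a b
    proof -
      from n obtain K g where k: "K \<in> components (F ` curve 1 par')" and h: "simple_path g" "pathstart g = a" "pathfinish g = b"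
        "path_image g \<subseteq> K" "g ` {0<..<1} \<inter> F ` S = {}" unfolding next_sample_def by blast
      have "path_image g \<subseteq> F ` curve 1 par'" using h(4) in_components_subset[OF k] by (rule order_trans)
      then show ?thesis using h by (intro exI[of _ g] conjI)
    qed
    show ?thesis unfolding consecutive_def
    proof
      assume "next_sample (F ` curve 1 par') (F ` S) (F (first_sample 7)) (F (first_sample 0)) \<or> next_sample (F ` curve 1 par') (F ` S) (F (first_sample 0)) (F (first_sample 7))"
      then show False
      proof
        assume "next_sample (F ` curve 1 par') (F ` S) (F (first_sample 7)) (F (first_sample 0))"
        from ex[OF this] show False by (elim exE conjE) (rule F7)
      next
        assume "next_sample (F ` curve 1 par') (F ` S) (F (first_sample 0)) (F (first_sample 7))"
        from ex[OF this] show False by (elim exE conjE) (rule F0)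
      qed
    qed
  qed
qed

lemma edge_iff:
  assumes "a \<in> S" "b \<in> S"
  shows "{a, b} \<in> snd (sample_graph C S) \<longleftrightarrow> consecutive C S a b"
  unfolding sample_graph_def using assms by (auto simp: doubleton_eq_iff consecutive_def)

section \<open>Transfer to the real plane\<close>

definition Phi :: "complex \<Rightarrow> real^2" where "Phi z = vector [Re z, Im z]"

lemma isometry_Phi: "isometry Phi"
proof -
  have "Phi (Complex (x $ 1) (x $ 2)) = x" for x by (simp add: Phi_def vec_eq_iff forall_2)
  then have "surj Phi" by (rule surjI)
  moreover have "dist (Phi x) (Phi y) = dist x y" for x y
    unfolding dist_norm norm_vec_def L2_set_def cmod_def by (simp add: Phi_def sum_2)
  ultimately show ?thesis unfolding isometry_def by blast
qed

theorem theorem4p1: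
  shows "\<exists>(S :: (real^2) set) C1 C2 C3 C4.
    finite S \<and>
    connected C1 \<and> closed_curve C1 \<and> connected C2 \<and> closed_curve C2 \<and>
    curve_union C3 \<and> \<not> connected C3 \<and> curve_union C4 \<and> \<not> connected C4 \<and>
    eps_sample C1 S 0.72 \<and> eps_sample C2 S 0.72 \<and> eps_sample C3 S 0.72 \<and> eps_sample C4 S 0.72 \<and>
    sample_graph C1 S \<noteq> sample_graph C2 S \<and> sample_graph C1 S \<noteq> sample_graph C3 S \<and>
    sample_graph C1 S \<noteq> sample_graph C4 S \<and> sample_graph C2 S \<noteq> sample_graph C3 S \<and>
    sample_graph C2 S \<noteq> sample_graph C4 S \<and> sample_graph C3 S \<noteq> sample_graph C4 S"
proof -
  let ?C = "\<lambda>p q. Phi ` curve p q"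
  note P = isometry_Phi
  \<comment> \<open>One bound for all four curves, so that a single net works for each of
    them.\<close>
  have "\<exists>\<mu>>0. \<forall>p<2. \<forall>q<2. \<forall>z\<in>common_part. \<mu> \<le> lfs (?C p q) (Phi z)"
  proof -
    obtain m where m: "m p q > 0 \<and> (\<forall>z\<in>common_part. m p q \<le> lfs (?C p q) (Phi z))" if "p < 2" "q < 2" for p q
      using lfs_common_part[OF P] by metis
    define \<mu> where "\<mu> = min (min (m 0 0) (m 0 1)) (min (m 1 0) (m 1 1))"
    have "\<mu> \<le> m p q" if "p < 2" "q < 2" for p q
    proof -
      have "p = 0 \<or> p = 1" "q = 0 \<or> q = 1" using that by auto
      then show ?thesis by (elim disjE) (simp_all add: \<mu>_def)
    qed
    moreover have "\<mu> > 0" unfolding \<mu>_def using m by simp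
    ultimately show ?thesis using m by (meson order_trans)
  qed
  then obtain \<mu> where \<mu>: "\<mu> > 0" "\<And>p q z. p < 2 \<Longrightarrow> q < 2 \<Longrightarrow> z \<in> common_part \<Longrightarrow> \<mu> \<le> lfs (?C p q) (Phi z)" by metis
  obtain N0 where N0: "finite N0" "N0 \<subseteq> common_part" "common_part \<subseteq> (\<Union>x\<in>N0. ball x (0.72 * \<mu>))"
  proof (rule compactE_image[OF common_part_compact, of common_part "\<lambda>x. ball x (0.72 * \<mu>)"])
    show "common_part \<subseteq> (\<Union>x\<in>common_part. ball x (0.72 * \<mu>))" using \<mu>(1) by auto
  qed (use that in auto)
  \<comment> \<open>Closing the net under \<open>mirror\<close> makes \<open>S\<close> symmetric;
    the second gadget can then be treated as the first gadget of the mirrored curve.\<close>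
  define N where "N = N0 \<union> mirror ` N0"
  have N: "finite N" "N \<subseteq> common_part" unfolding N_def using N0 mirror_common_part by auto
  define S where "S = gsamples \<union> mirror ` gsamples \<union> N"
  have Sref: "mirror ` S = S" unfolding S_def N_def image_Un image_image by auto
  have eps: "eps_sample (?C p q) (Phi ` S) 0.72" if pq: "p < 2" "q < 2" for p q
  proof (rule eps_curve[OF P pq S_def N])
    fix z assume z: "z \<in> common_part"
    then obtain s where "s \<in> N0" "dist s z < 0.72 * \<mu>" using N0 by auto
    then show "\<exists>s\<in>N. dist z s < 0.72 * lfs (?C p q) (Phi z)"
      using \<mu>(2)[OF pq z] by (intro bexI[of _ s]) (auto simp: N_def dist_commute)
  qed
  have SS: "gsamples \<subseteq> S" "S \<subseteq> gsamples \<union> mirror ` gsamples \<union> common_part" using N unfolding S_def by auto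
  have Sal: "F (first_sample 7) \<in> F ` S" "F (first_sample 0) \<in> F ` S" for F :: "complex \<Rightarrow> real^2" using first_sample_S[of 7] first_sample_S[of 0] SS by auto
  \<comment> \<open>For parities in {0, 1}, \<open>eP\<close> is an edge iff the first parity is 0
    and \<open>eQ\<close> iff the second is 0; any two of the four parity pairs differ in one of
    them.\<close>
  define eP where "eP = {Phi (first_sample 7), Phi (first_sample 0)}"
  define eQ where "eQ = {Phi (mirror (first_sample 7)), Phi (mirror (first_sample 0))}"
  have eP: "eP \<in> snd (sample_graph (?C 0 q) (Phi ` S))" "eP \<notin> snd (sample_graph (?C 1 q) (Phi ` S))" for q
    unfolding eP_def edge_iff[OF Sal] using edge_present[OF P SS] edge_absent[OF P SS(1)] by auto
  have PR: "isometry (Phi \<circ> mirror)" by (rule isometry_comp[OF P isometry_mirror])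
  have im: "(Phi \<circ> mirror) ` S = Phi ` S" "(Phi \<circ> mirror) ` curve p q = ?C q p" for p q
    unfolding image_comp[symmetric] Sref mirror_curve by auto
  have eQ: "eQ \<in> snd (sample_graph (?C p 0) (Phi ` S))" "eQ \<notin> snd (sample_graph (?C p 1) (Phi ` S))" for p
    using edge_iff[OF Sal[of "Phi \<circ> mirror"]] edge_present[OF PR SS] edge_absent[OF PR SS(1)]
    unfolding eQ_def im by auto
  have C10: "?C 1 0 = (Phi \<circ> mirror) ` curve 0 1" using im by simp
  show ?thesis
  proof (rule exI[of _ "Phi ` S"], rule exI[of _ "?C 0 1"], rule exI[of _ "?C 1 0"], rule exI[of _ "?C 0 0"], rule exI[of _ "?C 1 1"], intro conjI)
    show "finite (Phi ` S)" using N gsamples_finite by (simp add: S_def)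
    show "connected (?C 0 1)" "closed_curve (?C 0 1)" using CC01_curve[OF P] by auto
    show "connected (?C 1 0)" "closed_curve (?C 1 0)" unfolding C10 using CC01_curve[OF PR] by auto
    show "curve_union (?C 0 0)" "\<not> connected (?C 0 0)" using curve_diag[OF P, of 0] by auto
    show "curve_union (?C 1 1)" "\<not> connected (?C 1 1)" using curve_diag[OF P, of 1] by auto
    show "eps_sample (?C 0 1) (Phi ` S) 0.72" "eps_sample (?C 1 0) (Phi ` S) 0.72"
      "eps_sample (?C 0 0) (Phi ` S) 0.72" "eps_sample (?C 1 1) (Phi ` S) 0.72" by (intro eps; simp)+
    show "sample_graph (?C 0 1) (Phi ` S) \<noteq> sample_graph (?C 1 0) (Phi ` S)" using eP by metis
    show "sample_graph (?C 0 1) (Phi ` S) \<noteq> sample_graph (?C 0 0) (Phi ` S)" using eQ by metis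
    show "sample_graph (?C 0 1) (Phi ` S) \<noteq> sample_graph (?C 1 1) (Phi ` S)" using eP by metis
    show "sample_graph (?C 1 0) (Phi ` S) \<noteq> sample_graph (?C 0 0) (Phi ` S)" using eP by metis
    show "sample_graph (?C 1 0) (Phi ` S) \<noteq> sample_graph (?C 1 1) (Phi ` S)" using eQ by metis
    show "sample_graph (?C 0 0) (Phi ` S) \<noteq> sample_graph (?C 1 1) (Phi ` S)" using eP by metis
  qed
qed

end
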